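(* Let $C\ge1$, $d\ge 1$, $T>0$, let $f_1,\dots,f_C$ be probability densities on $\mathbb{R}^d$, and let $\mathfrak{X}=\{\vec X_t=(X^{(1)}_t,\dots,X^{(C)}_t),\,t\in[0,T]\}$ satisfy, for $c\in\{1,\dots,C\}$, $$dX_t^{(c)}=\frac{\bar X_t-X_t^{(c)}}{T-t}\,dt+dW_t^{(c)},\qquad X_0^{(c)}\sim f_c,\qquad \bar X_t:=\frac1C\sum_{c=1}^C X_t^{(c)},\quad t\in[0,T].$$ Then: 1. For $0\le s<t\le T$, conditionally on $\vec X_s=\vec x_s=(x_s^{(1)},\dots,x_s^{(C)})$, $\vec X_t$ is multivariate Gaussian $\mathcal N(\vec M_{s,t},V_{s,t})$, where $\vec M_{s,t}=(M_{s,t}^{(1)},\dots,M_{s,t}^{(C)})$ with $$M_{s,t}^{(c)}=\frac{T-t}{T-s}\,x_s^{(c)}+\frac{t-s}{T-s}\,\bar x_s,\qquad \bar x_s=\frac1C\sum_{c=1}^C x_s^{(c)},$$ and $V_{s,t}=\Sigma\otimes I_{d\times d}$ with $\Sigma=(\Sigma_{ij})$ the $C\times C$ matrix $$\Sigma_{ii}=\frac{(t-s)(T-t)}{T-s}+\frac{(t-s)^2}{C(T-s)},\qquad \Sigma_{ij}=\frac{(t-s)^2}{C(T-s)}\quad(i\ne j).$$ 2. For every $c\in\{1,\dots,C\}$, the distribution of $\{X_u^{(c)},\,s\le u\le t\}$ given the endpoints $X_s^{(c)}=x_s^{(c)}$ and $X_t^{(c)}=x_t^{(c)}$ is a Brownian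 bridge, so that $$X_u^{(c)}\,\big|\,(x_s^{(c)},x_t^{(c)})\ \sim\ \mathcal N\Big(\frac{(t-u)x_s^{(c)}+(u-s)x_t^{(c)}}{t-s},\ \frac{(u-s)(t-u)}{t-s}\,I_{d\times d}\Big).$$
   Context: $W^{(1)},\dots,W^{(C)}$ are independent $d$-dimensional Brownian motions; the initial values $X_0^{(1)},\dots,X_0^{(C)}$ are independent of each other and of the Brownian motions. The value of the process at time $T$ is the limit as $t\uparrow T$. The law of $\mathfrak X$ is called the proposal measure. $I_{d\times d}$ is the identity matrix and $\otimes$ the Kronecker product. *)

theory Defs
  imports "HOL-Probability.Probability"
begin

section \<open>Gaussian measures\<close>

text \<open>The one-dimensional normal law is parametrised by its variance and may be degenerate:
  variance 0 is the Dirac measure.  (The library's \<^const>\<open>normal_density\<close> takes the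
  standard deviation, and is meaningful for positive ones only.)\<close>

definition normal_law :: "real measure \<Rightarrow> real \<Rightarrow> real \<Rightarrow> bool" where
  "normal_law P m v \<longleftrightarrow>
     0 \<le> v \<and>
     P = (if v = 0 then return borel m
          else density lborel (\<lambda>x. ennreal (normal_density m (sqrt v) x)))"

text \<open>The law N(m, V) on Euclidean space, for a possibly singular covariance matrix V:
  every linear functional is univariate normal.\<close>

definition multivariate_normal :: "(real^'n) measure \<Rightarrow> real^'n \<Rightarrow> real^'n^'n \<Rightarrow> bool" where
  "multivariate_normal P m V \<longleftrightarrow>
     prob_space P \<and> sets P = sets borel \<and> transpose V = V \<and>
     (\<forall>a. normal_law (distr P borel (\<lambda>x. a \<bullet> x)) (a \<bullet> m) (a \<bullet> (V *v a)))"

definition kronecker :: "real^'n^'m \<Rightarrow> real^'q^'p \<Rightarrow> real^('n \<times> 'q)^('m \<times> 'p)" where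
  "kronecker A B = (\<chi> i j. A $ fst i $ fst j * B $ snd i $ snd j)"

text \<open>A family of C vectors in d dimensions, read as one vector with Cd entries; the index
  order is that of \<^const>\<open>kronecker\<close>.\<close>

definition stack :: "real^'d^'c \<Rightarrow> real^('c \<times> 'd)" where
  "stack x = (\<chi> p. x $ fst p $ snd p)"

section \<open>Conditional laws\<close>

text \<open>\<open>K\<close> is a regular version of the conditional law of \<open>Y\<close> given \<open>X\<close>.\<close>

definition regular_cond_law ::
  "'a measure \<Rightarrow> 'b measure \<Rightarrow> ('a \<Rightarrow> 'b) \<Rightarrow> 'e measure \<Rightarrow> ('a \<Rightarrow> 'e) \<Rightarrow> ('b \<Rightarrow> 'e measure) \<Rightarrow> bool"
where
  "regular_cond_law M N X L Y K \<longleftrightarrow>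
     X \<in> M \<rightarrow>\<^sub>M N \<and> Y \<in> M \<rightarrow>\<^sub>M L \<and> K \<in> N \<rightarrow>\<^sub>M prob_algebra L \<and>
     (\<forall>A\<in>sets N. \<forall>B\<in>sets L.
        emeasure M {\<omega> \<in> space M. X \<omega> \<in> A \<and> Y \<omega> \<in> B} =
        (\<integral>\<^sup>+x\<in>A. emeasure (K x) B \<partial>distr M N X))"

section \<open>Brownian motion and Brownian bridge\<close>

definition brownian_motion :: "'a measure \<Rightarrow> (real \<Rightarrow> 'a \<Rightarrow> real^'d) \<Rightarrow> bool" where
  "brownian_motion M W \<longleftrightarrow>
     prob_space M \<and>
     (\<forall>t\<ge>0. W t \<in> borel_measurable M) \<and>
     (AE \<omega> in M. W 0 \<omega> = 0) \<and>
     (AE \<omega> in M. continuous_on {0..} (\<lambda>t. W t \<omega>)) \<and>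
     (\<forall>s t. 0 \<le> s \<and> s < t \<longrightarrow>
        multivariate_normal (distr M borel (\<lambda>\<omega>. W t \<omega> - W s \<omega>)) 0 ((t - s) *\<^sub>R mat 1)) \<and>
     (\<forall>(n::nat) \<tau>. 0 \<le> \<tau> 0 \<and> (\<forall>i<n. \<tau> i \<le> \<tau> (Suc i)) \<longrightarrow>
        prob_space.indep_vars M (\<lambda>_. borel) (\<lambda>i \<omega>. W (\<tau> (Suc i)) \<omega> - W (\<tau> i) \<omega>) {..<n})"

text \<open>The law, on paths over \<open>[s,t]\<close>, of the d-dimensional Brownian bridge from \<open>x\<close> at time \<open>s\<close>
  to \<open>y\<close> at time \<open>t\<close>: the continuous Gaussian process with mean
  \<open>((t - u) x + (u - s) y) / (t - s)\<close> and covariance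
  \<open>(min u v - s) (t - max u v) / (t - s)\<close> times the identity.
  The set of continuous paths is not measurable in the product sigma-algebra, so path
  continuity is expressed by that set having outer measure 1.\<close>

definition brownian_bridge_law ::
  "real \<Rightarrow> real \<Rightarrow> real^'d \<Rightarrow> real^'d \<Rightarrow> (real \<Rightarrow> real^'d) measure \<Rightarrow> bool"
where
  "brownian_bridge_law s t x y P \<longleftrightarrow>
     prob_space P \<and> sets P = sets (\<Pi>\<^sub>M u\<in>{s..t}. (borel :: (real^'d) measure)) \<and>
     (\<forall>J a. finite J \<and> J \<subseteq> {s..t} \<longrightarrow>
        normal_law (distr P borel (\<lambda>\<omega>. \<Sum>u\<in>J. a u \<bullet> \<omega> u))
          (\<Sum>u\<in>J. a u \<bullet> ((1 / (t - s)) *\<^sub>R ((t - u) *\<^sub>R x + (u - s) *\<^sub>R y)))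
          (\<Sum>u\<in>J. \<Sum>v\<in>J. (min u v - s) * (t - max u v) / (t - s) * (a u \<bullet> a v))) \<and>
     (\<forall>A\<in>sets P. {\<omega> \<in> space P. continuous_on {s..t} \<omega>} \<subseteq> A \<longrightarrow> emeasure P A = 1)"

section \<open>The interacting system\<close>

definition prob_density :: "(real^'d \<Rightarrow> real) \<Rightarrow> bool" where
  "prob_density f \<longleftrightarrow>
     f \<in> borel_measurable borel \<and> (\<forall>x. 0 \<le> f x) \<and> (\<integral>\<^sup>+x. ennreal (f x) \<partial>lborel) = 1"

definition average :: "real^'d^'c \<Rightarrow> real^'d" where
  "average x = (1 / real CARD('c)) *\<^sub>R (\<Sum>c\<in>UNIV. x $ c)"

definition joint :: "('c \<Rightarrow> real \<Rightarrow> 'a \<Rightarrow> real^'d) \<Rightarrow> real \<Rightarrow> 'a \<Rightarrow> real^'d^'c" where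
  "joint X t \<omega> = (\<chi> c. X c t \<omega>)"

definition drift ::
  "real \<Rightarrow> ('c::finite \<Rightarrow> real \<Rightarrow> 'a \<Rightarrow> real^'d) \<Rightarrow> 'c \<Rightarrow> real \<Rightarrow> 'a \<Rightarrow> real^'d"
where
  "drift T X c t \<omega> = (1 / (T - t)) *\<^sub>R (average (joint X t \<omega>) - X c t \<omega>)"

text \<open>Since the noise is additive, the SDE is a pathwise integral equation and no stochastic
  integral is involved.  The drift is singular at \<open>T\<close>, so the equation is imposed on \<open>[0,T)\<close>.\<close>

definition sde_solution ::
  "'a measure \<Rightarrow> real \<Rightarrow> ('c::finite \<Rightarrow> real \<Rightarrow> 'a \<Rightarrow> real^'d) \<Rightarrow> ('c \<Rightarrow> real \<Rightarrow> 'a \<Rightarrow> real^'d) \<Rightarrow> bool"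
where
  "sde_solution M T W X \<longleftrightarrow>
     (\<forall>c. AE \<omega> in M.
        continuous_on {0..<T} (\<lambda>t. X c t \<omega>) \<and>
        (\<forall>t\<in>{0..<T}.
           set_integrable lborel {0..t} (\<lambda>r. drift T X c r \<omega>) \<and>
           X c t \<omega> = X c 0 \<omega> + (LINT r:{0..t}|lborel. drift T X c r \<omega>) + W c t \<omega>))"

definition cond_mean :: "real \<Rightarrow> real \<Rightarrow> real \<Rightarrow> real^'d^'c \<Rightarrow> real^'d^'c" where
  "cond_mean T s t x =
     (\<chi> c. ((T - t) / (T - s)) *\<^sub>R (x $ c) + ((t - s) / (T - s)) *\<^sub>R average x)"

definition cond_Sigma :: "real \<Rightarrow> real \<Rightarrow> real \<Rightarrow> real^'c^'c" where
  "cond_Sigma T s t =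
     (\<chi> i j. if i = j
        then (t - s) * (T - t) / (T - s) + (t - s)\<^sup>2 / (real CARD('c) * (T - s))
        else (t - s)\<^sup>2 / (real CARD('c) * (T - s)))"

end

theory Submission
  imports Defs
begin

text \<open>The mean path is driven by the averaged noise alone, and subtracting it leaves a linear equation with
  integrating factor \<open>1 / (T - t)\<close>.  Hence, pathwise, the position of particle \<open>c\<close> at time \<open>u\<close> is the
  point at time \<open>u\<close> of the chord from \<open>X c 0\<close> to the initial mean, plus a Wiener integral \<open>G\<close> of an
  explicit kernel; by L'Hopital's rule this persists up to time \<open>T\<close>.  Approximating \<open>G\<close> by
  Riemann-Stieltjes sums over Brownian increments shows that it is centred Gaussian, independent of the
  initial values, with covariance
  \<open>\<delta>(c,c') (min u v - u v / T) + u v / (C T)\<close> in each of the \<open>d\<close> coordinates.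

  Both claims are then regressions: \<open>X t - M s t (X s)\<close>, respectively the deviation of \<open>X c u\<close> from the
  chord between its endpoint positions, does not involve the initial values and is uncorrelated with the
  noise in the conditioning variables, hence independent of them.  Multidimensional
  uniqueness of characteristic functions, which turns uncorrelated into independent, is obtained one
  coordinate at a time from the one-dimensional theorem.\<close>

section \<open>Independence from characteristic functions\<close>

text \<open>The initial laws are arbitrary, so the states are not jointly Gaussian and Gaussian
  conditioning does not apply to them directly. A residual has to do two things at once: cancel the
  chord to the initial mean exactly, and be orthogonal to the noise in the conditioning variables.
  Both happen for structural reasons. The averaged noise has covariance \<open>min u v / C\<close>,
  that of a scaled Brownian motion; the deviations from it have covariance
  \<open>(\<delta> - 1 / C) * (min u v - u v / T)\<close>, that of bridges pinned to 0 at time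
  \<open>T\<close>. These regress on time \<open>s\<close> with factors 1 and
  \<open>(T - t) / (T - s)\<close>, and the same factors carry the average and the deviations of the
  chord from \<open>s\<close> to \<open>t\<close>; together they give \<open>M s t\<close>. A single
  particle has noise covariance \<open>min u v - \<kappa> u v\<close>. Interpolating between two
  times annihilates functions affine in time, hence both the chord and the \<open>\<kappa>\<close>
  term; what is left is the computation for Brownian motion, which is why the bridge law involves
  neither \<open>T\<close> nor \<open>C\<close>.\<close>

lemma integrable_bounded:
  fixes U :: "'a \<Rightarrow> 'b::{banach, second_countable_topology}"
  assumes "prob_space M" "U \<in> borel_measurable M" "\<And>\<omega>. norm (U \<omega>) \<le> B"
  shows "integrable M U"
proof -
  interpret prob_space M by fact
  show ?thesis using assms by (intro integrable_const_bound[where B = B]) auto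
qed

lemma norm_indicator_le_1: "norm (indicator A x :: 'b::real_normed_algebra_1) \<le> 1"
  by (auto simp: indicator_def)

text \<open>Tilting \<open>M\<close> by the density \<open>1 + V / (B + 1)\<close> leaves the characteristic function of \<open>Y\<close>
  unchanged, so one-dimensional Levy uniqueness applies.\<close>

lemma real_tilt_vanishes:
  fixes V Y :: "'a \<Rightarrow> real"
  assumes M: "prob_space M" and V[measurable]: "V \<in> borel_measurable M"
    and bd: "\<And>\<omega>. \<bar>V \<omega>\<bar> \<le> B"
    and Y[measurable]: "Y \<in> borel_measurable M"
    and ch: "\<And>t. (LINT \<omega>|M. of_real (V \<omega>) * iexp (t * Y \<omega>)) = 0"
    and A[measurable]: "A \<in> sets borel"
  shows "(LINT \<omega>|M. V \<omega> * indicator A (Y \<omega>)) = 0"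
proof -
  interpret prob_space M by fact
  have B1: "\<bar>V \<omega>\<bar> \<le> B + 1" "B + 1 > 0" for \<omega>
    using bd[of \<omega>] abs_ge_zero[of "V \<omega>"] by linarith+
  \<comment> \<open>\<open>B + 1\<close> instead of \<open>B\<close> keeps the denominator positive.
    Then \<open>0 \<le> h \<le> 2\<close>, and \<open>ch\<close> at \<open>t = 0\<close> says that
    \<open>V\<close> has mean 0, so \<open>h\<close> is a probability density.\<close>
  define h where "h \<omega> = 1 + V \<omega> / (B + 1)" for \<omega>
  have h0: "h \<omega> \<ge> 0" for \<omega>
    using B1(1)[of \<omega>] B1(2) by (auto simp: h_def field_simps abs_le_iff)
  have h2: "\<bar>h \<omega>\<bar> \<le> 2" for \<omega>
    using B1(1)[of \<omega>] B1(2) by (auto simp: h_def field_simps abs_le_iff)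
  have [measurable]: "h \<in> borel_measurable M" unfolding h_def by measurable
  have iV: "integrable M (\<lambda>\<omega>. of_real (V \<omega>) * iexp (t * Y \<omega>))" for t
    using bd by (intro integrable_bounded[OF M, where B = B]) (auto simp: norm_mult)
  have ih: "integrable M h" using h2 by (intro integrable_bounded[OF M, where B = 2]) auto
  have iVr: "integrable M V" using bd by (intro integrable_bounded[OF M, where B = B]) auto
  have "complex_of_real (integral\<^sup>L M V) = 0" using ch[of 0] by simp
  then have V0: "integral\<^sup>L M V = 0" by simp
  have hint: "integral\<^sup>L M h = 1"
    unfolding h_def using iVr V0 by (subst Bochner_Integration.integral_add) (auto simp: prob_space)
  define N where "N = density M (\<lambda>\<omega>. ennreal (h \<omega>))"
  have "emeasure N (space N) = 1"
    unfolding N_def using hint nn_integral_eq_integral[OF ih] h0 by (simp add: emeasure_density cong: nn_integral_cong)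
  then have N: "prob_space N" by (rule prob_spaceI)
  have [measurable]: "Y \<in> borel_measurable N" unfolding N_def by simp
  have rd: "real_distribution (distr M borel Y)" "real_distribution (distr N borel Y)"
    by (auto intro!: real_distribution_distr prob_space.real_distribution_distr[OF N])
  have "char (distr N borel Y) t = char (distr M borel Y) t" for t
  proof -
    have "char (distr N borel Y) t = (LINT \<omega>|N. iexp (t * Y \<omega>))"
      unfolding char_def by (subst integral_distr) auto
    also have "\<dots> = (LINT \<omega>|M. h \<omega> *\<^sub>R iexp (t * Y \<omega>))"
      unfolding N_def using h0 by (subst integral_density) auto
    also have "\<dots> = (LINT \<omega>|M. iexp (t * Y \<omega>) + of_real (V \<omega>) * iexp (t * Y \<omega>) / of_real (B + 1))"
      by (intro Bochner_Integration.integral_cong) (auto simp: h_def scaleR_conv_of_real field_simps)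
    also have "\<dots> = (LINT \<omega>|M. iexp (t * Y \<omega>))"
      using iV[of t] ch[of t]
      by (subst Bochner_Integration.integral_add)
        (auto intro!: integrable_bounded[OF M, where B = 1])
    also have "\<dots> = char (distr M borel Y) t"
      unfolding char_def by (subst integral_distr) auto
    finally show ?thesis .
  qed
  then have eq: "distr N borel Y = distr M borel Y"
    using rd by (intro Levy_uniqueness) auto
  have "(LINT \<omega>|M. h \<omega> *\<^sub>R (indicator A (Y \<omega>) :: real)) = (LINT \<omega>|N. indicator A (Y \<omega>))"
    unfolding N_def using h0 by (subst integral_density) auto
  also have "\<dots> = (LINT y|distr N borel Y. indicator A y)" by (subst integral_distr) auto
  also have "\<dots> = (LINT y|distr M borel Y. indicator A y)" unfolding eq ..
  also have "\<dots> = (LINT \<omega>|M. indicator A (Y \<omega>))" by (subst integral_distr) auto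
  finally have e: "(LINT \<omega>|M. h \<omega> *\<^sub>R (indicator A (Y \<omega>) :: real)) = (LINT \<omega>|M. indicator A (Y \<omega>))" .
  have i1: "integrable M (\<lambda>\<omega>. indicator A (Y \<omega>) :: real)"
    by (intro integrable_bounded[OF M, where B = 1]) (auto simp: norm_indicator_le_1)
  have i2: "integrable M (\<lambda>\<omega>. V \<omega> * indicator A (Y \<omega>))"
    using bd order_trans[OF abs_ge_zero bd]
    by (intro integrable_bounded[OF M, where B = B]) (auto simp: indicator_def)
  have "(LINT \<omega>|M. h \<omega> *\<^sub>R (indicator A (Y \<omega>) :: real)) =
     (LINT \<omega>|M. indicator A (Y \<omega>) + V \<omega> * indicator A (Y \<omega>) / (B + 1))"
    by (intro Bochner_Integration.integral_cong) (auto simp: h_def algebra_simps)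
  also have "\<dots> = (LINT \<omega>|M. indicator A (Y \<omega>)) + (LINT \<omega>|M. V \<omega> * indicator A (Y \<omega>)) / (B + 1)"
    using i1 i2 by (subst Bochner_Integration.integral_add) auto
  finally show ?thesis using e B1(2) by simp
qed

text \<open>Conjugating the hypothesis at \<open>- t\<close> gives the same hypothesis for
  \<open>cnj U\<close>. The real and imaginary parts of \<open>U\<close> are combinations of the
  two, so each satisfies the real version.\<close>

lemma complex_char_vanishes:
  fixes U :: "'a \<Rightarrow> complex" and Y :: "'a \<Rightarrow> real"
  assumes M: "prob_space M" and U[measurable]: "U \<in> borel_measurable M"
    and bd: "\<And>\<omega>. norm (U \<omega>) \<le> B"
    and Y[measurable]: "Y \<in> borel_measurable M"
    and ch: "\<And>t. (LINT \<omega>|M. U \<omega> * iexp (t * Y \<omega>)) = 0"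
    and A[measurable]: "A \<in> sets borel"
  shows "(LINT \<omega>|M. U \<omega> * indicator A (Y \<omega>)) = 0"
proof -
  have B0: "0 \<le> B" using order_trans[OF norm_ge_zero bd] .
  have iU: "integrable M (\<lambda>\<omega>. U \<omega> * iexp (t * Y \<omega>))" for t
    using bd by (intro integrable_bounded[OF M, where B = B]) (auto simp: norm_mult)
  have ch': "(LINT \<omega>|M. cnj (U \<omega>) * iexp (t * Y \<omega>)) = 0" for t
  proof -
    have "(LINT \<omega>|M. cnj (U \<omega>) * iexp (t * Y \<omega>)) = (LINT \<omega>|M. cnj (U \<omega> * iexp ((-t) * Y \<omega>)))"
      by (intro Bochner_Integration.integral_cong) (auto simp: exp_cnj)
    also have "\<dots> = cnj (LINT \<omega>|M. U \<omega> * iexp ((-t) * Y \<omega>))"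
      by (rule Bochner_Integration.integral_cnj)
    finally show ?thesis using ch[of "-t"] by simp
  qed
  have [measurable]: "(\<lambda>\<omega>. cnj (U \<omega>)) \<in> borel_measurable M"
    by (rule measurable_compose[OF U borel_measurable_continuous_onI[OF continuous_on_cnj[OF continuous_on_id]]])
  have iU': "integrable M (\<lambda>\<omega>. cnj (U \<omega>) * iexp (t * Y \<omega>))" for t
    using bd by (intro integrable_bounded[OF M, where B = B]) (auto simp: norm_mult)
  have "(LINT \<omega>|M. of_real (Re (U \<omega>)) * iexp (t * Y \<omega>)) = 0" for t
  proof -
    have "(LINT \<omega>|M. of_real (Re (U \<omega>)) * iexp (t * Y \<omega>)) =
      (LINT \<omega>|M. U \<omega> * iexp (t * Y \<omega>) / 2 + cnj (U \<omega>) * iexp (t * Y \<omega>) / 2)"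
      by (intro Bochner_Integration.integral_cong) (auto simp: complex_add_cnj[symmetric] field_simps complex_eq_iff)
    also have "\<dots> = 0" using iU iU' ch ch' by (subst Bochner_Integration.integral_add) auto
    finally show ?thesis .
  qed
  then have 1: "(LINT \<omega>|M. Re (U \<omega>) * indicator A (Y \<omega>)) = 0"
    using order_trans[OF abs_Re_le_cmod bd] by (intro real_tilt_vanishes[OF M, where B = B]) auto
  have "(LINT \<omega>|M. of_real (Im (U \<omega>)) * iexp (t * Y \<omega>)) = 0" for t
  proof -
    have "(LINT \<omega>|M. of_real (Im (U \<omega>)) * iexp (t * Y \<omega>)) =
      (LINT \<omega>|M. (- \<i> / 2) * (U \<omega> * iexp (t * Y \<omega>)) - (- \<i> / 2) * (cnj (U \<omega>) * iexp (t * Y \<omega>)))"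
      by (intro Bochner_Integration.integral_cong) (auto simp: field_simps complex_eq_iff)
    also have "\<dots> = 0"
      by (subst Bochner_Integration.integral_diff[OF integrable_mult_right[OF iU] integrable_mult_right[OF iU']])
        (simp only: integral_mult_right_zero ch ch', simp)
    finally show ?thesis .
  qed
  then have 2: "(LINT \<omega>|M. Im (U \<omega>) * indicator A (Y \<omega>)) = 0"
    using order_trans[OF abs_Im_le_cmod bd] by (intro real_tilt_vanishes[OF M, where B = B]) auto
  have i: "integrable M (\<lambda>\<omega>. U \<omega> * indicator A (Y \<omega>))"
    using bd B0 by (intro integrable_bounded[OF M, where B = B]) (auto simp: indicator_def)
  have "Re (LINT \<omega>|M. U \<omega> * indicator A (Y \<omega>)) = (LINT \<omega>|M. Re (U \<omega> * indicator A (Y \<omega>)))"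
    "Im (LINT \<omega>|M. U \<omega> * indicator A (Y \<omega>)) = (LINT \<omega>|M. Im (U \<omega> * indicator A (Y \<omega>)))"
    using integral_Re[OF i] integral_Im[OF i] by (auto simp del: times_complex.sel)
  moreover have "Re (U \<omega> * indicator A (Y \<omega>)) = Re (U \<omega>) * indicator A (Y \<omega>)"
    "Im (U \<omega> * indicator A (Y \<omega>)) = Im (U \<omega>) * indicator A (Y \<omega>)" for \<omega>
    by (auto simp: indicator_def)
  ultimately show ?thesis using 1 2 by (simp add: complex_eq_iff)
qed

text \<open>One coordinate at a time: the indicator of a treated coordinate is absorbed into the
  weight, which stays bounded by the same \<open>B\<close>. This is why the weight is arbitrary in
  the induction, and why the one-dimensional results carry a weight at all.\<close>

lemma complex_char_vanishes_finite:
  fixes U :: "'a \<Rightarrow> complex" and Y :: "'j \<Rightarrow> 'a \<Rightarrow> real"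
  assumes M: "prob_space M" and J: "finite J" and U: "U \<in> borel_measurable M"
    and bd: "\<And>\<omega>. norm (U \<omega>) \<le> B"
    and Y: "\<And>j. j \<in> J \<Longrightarrow> Y j \<in> borel_measurable M"
    and ch: "\<And>t. (LINT \<omega>|M. U \<omega> * iexp (\<Sum>j\<in>J. t j * Y j \<omega>)) = 0"
    and A: "\<And>j. j \<in> J \<Longrightarrow> A j \<in> sets borel"
  shows "(LINT \<omega>|M. U \<omega> * (\<Prod>j\<in>J. indicator (A j) (Y j \<omega>))) = 0"
  using J U bd Y ch A
proof (induction J arbitrary: U rule: finite_induct)
  case empty
  from empty(4) show ?case by simp
next
  case (insert j J)
  note [measurable] = insert.prems(1) insert.prems(3)[OF insertI1] insert.prems(3)[OF insertI2] insert.prems(5)[OF insertI1]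
  have B0: "0 \<le> B" using order_trans[OF norm_ge_zero insert.prems(2)] .
  have "(LINT \<omega>|M. (U \<omega> * indicator (A j) (Y j \<omega>)) * (\<Prod>j\<in>J. indicator (A j) (Y j \<omega>))) = 0"
  proof (rule insert.IH)
    show "(\<lambda>\<omega>. U \<omega> * indicator (A j) (Y j \<omega>)) \<in> borel_measurable M" by measurable
    show "norm (U \<omega> * indicator (A j) (Y j \<omega>)) \<le> B" for \<omega>
      using insert.prems(2) B0 by (auto simp: indicator_def)
    show "(LINT \<omega>|M. U \<omega> * indicator (A j) (Y j \<omega>) * iexp (\<Sum>j\<in>J. t j * Y j \<omega>)) = 0" for t
    proof -
      \<comment> \<open>With the frequencies of the other coordinates frozen, their exponential
        joins the weight and only the frequency \<open>s\<close> of coordinate \<open>j\<close>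
        varies; \<open>t(j := s)\<close> specialises the joint hypothesis to this situation.\<close>
      have "(LINT \<omega>|M. (U \<omega> * iexp (\<Sum>j\<in>J. t j * Y j \<omega>)) * indicator (A j) (Y j \<omega>)) = 0"
      proof (rule complex_char_vanishes[OF M, where B = B])
        show "(LINT \<omega>|M. U \<omega> * iexp (\<Sum>j\<in>J. t j * Y j \<omega>) * iexp (s * Y j \<omega>)) = 0" for s
        proof -
          have "(\<Sum>i\<in>J. (t(j := s)) i * Y i \<omega>) = (\<Sum>i\<in>J. t i * Y i \<omega>)" for \<omega>
            using insert.hyps by (intro sum.cong) auto
          then show ?thesis
            using insert.prems(4)[of "t(j := s)"] insert.hyps
            by (simp add: exp_add distrib_left mult_ac)
        qed
      qed (use insert.prems in \<open>auto simp: norm_mult\<close>)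
      then show ?thesis by (simp add: mult_ac)
    qed
  qed (use insert.prems in auto)
  then show ?case using insert.hyps by (simp add: mult_ac)
qed

text \<open>Dynkin's argument on the generating cylinders, for a complex-weighted integral in place
  of a measure. Complements use that the integral over the whole space is 0 (the empty frequency set
  \<open>F = {}\<close>); disjoint unions use countable additivity of the integral.\<close>

lemma complex_char_vanishes_PiM:
  fixes U :: "'a \<Rightarrow> complex" and Y :: "'j \<Rightarrow> 'a \<Rightarrow> real"
  assumes M: "prob_space M" and U[measurable]: "U \<in> borel_measurable M"
    and bd: "\<And>\<omega>. norm (U \<omega>) \<le> B"
    and Y[measurable]: "\<And>j. j \<in> J \<Longrightarrow> Y j \<in> borel_measurable M"
    and ch: "\<And>t F. finite F \<Longrightarrow> F \<subseteq> J \<Longrightarrow> (LINT \<omega>|M. U \<omega> * iexp (\<Sum>j\<in>F. t j * Y j \<omega>)) = 0"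
    and A: "A \<in> sets (\<Pi>\<^sub>M j\<in>J. (borel :: real measure))"
  shows "(LINT \<omega>|M. U \<omega> * indicator A (\<lambda>j\<in>J. Y j \<omega>)) = 0"
proof -
  define \<Phi> where "\<Phi> \<omega> = (\<lambda>j\<in>J. Y j \<omega>)" for \<omega>
  let ?P = "\<Pi>\<^sub>M j\<in>J. (borel :: real measure)"
  let ?I = "\<lambda>A. LINT \<omega>|M. U \<omega> * indicator A (\<Phi> \<omega>)"
  have B0: "0 \<le> B" using order_trans[OF norm_ge_zero bd] .
  have Phi[measurable]: "\<Phi> \<in> M \<rightarrow>\<^sub>M ?P"
    unfolding \<Phi>_def by (intro measurable_restrict) auto
  have i: "integrable M (\<lambda>\<omega>. U \<omega> * indicator A (\<Phi> \<omega>))" if [measurable]: "A \<in> sets ?P" for A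
    using bd B0 by (intro integrable_bounded[OF M, where B = B]) (auto simp: indicator_def)
  have sp: "(\<Phi> \<omega>) \<in> space ?P" for \<omega> by (auto simp: space_PiM \<Phi>_def)
  have sets_eq: "sets ?P = sigma_sets (space ?P) (prod_algebra J (\<lambda>_. borel))"
    by (simp add: sets_PiM space_PiM)
  have tot: "?I (space ?P) = 0"
    using ch[of "{}" "\<lambda>_. 0"] sp by (simp add: indicator_def)
  have G: "prod_algebra J (\<lambda>_. borel :: real measure) \<subseteq> Pow (space ?P)"
    using prod_algebra_sets_into_space[of J "\<lambda>_. borel :: real measure"] by (simp add: space_PiM)
  have "?I A = 0"
    using Int_stable_prod_algebra G A[unfolded sets_eq]
  proof (induction rule: sigma_sets_induct_disjoint)
    case (basic A)
    from prod_algebraE[OF basic] obtain F E where FE: "A = prod_emb J (\<lambda>_. borel) F (\<Pi>\<^sub>E j\<in>F. E j)"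
      "finite F" "F \<subseteq> J" "\<And>j. j \<in> F \<Longrightarrow> E j \<in> sets (borel :: real measure)"
      by metis
    have "indicator A (\<Phi> \<omega>) = (\<Prod>j\<in>F. indicator (E j) (Y j \<omega>) :: complex)" for \<omega>
    proof -
      have "(\<Phi> \<omega>) \<in> A \<longleftrightarrow> (\<forall>j\<in>F. Y j \<omega> \<in> E j)"
        using FE(3) sp[of \<omega>] by (auto simp: FE(1) \<Phi>_def prod_emb_def PiE_iff restrict_def extensional_def space_PiM)
      then show ?thesis using FE(2) by (auto simp: indicator_def prod_zero_iff)
    qed
    then show ?case
      by (simp only:) (rule complex_char_vanishes_finite[OF M FE(2) U bd Y[OF subsetD[OF FE(3)]] ch[OF FE(2,3)] FE(4)])
  next
    case empty
    show ?case by simp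
  next
    case (compl A)
    then have [measurable]: "A \<in> sets ?P" using sets_eq by simp
    have "?I (space ?P - A) = (LINT \<omega>|M. U \<omega> * indicator (space ?P) (\<Phi> \<omega>) - U \<omega> * indicator A (\<Phi> \<omega>))"
      using sp by (intro Bochner_Integration.integral_cong) (auto simp: indicator_def)
    also have "\<dots> = 0" using compl tot i by (subst Bochner_Integration.integral_diff) auto
    finally show ?case .
  next
    case (union A)
    have [measurable]: "A k \<in> sets ?P" for k using union(2) sets_eq by auto
    let ?A = "\<lambda>k. \<Phi> -` A k \<inter> space M"
    have *: "(LINT \<omega>:S|M. U \<omega>) = (LINT \<omega>|M. U \<omega> * indicator D (\<Phi> \<omega>))"
      if "S = \<Phi> -` D \<inter> space M" for S D
      unfolding set_lebesgue_integral_def that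
      by (intro Bochner_Integration.integral_cong) (auto simp: indicator_def)
    have "(LINT \<omega>:(\<Union>k. ?A k)|M. U \<omega>) = (\<Sum>k. (LINT \<omega>:?A k|M. U \<omega>))"
    proof (rule lebesgue_integral_countable_add)
      show "?A k \<in> sets M" for k by measurable
      show "?A i \<inter> ?A j = {}" if "i \<noteq> j" for i j
        using union(1) that by (auto simp: disjoint_family_on_def)
      show "set_integrable M (\<Union>k. ?A k) U"
        unfolding set_integrable_def
        using bd B0 by (intro integrable_bounded[OF M, where B = B]) (auto simp: indicator_def)
    qed
    also have "\<dots> = 0" using union(3) by (simp add: *[OF refl])
    finally show ?case by (subst *[of "\<Union>k. ?A k" "\<Union>k. A k", symmetric]) auto
  qed
  then show ?thesis unfolding \<Phi>_def .
qed

text \<open>Events replace exponentials on one side at a time, by centring. The weight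
  \<open>iexp (...) - ?c\<close> in \<open>Y\<close> integrates to 0 against every exponential in
  \<open>Z\<close>, hence against every \<open>Z\<close>-event. Then the centred indicator of a
  \<open>Z\<close>-event integrates to 0 against every exponential in \<open>Y\<close>, hence
  against every \<open>Y\<close>-event.\<close>

lemma indep_from_char:
  fixes Y :: "'j \<Rightarrow> 'a \<Rightarrow> real" and Z :: "'k \<Rightarrow> 'a \<Rightarrow> real"
  assumes M: "prob_space M"
    and Y[measurable]: "\<And>j. j \<in> J \<Longrightarrow> Y j \<in> borel_measurable M"
    and Z[measurable]: "\<And>j. j \<in> K \<Longrightarrow> Z j \<in> borel_measurable M"
    and ch: "\<And>s t F H. finite F \<Longrightarrow> F \<subseteq> J \<Longrightarrow> finite H \<Longrightarrow> H \<subseteq> K \<Longrightarrow>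
       (LINT \<omega>|M. iexp ((\<Sum>j\<in>F. s j * Y j \<omega>) + (\<Sum>k\<in>H. t k * Z k \<omega>))) =
       (LINT \<omega>|M. iexp (\<Sum>j\<in>F. s j * Y j \<omega>)) * (LINT \<omega>|M. iexp (\<Sum>k\<in>H. t k * Z k \<omega>))"
  shows "distr M ((\<Pi>\<^sub>M j\<in>J. borel) \<Otimes>\<^sub>M (\<Pi>\<^sub>M k\<in>K. borel)) (\<lambda>\<omega>. (\<lambda>j\<in>J. Y j \<omega>, \<lambda>k\<in>K. Z k \<omega>)) =
    distr M (\<Pi>\<^sub>M j\<in>J. borel) (\<lambda>\<omega>. \<lambda>j\<in>J. Y j \<omega>) \<Otimes>\<^sub>M distr M (\<Pi>\<^sub>M k\<in>K. borel) (\<lambda>\<omega>. \<lambda>k\<in>K. Z k \<omega>)"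
proof -
  interpret prob_space M by fact
  have PY[measurable]: "(\<lambda>\<omega>. \<lambda>j\<in>J. Y j \<omega>) \<in> M \<rightarrow>\<^sub>M (\<Pi>\<^sub>M j\<in>J. borel)" by measurable
  have PZ[measurable]: "(\<lambda>\<omega>. \<lambda>j\<in>K. Z j \<omega>) \<in> M \<rightarrow>\<^sub>M (\<Pi>\<^sub>M j\<in>K. borel)" by measurable
  have i1: "integrable M (\<lambda>\<omega>. iexp (f \<omega>))" if [measurable]: "f \<in> borel_measurable M" for f :: "'a \<Rightarrow> real"
    by (intro integrable_bounded[OF M, where B = 1]) auto
  have mY: "(\<lambda>\<omega>. \<Sum>j\<in>F. s j * Y j \<omega>) \<in> borel_measurable M" if "F \<subseteq> J" for F s
    using that by (intro borel_measurable_sum borel_measurable_times Y) auto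
  have mZ: "(\<lambda>\<omega>. \<Sum>j\<in>F. s j * Z j \<omega>) \<in> borel_measurable M" if "F \<subseteq> K" for F s
    using that by (intro borel_measurable_sum borel_measurable_times Z) auto
  have pr: "prob {\<omega>\<in>space M. (\<lambda>j\<in>J. Y j \<omega>) \<in> A \<and> (\<lambda>j\<in>K. Z j \<omega>) \<in> B} =
      prob {\<omega>\<in>space M. (\<lambda>j\<in>J. Y j \<omega>) \<in> A} * prob {\<omega>\<in>space M. (\<lambda>j\<in>K. Z j \<omega>) \<in> B}"
    if A[measurable]: "A \<in> sets (\<Pi>\<^sub>M j\<in>J. borel)" and B[measurable]: "B \<in> sets (\<Pi>\<^sub>M j\<in>K. borel)" for A B
  proof -
    let ?ZB = "\<lambda>\<omega>. indicator B (\<lambda>j\<in>K. Z j \<omega>) :: complex"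
    let ?YA = "\<lambda>\<omega>. indicator A (\<lambda>j\<in>J. Y j \<omega>) :: complex"
    have iB: "integrable M ?ZB" by (intro integrable_bounded[OF M, where B = 1]) (auto simp: norm_indicator_le_1)
    have iA: "integrable M ?YA" by (intro integrable_bounded[OF M, where B = 1]) (auto simp: norm_indicator_le_1)
    have 1: "(LINT \<omega>|M. iexp (\<Sum>j\<in>F. s j * Y j \<omega>) * ?ZB \<omega>) = (LINT \<omega>|M. iexp (\<Sum>j\<in>F. s j * Y j \<omega>)) * (LINT \<omega>|M. ?ZB \<omega>)"
      if F: "finite F" "F \<subseteq> J" for F s
    proof -
      note [measurable] = mY[OF F(2), of s]
      let ?c = "LINT \<omega>|M. iexp (\<Sum>j\<in>F. s j * Y j \<omega>)"
      have iYZ: "integrable M (\<lambda>\<omega>. iexp (\<Sum>j\<in>F. s j * Y j \<omega>) * ?ZB \<omega>)"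
        by (rule integrable_bounded[OF M, where B = 1], measurable) (simp add: norm_mult norm_indicator_le_1)
      have "(LINT \<omega>|M. (iexp (\<Sum>j\<in>F. s j * Y j \<omega>) - ?c) * ?ZB \<omega>) = 0"
      proof (rule complex_char_vanishes_PiM[OF M _ _ Z _ B])
        show "(\<lambda>\<omega>. iexp (\<Sum>j\<in>F. s j * Y j \<omega>) - ?c) \<in> borel_measurable M"
          by measurable
        show "norm (iexp (\<Sum>j\<in>F. s j * Y j \<omega>) - ?c) \<le> 1 + norm ?c" for \<omega>
          by (rule order_trans[OF norm_triangle_ineq4]) simp
        show "(LINT \<omega>|M. (iexp (\<Sum>j\<in>F. s j * Y j \<omega>) - ?c) * iexp (\<Sum>j\<in>H. t j * Z j \<omega>)) = 0"
          if H: "finite H" "H \<subseteq> K" for t H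
        proof -
          note [measurable] = mZ[OF H(2), of t]
          have "(LINT \<omega>|M. (iexp (\<Sum>j\<in>F. s j * Y j \<omega>) - ?c) * iexp (\<Sum>j\<in>H. t j * Z j \<omega>)) =
           (LINT \<omega>|M. iexp ((\<Sum>j\<in>F. s j * Y j \<omega>) + (\<Sum>j\<in>H. t j * Z j \<omega>)) - ?c * iexp (\<Sum>j\<in>H. t j * Z j \<omega>))"
            by (intro Bochner_Integration.integral_cong) (auto simp: algebra_simps exp_add)
          also have "\<dots> = 0"
            by (subst Bochner_Integration.integral_diff[OF i1 integrable_mult_right[OF i1]], measurable)
              (simp only: integral_mult_right_zero ch[OF F H], simp)
          finally show ?thesis .
        qed
      qed auto
      moreover have "(LINT \<omega>|M. (iexp (\<Sum>j\<in>F. s j * Y j \<omega>) - ?c) * ?ZB \<omega>) =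
         (LINT \<omega>|M. iexp (\<Sum>j\<in>F. s j * Y j \<omega>) * ?ZB \<omega> - ?c * ?ZB \<omega>)"
        by (simp add: algebra_simps)
      moreover have "\<dots> = (LINT \<omega>|M. iexp (\<Sum>j\<in>F. s j * Y j \<omega>) * ?ZB \<omega>) - ?c * (LINT \<omega>|M. ?ZB \<omega>)"
        by (subst Bochner_Integration.integral_diff[OF iYZ integrable_mult_right[OF iB]])
          (simp only: integral_mult_right_zero)
      ultimately show ?thesis by simp
    qed
    let ?c = "LINT \<omega>|M. ?ZB \<omega>"
    have "(LINT \<omega>|M. (?ZB \<omega> - ?c) * ?YA \<omega>) = 0"
    proof (rule complex_char_vanishes_PiM[OF M _ _ Y _ A])
      show "norm (?ZB \<omega> - ?c) \<le> 1 + norm ?c" for \<omega>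
        by (rule order_trans[OF norm_triangle_ineq4]) (simp add: norm_indicator_le_1)
      show "(LINT \<omega>|M. (?ZB \<omega> - ?c) * iexp (\<Sum>j\<in>F. s j * Y j \<omega>)) = 0" if F: "finite F" "F \<subseteq> J" for s F
      proof -
        note [measurable] = mY[OF F(2), of s]
        have "(LINT \<omega>|M. (?ZB \<omega> - ?c) * iexp (\<Sum>j\<in>F. s j * Y j \<omega>)) =
          (LINT \<omega>|M. iexp (\<Sum>j\<in>F. s j * Y j \<omega>) * ?ZB \<omega> - ?c * iexp (\<Sum>j\<in>F. s j * Y j \<omega>))"
          by (simp add: algebra_simps)
        also have "\<dots> = 0"
        proof (subst Bochner_Integration.integral_diff)
          show "integrable M (\<lambda>\<omega>. iexp (\<Sum>j\<in>F. s j * Y j \<omega>) * ?ZB \<omega>)"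
            by (rule integrable_bounded[OF M, where B = 1], measurable) (simp add: norm_mult norm_indicator_le_1)
          show "integrable M (\<lambda>\<omega>. ?c * iexp (\<Sum>j\<in>F. s j * Y j \<omega>))"
            by (intro integrable_mult_right i1) measurable
          show "(LINT \<omega>|M. iexp (\<Sum>j\<in>F. s j * Y j \<omega>) * ?ZB \<omega>) - (LINT \<omega>|M. ?c * iexp (\<Sum>j\<in>F. s j * Y j \<omega>)) = 0"
            by (simp only: integral_mult_right_zero 1[OF F]) simp
        qed
        finally show ?thesis .
      qed
    qed auto
    moreover have "(LINT \<omega>|M. (?ZB \<omega> - ?c) * ?YA \<omega>) = (LINT \<omega>|M. ?ZB \<omega> * ?YA \<omega> - ?c * ?YA \<omega>)"
        by (simp add: algebra_simps)
    moreover have "\<dots> = (LINT \<omega>|M. ?ZB \<omega> * ?YA \<omega>) - ?c * (LINT \<omega>|M. ?YA \<omega>)"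
      using iA by (subst Bochner_Integration.integral_diff)
        (auto intro!: integrable_bounded[OF M, where B = 1] simp: indicator_def)
    ultimately have e: "(LINT \<omega>|M. ?ZB \<omega> * ?YA \<omega>) = (LINT \<omega>|M. ?ZB \<omega>) * (LINT \<omega>|M. ?YA \<omega>)" by simp
    have ind: "complex_of_real (prob {\<omega>\<in>space M. P \<omega>}) = (LINT \<omega>|M. g \<omega>)"
      if [measurable]: "Measurable.pred M P" and "\<And>\<omega>. g \<omega> = (if P \<omega> then 1 else 0)" for g P
    proof -
      have "(LINT \<omega>|M. g \<omega>) = (LINT \<omega>|M. complex_of_real (indicator {\<omega>\<in>space M. P \<omega>} \<omega>))"
        using that(2) by (intro Bochner_Integration.integral_cong) (auto simp: indicator_def)
      then show ?thesis by (simp add: measure_def[symmetric] Int_absorb1 subset_eq)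
    qed
    have "complex_of_real (prob {\<omega>\<in>space M. (\<lambda>j\<in>J. Y j \<omega>) \<in> A \<and> (\<lambda>j\<in>K. Z j \<omega>) \<in> B}) = (LINT \<omega>|M. ?ZB \<omega> * ?YA \<omega>)"
      by (rule ind) (auto simp: indicator_def)
    moreover have "(LINT \<omega>|M. ?YA \<omega>) = complex_of_real (prob {\<omega>\<in>space M. (\<lambda>j\<in>J. Y j \<omega>) \<in> A})"
      by (rule ind[symmetric]) (auto simp: indicator_def)
    moreover have "(LINT \<omega>|M. ?ZB \<omega>) = complex_of_real (prob {\<omega>\<in>space M. (\<lambda>j\<in>K. Z j \<omega>) \<in> B})"
      by (rule ind[symmetric]) (auto simp: indicator_def)
    ultimately have "complex_of_real (prob {\<omega>\<in>space M. (\<lambda>j\<in>J. Y j \<omega>) \<in> A \<and> (\<lambda>j\<in>K. Z j \<omega>) \<in> B}) =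
       complex_of_real (prob {\<omega>\<in>space M. (\<lambda>j\<in>J. Y j \<omega>) \<in> A} * prob {\<omega>\<in>space M. (\<lambda>j\<in>K. Z j \<omega>) \<in> B})"
      using e by (simp only: of_real_mult mult.commute)
    then show ?thesis by (simp only: of_real_eq_iff)
  qed
  have ps: "prob_space (distr M (\<Pi>\<^sub>M j\<in>J. borel) (\<lambda>\<omega>. \<lambda>j\<in>J. Y j \<omega>))"
    "prob_space (distr M (\<Pi>\<^sub>M k\<in>K. borel) (\<lambda>\<omega>. \<lambda>k\<in>K. Z k \<omega>))"
    by (auto intro!: prob_space_distr)
  show ?thesis
  proof (rule pair_measure_eqI[symmetric])
    show "sigma_finite_measure (distr M (\<Pi>\<^sub>M j\<in>J. borel) (\<lambda>\<omega>. \<lambda>j\<in>J. Y j \<omega>))"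
      "sigma_finite_measure (distr M (\<Pi>\<^sub>M k\<in>K. borel) (\<lambda>\<omega>. \<lambda>k\<in>K. Z k \<omega>))"
      using ps by (auto intro: prob_space_imp_sigma_finite)
    fix A B assume "A \<in> sets (distr M (\<Pi>\<^sub>M j\<in>J. borel) (\<lambda>\<omega>. \<lambda>j\<in>J. Y j \<omega>))"
      "B \<in> sets (distr M (\<Pi>\<^sub>M k\<in>K. borel) (\<lambda>\<omega>. \<lambda>k\<in>K. Z k \<omega>))"
    then have AB[measurable]: "A \<in> sets (\<Pi>\<^sub>M j\<in>J. borel)" "B \<in> sets (\<Pi>\<^sub>M k\<in>K. borel)" by auto
    have v: "X -` D \<inter> space M = {\<omega>\<in>space M. X \<omega> \<in> D}" for D and X :: "'a \<Rightarrow> 'x" by auto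
    show "emeasure (distr M (\<Pi>\<^sub>M j\<in>J. borel) (\<lambda>\<omega>. \<lambda>j\<in>J. Y j \<omega>)) A *
       emeasure (distr M (\<Pi>\<^sub>M k\<in>K. borel) (\<lambda>\<omega>. \<lambda>k\<in>K. Z k \<omega>)) B =
       emeasure (distr M ((\<Pi>\<^sub>M j\<in>J. borel) \<Otimes>\<^sub>M (\<Pi>\<^sub>M k\<in>K. borel)) (\<lambda>\<omega>. (\<lambda>j\<in>J. Y j \<omega>, \<lambda>k\<in>K. Z k \<omega>))) (A \<times> B)"
      using pr[OF AB] by (simp add: emeasure_distr v emeasure_eq_measure ennreal_mult[symmetric])
  qed (simp cong: sets_pair_measure_cong)
qed

section \<open>Conditional laws from an independent residual\<close>

lemma regular_cond_law_residual:
  assumes M: "prob_space M"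
    and X[measurable]: "X \<in> M \<rightarrow>\<^sub>M N" and R[measurable]: "R \<in> M \<rightarrow>\<^sub>M Q"
    and ind: "distr M (N \<Otimes>\<^sub>M Q) (\<lambda>\<omega>. (X \<omega>, R \<omega>)) = distr M N X \<Otimes>\<^sub>M distr M Q R"
    and H[measurable]: "(\<lambda>(x, r). H x r) \<in> N \<Otimes>\<^sub>M Q \<rightarrow>\<^sub>M L"
    and Y: "\<And>\<omega>. \<omega> \<in> space M \<Longrightarrow> Y \<omega> = H (X \<omega>) (R \<omega>)"
  shows "regular_cond_law M N X L Y (\<lambda>x. distr (distr M Q R) L (H x))"
  unfolding regular_cond_law_def
proof (intro conjI ballI)
  interpret prob_space M by fact
  have Y'[measurable]: "Y \<in> M \<rightarrow>\<^sub>M L"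
    using measurable_compose[OF measurable_Pair[OF X R] H] by (subst measurable_cong[OF Y]) simp_all
  then show "Y \<in> M \<rightarrow>\<^sub>M L" "X \<in> M \<rightarrow>\<^sub>M N" using X by auto
  have pQ: "distr M Q R \<in> space (prob_algebra Q)"
    by (auto simp: space_prob_algebra intro!: prob_space_distr)
  interpret Q: prob_space "distr M Q R" by (rule prob_space_distr) simp
  show "(\<lambda>x. distr (distr M Q R) L (H x)) \<in> N \<rightarrow>\<^sub>M prob_algebra L"
    using pQ by (intro measurable_distr_prob_space2[where M = Q]) (auto intro: H)
  fix A B assume A[measurable]: "A \<in> sets N" and B[measurable]: "B \<in> sets L"
  have HQ[measurable]: "H x \<in> Q \<rightarrow>\<^sub>M L" if "x \<in> space N" for x
    using measurable_Pair2[OF H that] by simp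
  let ?D = "{z \<in> space (N \<Otimes>\<^sub>M Q). fst z \<in> A \<and> (case z of (x, r) \<Rightarrow> H x r) \<in> B}"
  have D[measurable]: "?D \<in> sets (N \<Otimes>\<^sub>M Q)" by measurable
  have "emeasure M {\<omega> \<in> space M. X \<omega> \<in> A \<and> Y \<omega> \<in> B} =
     emeasure (distr M (N \<Otimes>\<^sub>M Q) (\<lambda>\<omega>. (X \<omega>, R \<omega>))) ?D"
    using measurable_space[OF X] measurable_space[OF R] Y
    by (subst emeasure_distr) (auto intro!: arg_cong[where f = "emeasure M"] simp: space_pair_measure)
  also have "\<dots> = (\<integral>\<^sup>+x. emeasure (distr M Q R) (Pair x -` ?D) \<partial>distr M N X)"
    unfolding ind by (subst Q.emeasure_pair_measure_alt) (auto cong: sets_pair_measure_cong)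
  also have "\<dots> = (\<integral>\<^sup>+x\<in>A. emeasure (distr (distr M Q R) L (H x)) B \<partial>distr M N X)"
  proof (intro nn_integral_cong)
    fix x assume "x \<in> space (distr M N X)"
    then have x: "x \<in> space N" by simp
    have "Pair x -` ?D = (if x \<in> A then H x -` B \<inter> space Q else {})"
      using x by (auto simp: space_pair_measure)
    then show "emeasure (distr M Q R) (Pair x -` ?D) = emeasure (distr (distr M Q R) L (H x)) B * indicator A x"
      using HQ[OF x] by (auto simp: emeasure_distr[OF _ B])
  qed
  finally show "emeasure M {\<omega> \<in> space M. X \<omega> \<in> A \<and> Y \<omega> \<in> B} =
        (\<integral>\<^sup>+x\<in>A. emeasure (distr (distr M Q R) L (H x)) B \<partial>distr M N X)" .
qed

section \<open>Characteristic functions of normal laws, variance 0 included\<close>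

lemma char_normal_density:
  assumes M: "prob_space M" and Z: "distr M borel Z = density lborel (\<lambda>x. ennreal (normal_density \<mu> \<sigma> x))"
    and Z'[measurable]: "Z \<in> borel_measurable M" and s: "\<sigma> > 0"
  shows "(LINT \<omega>|M. iexp (t * Z \<omega>)) = iexp (t * \<mu>) * exp (complex_of_real (- (t\<^sup>2 * \<sigma>\<^sup>2) / 2))"
proof -
  interpret prob_space M by fact
  have "distributed M lborel Z (normal_density \<mu> \<sigma>)"
    unfolding distributed_def using Z by (simp cong: distr_cong)
  then have "distributed M lborel (\<lambda>x. (Z x - \<mu>) / \<sigma>) std_normal_density"
    using normal_standard_normal_convert[OF s] by blast
  then have d: "distr M borel (\<lambda>x. (Z x - \<mu>) / \<sigma>) = std_normal_distribution"
    by (simp add: distributed_def cong: distr_cong)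
  have "(LINT \<omega>|M. iexp (t * Z \<omega>)) = (LINT \<omega>|M. iexp (t * \<mu>) * iexp ((t * \<sigma>) * ((Z \<omega> - \<mu>) / \<sigma>)))"
    using s by (intro Bochner_Integration.integral_cong) (auto simp: exp_add[symmetric] field_simps)
  also have "\<dots> = iexp (t * \<mu>) * (LINT \<omega>|M. iexp ((t * \<sigma>) * ((Z \<omega> - \<mu>) / \<sigma>)))"
    by (rule integral_mult_right_zero)
  also have "(LINT \<omega>|M. iexp ((t * \<sigma>) * ((Z \<omega> - \<mu>) / \<sigma>))) = char (distr M borel (\<lambda>x. (Z x - \<mu>) / \<sigma>)) (t * \<sigma>)"
    unfolding char_def by (subst integral_distr) auto
  also have "\<dots> = exp (complex_of_real (- (t\<^sup>2 * \<sigma>\<^sup>2) / 2))"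
    unfolding d char_std_normal_distribution by (simp add: exp_of_real[symmetric] power_mult_distrib)
  finally show ?thesis .
qed

lemma char_normal_law:
  assumes M: "prob_space M" and Z: "normal_law (distr M borel Z) m v"
    and Z'[measurable]: "Z \<in> borel_measurable M"
  shows "(LINT \<omega>|M. iexp (t * Z \<omega>)) = iexp (t * m) * exp (complex_of_real (- (t\<^sup>2 * v) / 2))"
proof (cases "v = 0")
  case True
  then have e: "distr M borel Z = return borel m" using Z by (simp add: normal_law_def)
  have "(LINT \<omega>|M. iexp (t * Z \<omega>)) = (LINT z|distr M borel Z. iexp (t * z))"
    by (subst integral_distr) auto
  then show ?thesis unfolding e using True by (simp add: integral_return)
next
  case False
  then have "v > 0" "distr M borel Z = density lborel (\<lambda>x. ennreal (normal_density m (sqrt v) x))"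
    using Z by (auto simp: normal_law_def)
  then show ?thesis using char_normal_density[OF M _ Z', of m "sqrt v" t] by simp
qed

lemma normal_law_from_char:
  assumes M: "prob_space M" and Z[measurable]: "Z \<in> borel_measurable M"
    and ch: "\<And>t. (LINT \<omega>|M. iexp (t * Z \<omega>)) = iexp (t * m) * exp (complex_of_real (- (t\<^sup>2 * v) / 2))"
  shows "normal_law (distr M borel Z) m v"
proof -
  interpret prob_space M by fact
  have rd: "real_distribution (distr M borel Z)" by (auto intro: real_distribution_distr)
  have chZ: "char (distr M borel Z) t = iexp (t * m) * exp (complex_of_real (- (t\<^sup>2 * v) / 2))" for t
    unfolding char_def using ch by (subst integral_distr) auto
  \<comment> \<open>Nonnegativity of \<open>v\<close> comes for free from the bound 1 on the modulus
    of a characteristic function, at frequency 1. Covariance forms therefore never have to be shown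
    positive semidefinite by hand.\<close>
  have "exp (- v / 2) \<le> 1"
    using real_distribution.cmod_char_le_1[OF rd, of 1] unfolding chZ exp_of_real by (simp add: norm_mult)
  then have v0: "0 \<le> v" by simp
  show ?thesis
  proof (cases "v = 0")
    case True
    have "real_distribution (return borel m :: real measure)"
      by (simp add: real_distribution_def real_distribution_axioms_def prob_space_return)
    moreover have "char (return borel m) = char (distr M borel Z)"
      by (rule ext) (simp add: chZ True, simp add: char_def integral_return)
    ultimately show ?thesis using rd Levy_uniqueness True by (auto simp: normal_law_def)
  next
    case False
    with v0 have s: "sqrt v > 0" by simp
    have "char (distr M borel (\<lambda>x. (Z x - m) / sqrt v)) t = char std_normal_distribution t" for t
    proof -
      have "char (distr M borel (\<lambda>x. (Z x - m) / sqrt v)) t = (LINT \<omega>|M. iexp (t * ((Z \<omega> - m) / sqrt v)))"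
        unfolding char_def by (subst integral_distr) auto
      also have "\<dots> = (LINT \<omega>|M. iexp (- t * m / sqrt v) * iexp ((t / sqrt v) * Z \<omega>))"
        using s by (intro Bochner_Integration.integral_cong) (auto simp: exp_add[symmetric] field_simps)
      also have "\<dots> = iexp (- t * m / sqrt v) * (iexp ((t / sqrt v) * m) * exp (complex_of_real (- ((t / sqrt v)\<^sup>2 * v) / 2)))"
        unfolding ch[symmetric] by (rule integral_mult_right_zero)
      also have "\<dots> = exp (complex_of_real (- ((t / sqrt v)\<^sup>2 * v) / 2))"
        by (simp add: exp_add[symmetric] mult.assoc[symmetric])
      also have "(t / sqrt v)\<^sup>2 * v = t\<^sup>2" using s v0 by (simp add: power_divide)
      finally show ?thesis by (simp add: char_std_normal_distribution exp_of_real[symmetric])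
    qed
    then have "distr M borel (\<lambda>x. (Z x - m) / sqrt v) = std_normal_distribution"
      by (intro Levy_uniqueness real_dist_normal_dist real_distribution_distr) auto
    then have "distributed M lborel (\<lambda>x. (Z x - m) / sqrt v) std_normal_density"
      by (simp add: distributed_def cong: distr_cong)
    then have "distributed M lborel Z (normal_density m (sqrt v))"
      using normal_standard_normal_convert[OF s] by blast
    then show ?thesis using False v0 by (simp add: distributed_def normal_law_def cong: distr_cong)
  qed
qed

section \<open>Gaussian fields\<close>

text \<open>The family \<open>G\<close> is centred Gaussian with covariance \<open>\<Gamma>\<close> and independent of the variables
  in \<open>S\<close>, expressed by characteristic functions of finite linear combinations.\<close>

definition gaussian_field ::
  "'a measure \<Rightarrow> ('a \<Rightarrow> real) set \<Rightarrow> 'i set \<Rightarrow> ('i \<Rightarrow> 'i \<Rightarrow> real) \<Rightarrow> ('i \<Rightarrow> 'a \<Rightarrow> real) \<Rightarrow> bool"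
where
  "gaussian_field M S D \<Gamma> G \<longleftrightarrow>
     (\<forall>\<xi>\<in>S. \<xi> \<in> borel_measurable M) \<and> (\<forall>i\<in>D. G i \<in> borel_measurable M) \<and>
     (\<forall>\<xi>\<in>S. \<forall>I a. finite I \<and> I \<subseteq> D \<longrightarrow>
       (LINT \<omega>|M. iexp (\<xi> \<omega> + (\<Sum>i\<in>I. a i * G i \<omega>))) =
       (LINT \<omega>|M. iexp (\<xi> \<omega>)) * exp (complex_of_real (- (\<Sum>i\<in>I. \<Sum>j\<in>I. a i * a j * \<Gamma> i j) / 2)))"

lemma gaussian_fieldD:
  assumes "gaussian_field M S D \<Gamma> G"
  shows "\<xi> \<in> S \<Longrightarrow> \<xi> \<in> borel_measurable M" "i \<in> D \<Longrightarrow> G i \<in> borel_measurable M"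
    "\<xi> \<in> S \<Longrightarrow> finite I \<Longrightarrow> I \<subseteq> D \<Longrightarrow>
       (LINT \<omega>|M. iexp (\<xi> \<omega> + (\<Sum>i\<in>I. a i * G i \<omega>))) =
       (LINT \<omega>|M. iexp (\<xi> \<omega>)) * exp (complex_of_real (- (\<Sum>i\<in>I. \<Sum>j\<in>I. a i * a j * \<Gamma> i j) / 2))"
  using assms unfolding gaussian_field_def by auto

lemma gaussian_field_mono:
  assumes "gaussian_field M S' D' \<Gamma> G" "S \<subseteq> S'" "D \<subseteq> D'"
  shows "gaussian_field M S D \<Gamma> G"
  using assms unfolding gaussian_field_def by (meson subset_eq order_trans)

lemma gaussian_field_cov_cong:
  assumes G: "gaussian_field M S D \<Gamma> G" and eq: "\<And>i j. i \<in> D \<Longrightarrow> j \<in> D \<Longrightarrow> \<Gamma> i j = \<Gamma>' i j"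
  shows "gaussian_field M S D \<Gamma>' G"
proof -
  have "(\<Sum>i\<in>I. \<Sum>j\<in>I. a i * a j * \<Gamma> i j) = (\<Sum>i\<in>I. \<Sum>j\<in>I. a i * a j * \<Gamma>' i j)" if "I \<subseteq> D" for I a
    using that by (intro sum.cong refl) (simp add: eq subset_eq)
  then show ?thesis using G unfolding gaussian_field_def by simp
qed

text \<open>A combination of noise over \<open>E\<close> and a combination of residuals have
  coefficient vectors \<open>A\<close> and \<open>B\<close> whose mixed terms in the quadratic form
  vanish by \<open>orth\<close>. The Gaussian factor then splits, so the residuals stay independent
  after the noise over \<open>E\<close> has joined the test variables. Orthogonality is asked on
  both sides because \<open>\<Gamma>\<close> is not assumed symmetric.\<close>

lemma gaussian_field_residual:
  fixes G :: "'i \<Rightarrow> 'a \<Rightarrow> real" and w :: "'j \<Rightarrow> 'i \<Rightarrow> real"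
  assumes G: "gaussian_field M S D \<Gamma> G"
    and F: "\<And>j. j \<in> D' \<Longrightarrow> finite (F j)" "\<And>j. j \<in> D' \<Longrightarrow> F j \<subseteq> D" and E: "E \<subseteq> D"
    and orth: "\<And>i j. i \<in> E \<Longrightarrow> j \<in> D' \<Longrightarrow> (\<Sum>k\<in>F j. w j k * \<Gamma> k i) = 0"
      "\<And>i j. i \<in> E \<Longrightarrow> j \<in> D' \<Longrightarrow> (\<Sum>k\<in>F j. w j k * \<Gamma> i k) = 0"
  shows "gaussian_field M {\<lambda>\<omega>. \<xi> \<omega> + (\<Sum>i\<in>I. a i * G i \<omega>) |\<xi> I a. \<xi> \<in> S \<and> finite I \<and> I \<subseteq> E} D'
     (\<lambda>j j'. \<Sum>k\<in>F j. \<Sum>k'\<in>F j'. w j k * w j' k' * \<Gamma> k k') (\<lambda>j \<omega>. \<Sum>k\<in>F j. w j k * G k \<omega>)"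
  unfolding gaussian_field_def
proof (intro conjI ballI allI impI)
  fix \<eta> assume "\<eta> \<in> {\<lambda>\<omega>. \<xi> \<omega> + (\<Sum>i\<in>I. a i * G i \<omega>) |\<xi> I a. \<xi> \<in> S \<and> finite I \<and> I \<subseteq> E}"
  then obtain \<xi> I a where \<eta>: "\<eta> = (\<lambda>\<omega>. \<xi> \<omega> + (\<Sum>i\<in>I. a i * G i \<omega>))" "\<xi> \<in> S" "finite I" "I \<subseteq> E" by auto
  show "\<eta> \<in> borel_measurable M"
    unfolding \<eta>(1) using \<eta>(4) E
    by (intro borel_measurable_add borel_measurable_sum borel_measurable_times borel_measurable_const gaussian_fieldD[OF G]) (use \<eta> in auto)
  fix J b assume "finite J \<and> J \<subseteq> D'"
  then have J: "finite J" "J \<subseteq> D'" by auto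
  \<comment> \<open>Both sums are rewritten over the common index set \<open>P\<close>, with
    coefficient 0 outside their own indices; \<open>B\<close> adds up the contributions of an index
    that lies in several \<open>F j\<close>.\<close>
  define P where "P = I \<union> (\<Union>j\<in>J. F j)"
  define A where "A i = (if i \<in> I then a i else 0)" for i
  define B where "B i = (\<Sum>j\<in>J. b j * (if i \<in> F j then w j i else 0))" for i
  have P: "finite P" "P \<subseteq> D" using \<eta> J F E unfolding P_def by blast+
  have sA: "(\<Sum>i\<in>P. A i * f i) = (\<Sum>i\<in>I. a i * f i)" for f
  proof -
    have "(\<Sum>i\<in>P. A i * f i) = (\<Sum>i\<in>P. if i \<in> I then a i * f i else 0)"
      by (intro sum.cong) (auto simp: A_def)
    also have "\<dots> = (\<Sum>i\<in>P \<inter> I. a i * f i)" using P by (simp add: sum.inter_restrict)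
    finally show ?thesis by (simp add: P_def Int_absorb1 Un_upper1)
  qed
  have sB: "(\<Sum>i\<in>P. B i * f i) = (\<Sum>j\<in>J. b j * (\<Sum>k\<in>F j. w j k * f k))" for f
  proof -
    have "(\<Sum>i\<in>P. B i * f i) = (\<Sum>i\<in>P. \<Sum>j\<in>J. b j * (if i \<in> F j then w j i * f i else 0))"
      unfolding B_def sum_distrib_right by (intro sum.cong) auto
    also have "\<dots> = (\<Sum>j\<in>J. b j * (\<Sum>i\<in>P. if i \<in> F j then w j i * f i else 0))"
      by (subst sum.swap) (simp add: sum_distrib_left)
    also have "\<dots> = (\<Sum>j\<in>J. b j * (\<Sum>k\<in>F j. w j k * f k))"
    proof (rule sum.cong[OF refl], rule arg_cong[of _ _ "times _"])
      fix j assume "j \<in> J"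
      then have "P \<inter> F j = F j" by (auto simp: P_def)
      then show "(\<Sum>i\<in>P. if i \<in> F j then w j i * f i else 0) = (\<Sum>k\<in>F j. w j k * f k)"
        using P by (simp add: sum.inter_restrict[symmetric])
    qed
    finally show ?thesis .
  qed
  define Q where "Q u v = (\<Sum>i\<in>P. \<Sum>j\<in>P. u i * v j * \<Gamma> i j)" for u v :: "'i \<Rightarrow> real"
  have Q1: "Q u v = (\<Sum>i\<in>P. u i * (\<Sum>j\<in>P. v j * \<Gamma> i j))" for u v
    by (simp add: Q_def sum_distrib_left mult_ac)
  have Q2: "Q u v = (\<Sum>j\<in>P. v j * (\<Sum>i\<in>P. u i * \<Gamma> i j))" for u v
    unfolding Q_def by (subst sum.swap) (simp add: sum_distrib_left mult_ac)
  have QAA: "Q A A = (\<Sum>i\<in>I. \<Sum>j\<in>I. a i * a j * \<Gamma> i j)"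
    unfolding Q1 sA by (simp add: sum_distrib_left mult_ac)
  have QBB: "Q B B = (\<Sum>j\<in>J. \<Sum>j'\<in>J. b j * b j' * (\<Sum>k\<in>F j. \<Sum>k'\<in>F j'. w j k * w j' k' * \<Gamma> k k'))"
  proof -
    have "Q B B = (\<Sum>j\<in>J. b j * (\<Sum>k\<in>F j. w j k * (\<Sum>j'\<in>J. b j' * (\<Sum>k'\<in>F j'. w j' k' * \<Gamma> k k'))))"
      unfolding Q1 sB by simp
    also have "\<dots> = (\<Sum>j\<in>J. b j * (\<Sum>j'\<in>J. b j' * (\<Sum>k\<in>F j. \<Sum>k'\<in>F j'. w j k * w j' k' * \<Gamma> k k')))"
    proof (rule sum.cong[OF refl], rule arg_cong[of _ _ "times _"])
      fix j
      have "(\<Sum>k\<in>F j. w j k * (\<Sum>j'\<in>J. b j' * (\<Sum>k'\<in>F j'. w j' k' * \<Gamma> k k'))) =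
        (\<Sum>k\<in>F j. \<Sum>j'\<in>J. b j' * (\<Sum>k'\<in>F j'. w j k * w j' k' * \<Gamma> k k'))"
        by (simp add: sum_distrib_left mult_ac)
      also have "\<dots> = (\<Sum>j'\<in>J. b j' * (\<Sum>k\<in>F j. \<Sum>k'\<in>F j'. w j k * w j' k' * \<Gamma> k k'))"
        by (subst sum.swap) (simp add: sum_distrib_left)
      finally show "(\<Sum>k\<in>F j. w j k * (\<Sum>j'\<in>J. b j' * (\<Sum>k'\<in>F j'. w j' k' * \<Gamma> k k'))) = \<dots>" .
    qed
    finally show ?thesis by (simp add: sum_distrib_left mult_ac)
  qed
  have QAB: "Q A B = 0" unfolding Q1 sA sB using orth(2) \<eta>(4) J(2) by (simp add: subset_eq)
  have QBA: "Q B A = 0" unfolding Q2 sA sB using orth(1) \<eta>(4) J(2) by (simp add: subset_eq)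
  have QQ: "Q (\<lambda>i. A i + B i) (\<lambda>i. A i + B i) = Q A A + Q A B + Q B A + Q B B"
    by (simp add: Q_def algebra_simps sum.distrib)
  have e1: "(LINT \<omega>|M. iexp (\<xi> \<omega> + (\<Sum>i\<in>P. (A i + B i) * G i \<omega>))) =
     (LINT \<omega>|M. iexp (\<xi> \<omega>)) * exp (complex_of_real (- (Q A A + Q B B) / 2))"
    unfolding gaussian_fieldD(3)[OF G \<eta>(2) P] unfolding QQ[unfolded Q_def QAB QBA, folded Q_def]
    using QQ QAB QBA unfolding Q_def by simp
  have "(\<Sum>i\<in>P. (A i + B i) * G i \<omega>) = (\<Sum>i\<in>I. a i * G i \<omega>) + (\<Sum>j\<in>J. b j * (\<Sum>k\<in>F j. w j k * G k \<omega>))" for \<omega>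
    unfolding sA[symmetric] sB[symmetric] by (simp add: algebra_simps sum.distrib)
  then have e2: "(LINT \<omega>|M. iexp (\<eta> \<omega> + (\<Sum>j\<in>J. b j * (\<Sum>k\<in>F j. w j k * G k \<omega>)))) =
     (LINT \<omega>|M. iexp (\<xi> \<omega>)) * exp (complex_of_real (- (Q A A + Q B B) / 2))"
    unfolding e1[symmetric] \<eta>(1) by (simp only: add.assoc)
  have e3: "(LINT \<omega>|M. iexp (\<eta> \<omega>)) = (LINT \<omega>|M. iexp (\<xi> \<omega>)) * exp (complex_of_real (- Q A A / 2))"
    unfolding \<eta>(1) QAA by (rule gaussian_fieldD(3)[OF G \<eta>(2,3)]) (use \<eta> E in auto)
  show "(LINT \<omega>|M. iexp (\<eta> \<omega> + (\<Sum>j\<in>J. b j * (\<Sum>k\<in>F j. w j k * G k \<omega>)))) =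
     (LINT \<omega>|M. iexp (\<eta> \<omega>)) * exp (complex_of_real (- (\<Sum>j\<in>J. \<Sum>j'\<in>J. b j * b j' *
        (\<Sum>k\<in>F j. \<Sum>k'\<in>F j'. w j k * w j' k' * \<Gamma> k k')) / 2))"
    unfolding e2 e3 QBB[symmetric] by (simp add: exp_add[symmetric] mult.assoc diff_divide_distrib add_divide_distrib)
next
  fix j assume j: "j \<in> D'"
  show "(\<lambda>\<omega>. \<Sum>k\<in>F j. w j k * G k \<omega>) \<in> borel_measurable M"
    using F(2)[OF j] by (intro borel_measurable_sum borel_measurable_times borel_measurable_const gaussian_fieldD[OF G]) auto
qed

text \<open>The case \<open>E = {}\<close> of the preceding lemma: there is nothing to be orthogonal
  to, and \<open>S\<close> is recovered with empty noise sums.\<close>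

lemma gaussian_field_linear:
  fixes G :: "'i \<Rightarrow> 'a \<Rightarrow> real" and w :: "'j \<Rightarrow> 'i \<Rightarrow> real"
  assumes G: "gaussian_field M S D \<Gamma> G"
    and F: "\<And>j. j \<in> D' \<Longrightarrow> finite (F j)" "\<And>j. j \<in> D' \<Longrightarrow> F j \<subseteq> D"
  shows "gaussian_field M S D' (\<lambda>j j'. \<Sum>k\<in>F j. \<Sum>k'\<in>F j'. w j k * w j' k' * \<Gamma> k k') (\<lambda>j \<omega>. \<Sum>k\<in>F j. w j k * G k \<omega>)"
proof (rule gaussian_field_mono[OF gaussian_field_residual[OF G F, of D' _ "{}"]])
  show "S \<subseteq> {\<lambda>\<omega>. \<xi> \<omega> + (\<Sum>i\<in>I. a i * G i \<omega>) |\<xi> I a. \<xi> \<in> S \<and> finite I \<and> I \<subseteq> {}}"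
    by (auto intro!: exI[of _ "{}"])
qed auto

text \<open>The defining identity integrates functions of modulus 1, so almost sure convergence is
  enough: dominated convergence with bound 1 on the left, continuity of the exponential on the
  right. No mean-square estimate enters.\<close>

lemma gaussian_field_limit:
  assumes M: "prob_space M"
    and Gn: "\<And>n. gaussian_field M S D (\<Gamma>n n) (Gn n)"
    and G: "\<And>i. i \<in> D \<Longrightarrow> G i \<in> borel_measurable M"
    and lim: "\<And>i. i \<in> D \<Longrightarrow> AE \<omega> in M. (\<lambda>n. Gn n i \<omega>) \<longlonglongrightarrow> G i \<omega>"
    and cov: "\<And>i j. i \<in> D \<Longrightarrow> j \<in> D \<Longrightarrow> (\<lambda>n. \<Gamma>n n i j) \<longlonglongrightarrow> \<Gamma> i j"
  shows "gaussian_field M S D \<Gamma> G"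
  unfolding gaussian_field_def
proof (intro conjI ballI allI impI)
  interpret prob_space M by fact
  show "\<xi> \<in> borel_measurable M" if "\<xi> \<in> S" for \<xi> using gaussian_fieldD(1)[OF Gn that] .
  fix \<xi> I a assume \<xi>: "\<xi> \<in> S" and "finite I \<and> I \<subseteq> D"
  then have I: "finite I" "I \<subseteq> D" by auto
  have [measurable]: "\<xi> \<in> borel_measurable M" using gaussian_fieldD(1)[OF Gn \<xi>] .
  have [measurable]: "(\<lambda>\<omega>. \<Sum>i\<in>I. a i * Gn n i \<omega>) \<in> borel_measurable M" for n
    using I(2) by (intro borel_measurable_sum borel_measurable_times borel_measurable_const gaussian_fieldD[OF Gn]) auto
  have [measurable]: "(\<lambda>\<omega>. \<Sum>i\<in>I. a i * G i \<omega>) \<in> borel_measurable M"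
    using I(2) by (intro borel_measurable_sum borel_measurable_times borel_measurable_const G) auto
  have ae: "AE \<omega> in M. \<forall>i\<in>I. (\<lambda>n. Gn n i \<omega>) \<longlonglongrightarrow> G i \<omega>"
    using I lim by (subst AE_ball_countable) (auto intro: countable_finite)
  have 1: "(\<lambda>n. LINT \<omega>|M. iexp (\<xi> \<omega> + (\<Sum>i\<in>I. a i * Gn n i \<omega>))) \<longlonglongrightarrow> (LINT \<omega>|M. iexp (\<xi> \<omega> + (\<Sum>i\<in>I. a i * G i \<omega>)))"
  proof (rule integral_dominated_convergence[where w = "\<lambda>_. 1"])
    show "AE \<omega> in M. (\<lambda>n. iexp (\<xi> \<omega> + (\<Sum>i\<in>I. a i * Gn n i \<omega>))) \<longlonglongrightarrow> iexp (\<xi> \<omega> + (\<Sum>i\<in>I. a i * G i \<omega>))"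
      using ae by eventually_elim (intro tendsto_intros, auto)
    show "(\<lambda>\<omega>. iexp (\<xi> \<omega> + (\<Sum>i\<in>I. a i * G i \<omega>))) \<in> borel_measurable M" by measurable
    show "(\<lambda>\<omega>. iexp (\<xi> \<omega> + (\<Sum>i\<in>I. a i * Gn n i \<omega>))) \<in> borel_measurable M" for n by measurable
    show "AE \<omega> in M. norm (iexp (\<xi> \<omega> + (\<Sum>i\<in>I. a i * Gn n i \<omega>))) \<le> 1" for n by simp
  qed simp
  have 2: "(\<lambda>n. LINT \<omega>|M. iexp (\<xi> \<omega> + (\<Sum>i\<in>I. a i * Gn n i \<omega>))) \<longlonglongrightarrow>
     (LINT \<omega>|M. iexp (\<xi> \<omega>)) * exp (complex_of_real (- (\<Sum>i\<in>I. \<Sum>j\<in>I. a i * a j * \<Gamma> i j) / 2))"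
    unfolding gaussian_fieldD(3)[OF Gn \<xi> I] using I(2) by (intro tendsto_intros cov) auto
  show "(LINT \<omega>|M. iexp (\<xi> \<omega> + (\<Sum>i\<in>I. a i * G i \<omega>))) =
     (LINT \<omega>|M. iexp (\<xi> \<omega>)) * exp (complex_of_real (- (\<Sum>i\<in>I. \<Sum>j\<in>I. a i * a j * \<Gamma> i j) / 2))"
    using 1 2 by (rule LIMSEQ_unique)
qed (rule G)

lemma gaussian_field_normal_law:
  assumes M: "prob_space M" and G: "gaussian_field M S D \<Gamma> G" and S: "(\<lambda>_. 0) \<in> S"
    and I: "finite I" "I \<subseteq> D"
  shows "normal_law (distr M borel (\<lambda>\<omega>. m + (\<Sum>i\<in>I. a i * G i \<omega>))) m (\<Sum>i\<in>I. \<Sum>j\<in>I. a i * a j * \<Gamma> i j)"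
proof (rule normal_law_from_char[OF M])
  interpret prob_space M by fact
  show "(\<lambda>\<omega>. m + (\<Sum>i\<in>I. a i * G i \<omega>)) \<in> borel_measurable M"
    using I(2) by (intro borel_measurable_add borel_measurable_sum borel_measurable_times borel_measurable_const gaussian_fieldD[OF G]) auto
  fix t
  have q: "(\<Sum>i\<in>I. \<Sum>j\<in>I. (t * a i) * (t * a j) * \<Gamma> i j) = t\<^sup>2 * (\<Sum>i\<in>I. \<Sum>j\<in>I. a i * a j * \<Gamma> i j)"
    by (simp add: sum_distrib_left power2_eq_square mult_ac)
  have "(LINT \<omega>|M. iexp (t * (m + (\<Sum>i\<in>I. a i * G i \<omega>)))) = (LINT \<omega>|M. iexp (t * m) * iexp (0 + (\<Sum>i\<in>I. (t * a i) * G i \<omega>)))"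
    by (simp add: exp_add[symmetric] algebra_simps sum_distrib_left)
  also have "\<dots> = iexp (t * m) * (LINT \<omega>|M. iexp (0 + (\<Sum>i\<in>I. (t * a i) * G i \<omega>)))"
    by (rule integral_mult_right_zero)
  also have "(LINT \<omega>|M. iexp (0 + (\<Sum>i\<in>I. (t * a i) * G i \<omega>))) = exp (complex_of_real (- (t\<^sup>2 * (\<Sum>i\<in>I. \<Sum>j\<in>I. a i * a j * \<Gamma> i j)) / 2))"
    unfolding gaussian_fieldD(3)[OF G S I] q by (simp add: prob_space)
  finally show "(LINT \<omega>|M. iexp (t * (m + (\<Sum>i\<in>I. a i * G i \<omega>)))) =
    iexp (t * m) * exp (complex_of_real (- (t\<^sup>2 * (\<Sum>i\<in>I. \<Sum>j\<in>I. a i * a j * \<Gamma> i j)) / 2))" .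
qed

text \<open>With all finite combinations of the \<open>Y j\<close> among the test variables, the
  identity defining the field is a factorization of joint characteristic functions.\<close>

lemma gaussian_field_indep:
  fixes Y :: "'j \<Rightarrow> 'a \<Rightarrow> real"
  assumes M: "prob_space M" and G: "gaussian_field M S D \<Gamma> G" and S: "(\<lambda>_. 0) \<in> S"
    and Y: "\<And>F s. finite F \<Longrightarrow> F \<subseteq> J \<Longrightarrow> (\<lambda>\<omega>. \<Sum>j\<in>F. s j * Y j \<omega>) \<in> S"
  shows "distr M ((\<Pi>\<^sub>M j\<in>J. borel) \<Otimes>\<^sub>M (\<Pi>\<^sub>M i\<in>D. borel)) (\<lambda>\<omega>. (\<lambda>j\<in>J. Y j \<omega>, \<lambda>i\<in>D. G i \<omega>)) =
    distr M (\<Pi>\<^sub>M j\<in>J. borel) (\<lambda>\<omega>. \<lambda>j\<in>J. Y j \<omega>) \<Otimes>\<^sub>M distr M (\<Pi>\<^sub>M i\<in>D. borel) (\<lambda>\<omega>. \<lambda>i\<in>D. G i \<omega>)"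
proof (rule indep_from_char[OF M])
  interpret prob_space M by fact
  show "Y j \<in> borel_measurable M" if "j \<in> J" for j
    using gaussian_fieldD(1)[OF G Y[of "{j}" "\<lambda>_. 1"]] that by simp
  show "G i \<in> borel_measurable M" if "i \<in> D" for i using gaussian_fieldD(2)[OF G that] .
  fix s t F H assume F: "finite F" "F \<subseteq> J" and H: "finite H" "H \<subseteq> D"
  have 1: "(LINT \<omega>|M. iexp (\<Sum>k\<in>H. t k * G k \<omega>)) = exp (complex_of_real (- (\<Sum>i\<in>H. \<Sum>j\<in>H. t i * t j * \<Gamma> i j) / 2))"
    using gaussian_fieldD(3)[OF G S H, of t] by (simp add: prob_space)
  show "(LINT \<omega>|M. iexp ((\<Sum>j\<in>F. s j * Y j \<omega>) + (\<Sum>k\<in>H. t k * G k \<omega>))) =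
       (LINT \<omega>|M. iexp (\<Sum>j\<in>F. s j * Y j \<omega>)) * (LINT \<omega>|M. iexp (\<Sum>k\<in>H. t k * G k \<omega>))"
    unfolding 1 by (rule gaussian_fieldD(3)[OF G Y[OF F] H])
qed

section \<open>Riemann--Stieltjes sums and the singular linear equation\<close>

lemma nat_floor_div_le: "0 \<le> u \<Longrightarrow> real (nat \<lfloor>real n * u\<rfloor>) / real n \<le> u"
  by (cases "n = 0") (auto simp: divide_le_eq mult.commute)

lemma tendsto_nat_floor_div:
  assumes "0 \<le> u"
  shows "(\<lambda>n. real (nat \<lfloor>real n * u\<rfloor>) / real n) \<longlonglongrightarrow> u"
proof (rule tendsto_sandwich[where f = "\<lambda>n. u - 1 / real n" and h = "\<lambda>_. u"])
  show "\<forall>\<^sub>F n in sequentially. u - 1 / real n \<le> real (nat \<lfloor>real n * u\<rfloor>) / real n"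
  proof (intro eventually_sequentiallyI[of 1])
    fix n :: nat assume n: "1 \<le> n"
    have "real n * u - 1 \<le> real (nat \<lfloor>real n * u\<rfloor>)" using assms by linarith
    then have "(real n * u - 1) / real n \<le> real (nat \<lfloor>real n * u\<rfloor>) / real n"
      by (rule divide_right_mono) simp
    moreover have "(real n * u - 1) / real n = u - 1 / real n" using n by (simp add: diff_divide_distrib)
    ultimately show "u - 1 / real n \<le> real (nat \<lfloor>real n * u\<rfloor>) / real n" by simp
  qed
  show "\<forall>\<^sub>F n in sequentially. real (nat \<lfloor>real n * u\<rfloor>) / real n \<le> u"
    using nat_floor_div_le[OF assms] by simp
  show "(\<lambda>n. u - 1 / real n) \<longlonglongrightarrow> u"
    using tendsto_diff[OF tendsto_const lim_1_over_n, of u] by simp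
qed simp

text \<open>The grid \<open>k / n\<close> is the same for every \<open>u\<close>, so that different
  times can later share the same Brownian increments. The last grid point only approaches
  \<open>u\<close>, and continuity of \<open>P\<close> closes the gap. \<open>F\<close> takes both
  ends of a cell because summation by parts will produce such integrands.\<close>

lemma riemann_sum_tendsto:
  fixes F :: "real \<Rightarrow> real \<Rightarrow> real"
  assumes u: "0 \<le> u"
    and F: "continuous_on ({0..u} \<times> {0..u}) (\<lambda>(x, y). F x y)"
    and P: "\<And>x. x \<in> {0..u} \<Longrightarrow> (P has_real_derivative F x x) (at x within {0..u})"
  shows "(\<lambda>n. (\<Sum>k<nat \<lfloor>real n * u\<rfloor>. F (real k / real n) (real (Suc k) / real n) / real n)) \<longlonglongrightarrow> P u - P 0"
proof -
  let ?N = "\<lambda>n. nat \<lfloor>real n * u\<rfloor>"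
  let ?t = "\<lambda>n k. real k / real n"
  have Pc: "continuous_on {0..u} P" by (rule DERIV_continuous_on[OF P])
  have tN: "?t n (?N n) \<in> {0..u}" for n using nat_floor_div_le[OF u, of n] by auto
  have tk: "?t n k \<in> {0..u}" if "k \<le> ?N n" for k n
  proof -
    have "?t n k \<le> ?t n (?N n)" using that by (intro divide_right_mono) auto
    then show ?thesis using tN[of n] by auto
  qed
  have lim1: "(\<lambda>n. P (?t n (?N n)) - P 0) \<longlonglongrightarrow> P u - P 0"
    using u tN
    by (intro tendsto_diff continuous_on_tendsto_compose[OF Pc tendsto_nat_floor_div] always_eventually) (auto simp del: of_nat_nat)
  have lim2: "(\<lambda>n. (P (?t n (?N n)) - P 0) - (\<Sum>k<?N n. F (?t n k) (?t n (Suc k)) / real n)) \<longlonglongrightarrow> 0"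
  proof (rule LIMSEQ_I)
    fix e :: real assume e: "0 < e"
    \<comment> \<open>The cells have total length at most \<open>u\<close>, so an error of
      \<open>e'\<close> per unit length sums to at most \<open>e' * u < e\<close>;
      \<open>u + 1\<close> keeps the denominator positive at \<open>u = 0\<close>.\<close>
    define e' where "e' = e / (u + 1)"
    have e': "e' > 0" "e' * u < e" using e u by (auto simp: e'_def field_simps)
    have "uniformly_continuous_on ({0..u} \<times> {0..u}) (\<lambda>(x, y). F x y)"
      using F by (intro compact_uniformly_continuous compact_Times) auto
    from this[unfolded uniformly_continuous_on_def, rule_format, OF e'(1)] obtain d where
      d: "d > 0" and d': "\<And>z z'. z \<in> {0..u} \<times> {0..u} \<Longrightarrow> z' \<in> {0..u} \<times> {0..u} \<Longrightarrow> dist z' z < d \<Longrightarrow>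
        dist (case z' of (x, y) \<Rightarrow> F x y) (case z of (x, y) \<Rightarrow> F x y) < e'"
      by blast
    have local: "\<bar>P y - P x - F x y * (y - x)\<bar> \<le> e' * (y - x)"
      if xy: "x < y" "x \<in> {0..u}" "y \<in> {0..u}" "y - x < d" for x y
    proof -
      have "\<exists>z\<in>{x<..<y}. P y - P x = F z z * (y - x)"
      proof (rule mvt[OF xy(1)])
        show "continuous_on {x..y} P" using xy by (intro continuous_on_subset[OF Pc]) auto
        fix z assume "x < z" "z < y"
        then have z: "z \<in> interior {0..u}" "z \<in> {0..u}" using xy by (auto simp: interior_atLeastAtMost_real)
        show "(P has_derivative (\<lambda>h. F z z * h)) (at z)"
          using P[OF z(2)] unfolding at_within_interior[OF z(1)] has_field_derivative_def .
      qed auto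
      then obtain z where z: "x < z" "z < y" and Pz: "P y - P x = F z z * (y - x)" by auto
      have "dist (x, y) (z, z) \<le> \<bar>x - z\<bar> + \<bar>y - z\<bar>"
        unfolding dist_Pair_Pair dist_real_def using sqrt_sum_squares_le_sum_abs[of "\<bar>x - z\<bar>" "\<bar>y - z\<bar>"] by simp
      also have "\<dots> < d" using z xy by linarith
      finally have "dist (F x y) (F z z) < e'"
        using d'[of "(z, z)" "(x, y)"] xy z by simp
      then have "\<bar>F z z - F x y\<bar> \<le> e'" by (simp add: dist_real_def)
      then have "\<bar>F z z - F x y\<bar> * (y - x) \<le> e' * (y - x)"
        using xy by (intro mult_right_mono) auto
      moreover have "P y - P x - F x y * (y - x) = (F z z - F x y) * (y - x)"
        unfolding Pz by (simp add: algebra_simps)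
      ultimately show ?thesis using xy by (simp add: abs_mult)
    qed
    obtain n0 where n0: "1 / d < real n0" using reals_Archimedean2 by blast
    show "\<exists>n0. \<forall>n\<ge>n0. norm (P (?t n (?N n)) - P 0 - (\<Sum>k<?N n. F (?t n k) (?t n (Suc k)) / real n) - 0) < e"
    proof (intro exI[of _ n0] allI impI)
      fix n assume n: "n0 \<le> n"
      then have "1 / d < real n" using n0 by simp
      moreover have "0 < 1 / d" using d by simp
      ultimately have n0: "0 < real n" by linarith
      with \<open>1 / d < real n\<close> have nd: "0 < real n" "1 / real n < d" using d by (auto simp: field_simps)
      have step: "\<bar>P (?t n (Suc k)) - P (?t n k) - F (?t n k) (?t n (Suc k)) / real n\<bar> \<le> e' / real n"
        if k: "k < ?N n" for k
      proof -
        have "?t n k < ?t n (Suc k)" "?t n k \<in> {0..u}" "?t n (Suc k) \<in> {0..u}"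
          using nd tk[of k n] tk[of "Suc k" n] k by (simp_all add: divide_strict_right_mono del: of_nat_nat)
        moreover have "?t n (Suc k) - ?t n k = 1 / real n" by (simp add: diff_divide_distrib[symmetric])
        ultimately show ?thesis using local[of "?t n k" "?t n (Suc k)"] nd by simp
      qed
      have "P (?t n (?N n)) - P 0 - (\<Sum>k<?N n. F (?t n k) (?t n (Suc k)) / real n) =
        (\<Sum>k<?N n. P (?t n (Suc k)) - P (?t n k) - F (?t n k) (?t n (Suc k)) / real n)"
        using sum_lessThan_telescope[of "\<lambda>k. P (?t n k)" "?N n"] by (simp add: sum_subtractf)
      also have "\<bar>\<dots>\<bar> \<le> (\<Sum>k<?N n. e' / real n)"
        by (rule order_trans[OF sum_abs sum_mono]) (use step in auto)
      also have "\<dots> = e' * ?t n (?N n)" by simp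
      also have "\<dots> \<le> e' * u" using tN[of n] e' by (intro mult_left_mono) auto
      finally show "norm (P (?t n (?N n)) - P 0 - (\<Sum>k<?N n. F (?t n k) (?t n (Suc k)) / real n) - 0) < e"
        using e'(2) by simp
    qed
  qed
  show ?thesis using tendsto_diff[OF lim1 lim2] by simp
qed

lemma sum_by_parts:
  fixes g b :: "nat \<Rightarrow> real"
  shows "(\<Sum>k<N. g k * (b (Suc k) - b k)) = g N * b N - g 0 * b 0 - (\<Sum>k<N. (g (Suc k) - g k) * b (Suc k))"
  by (induction N) (auto simp: algebra_simps)

text \<open>The kernel \<open>1 / (T - r)\<close> is smooth before \<open>T\<close>, so its sums
  against a merely continuous path converge after summation by parts. The limit is the boundary term
  minus the integral of \<open>b\<close> against the derivative of the kernel, represented by the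
  antiderivative \<open>P\<close>.\<close>

lemma stieltjes_sum_tendsto:
  fixes b :: "real \<Rightarrow> real"
  assumes u: "0 \<le> u" "u < T" and b: "continuous_on {0..u} b" "b 0 = 0"
    and P: "\<And>t. t \<in> {0..u} \<Longrightarrow> (P has_real_derivative b t / (T - t)\<^sup>2) (at t within {0..u})"
  shows "(\<lambda>n. \<Sum>k<nat \<lfloor>real n * u\<rfloor>. (b (real (Suc k) / real n) - b (real k / real n)) / (T - real k / real n))
     \<longlonglongrightarrow> b u / (T - u) - (P u - P 0)"
proof -
  let ?N = "\<lambda>n. nat \<lfloor>real n * u\<rfloor>"
  let ?t = "\<lambda>n k. real k / real n"
  have tk: "?t n k \<in> {0..u}" if "k \<le> ?N n" for k n
  proof -
    have "?t n k \<le> ?t n (?N n)" using that by (intro divide_right_mono) auto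
    then show ?thesis using nat_floor_div_le[OF u(1), of n] by auto
  qed
  have c: "continuous_on {0..u} (\<lambda>t. 1 / (T - t) * b t)"
    using u b by (intro continuous_intros) auto
  have lim1: "(\<lambda>n. 1 / (T - ?t n (?N n)) * b (?t n (?N n))) \<longlonglongrightarrow> 1 / (T - u) * b u"
    using u tk[OF order_refl]
    by (intro continuous_on_tendsto_compose[OF c tendsto_nat_floor_div] always_eventually) (auto simp del: of_nat_nat)
  have "(\<lambda>n. \<Sum>k<?N n. (\<lambda>x y. b y / ((T - x) * (T - y))) (?t n k) (?t n (Suc k)) / real n) \<longlonglongrightarrow> P u - P 0"
  proof (rule riemann_sum_tendsto[OF u(1)])
    have "continuous_on ({0..u} \<times> {0..u}) (\<lambda>z. b (snd z) / ((T - fst z) * (T - snd z)))"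
      using u by (intro continuous_intros continuous_on_compose2[OF b(1)]) auto
    then show "continuous_on ({0..u} \<times> {0..u}) (\<lambda>(x, y). b y / ((T - x) * (T - y)))"
      by (simp add: case_prod_unfold)
  qed (use P in \<open>auto simp: power2_eq_square\<close>)
  then have "(\<lambda>n. 1 / (T - ?t n (?N n)) * b (?t n (?N n)) - (\<Sum>k<?N n. b (?t n (Suc k)) / ((T - ?t n k) * (T - ?t n (Suc k))) / real n)) \<longlonglongrightarrow> 1 / (T - u) * b u - (P u - P 0)"
    by (intro tendsto_diff lim1)
  moreover have "1 / (T - ?t n (?N n)) * b (?t n (?N n)) - (\<Sum>k<?N n. b (?t n (Suc k)) / ((T - ?t n k) * (T - ?t n (Suc k))) / real n)
     = (\<Sum>k<?N n. (b (?t n (Suc k)) - b (?t n k)) / (T - ?t n k))" for n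
  proof -
    \<comment> \<open>The increment of \<open>1 / (T - t)\<close> over a cell is exactly
      \<open>1 / n\<close> times \<open>1 / ((T - x) * (T - y))\<close>, with \<open>x\<close> and
      \<open>y\<close> the two ends; hence the two-argument integrand.\<close>
    have "(\<Sum>k<?N n. b (?t n (Suc k)) / ((T - ?t n k) * (T - ?t n (Suc k))) / real n) =
       (\<Sum>k<?N n. (1 / (T - ?t n (Suc k)) - 1 / (T - ?t n k)) * b (?t n (Suc k)))"
    proof (rule sum.cong[OF refl])
      fix k assume "k \<in> {..<?N n}"
      then have "T - ?t n k > 0" "T - ?t n (Suc k) > 0"
        using tk[of k n] tk[of "Suc k" n] u by (auto simp del: of_nat_Suc)
      moreover have n: "1 / real n = (T - ?t n k) - (T - ?t n (Suc k))" by (simp add: add_divide_distrib)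
      moreover have "1 / B - 1 / A = (A - B) * (1 / (A * B))" if "A > 0" "B > 0" for A B :: real
        using that by (simp add: field_simps)
      ultimately have "(1 / (T - ?t n (Suc k)) - 1 / (T - ?t n k)) = 1 / real n * (1 / ((T - ?t n k) * (T - ?t n (Suc k))))"
        unfolding n by (simp only:)
      then show "b (?t n (Suc k)) / ((T - ?t n k) * (T - ?t n (Suc k))) / real n =
        (1 / (T - ?t n (Suc k)) - 1 / (T - ?t n k)) * b (?t n (Suc k))"
        by (simp only:) (simp add: divide_inverse mult_ac)
    qed
    then show ?thesis
      using sum_by_parts[of "\<lambda>k. 1 / (T - ?t n k)" "\<lambda>k. b (?t n k)" "?N n"] b(2) by simp
  qed
  ultimately show ?thesis by simp
qed

text \<open>\<open>P\<close> may blow up like \<open>1 / (T - t)\<close>. Compared with that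
  function, the quotient of derivatives is just \<open>b t\<close>, and this form of L'Hopital's
  rule asks for divergence of the denominator alone, so the growth of \<open>P\<close> need not be
  estimated.\<close>

lemma singular_kernel_limit:
  fixes b :: "real \<Rightarrow> real"
  assumes T: "0 < T" and b: "continuous_on {0..T} b"
    and P: "\<And>u t. u < T \<Longrightarrow> t \<in> {0..u} \<Longrightarrow> (P has_real_derivative b t / (T - t)\<^sup>2) (at t within {0..u})"
  shows "((\<lambda>t. (T - t) * P t) \<longlongrightarrow> b T) (at_left T)"
proof -
  have ev: "\<forall>\<^sub>F t in at_left T. t \<in> {0<..<T}"
    using T by (intro eventually_at_leftI[of 0]) auto
  have bT: "(b \<longlongrightarrow> b T) (at_left T)"
    using b T unfolding continuous_on_def at_within_Icc_at_left[OF T, symmetric] by auto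
  have "((\<lambda>t. P t / (1 / (T - t))) \<longlongrightarrow> b T) (at_left T)"
  proof (rule lhopital_left_at_top[where f' = "\<lambda>t. b t / (T - t)\<^sup>2" and g' = "\<lambda>t. 1 / (T - t)\<^sup>2"])
    have "((\<lambda>t. T - t) \<longlongrightarrow> T - T) (at_left T)" by (intro tendsto_intros)
    moreover have "\<forall>\<^sub>F t in at_left T. 0 < T - t" using ev by eventually_elim auto
    ultimately have "filterlim (\<lambda>t. T - t) (at_right 0) (at_left T)" by (intro filterlim_at_withinI) (auto elim: eventually_mono)
    then have "filterlim (\<lambda>t. inverse (T - t)) at_top (at_left T)"
      by (rule filterlim_compose[OF filterlim_inverse_at_top_right])
    then show "filterlim (\<lambda>t. 1 / (T - t)) at_top (at_left T)" by (simp add: inverse_eq_divide)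
    show "\<forall>\<^sub>F t in at_left T. 1 / (T - t)\<^sup>2 \<noteq> 0" using ev by eventually_elim auto
    show "\<forall>\<^sub>F t in at_left T. (P has_real_derivative b t / (T - t)\<^sup>2) (at t)"
      using ev
    proof eventually_elim
      case (elim t)
      \<comment> \<open>The derivative is known only within intervals \<open>{0..u}\<close>; the
        midpoint between \<open>t\<close> and \<open>T\<close> serves as \<open>u\<close>, so that
        \<open>t\<close> is interior and the derivative is two-sided.\<close>
      then have "t \<in> interior {0..(t + T) / 2}" by (auto simp: interior_atLeastAtMost_real field_simps)
      from at_within_interior[OF this] show ?case using P[of "(t + T) / 2" t] elim by auto
    qed
    show "\<forall>\<^sub>F t in at_left T. ((\<lambda>t. 1 / (T - t)) has_real_derivative 1 / (T - t)\<^sup>2) (at t)"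
      using ev
    proof eventually_elim
      case (elim t)
      then show ?case by (auto intro!: derivative_eq_intros simp: power2_eq_square field_simps)
    qed
    show "((\<lambda>t. b t / (T - t)\<^sup>2 / (1 / (T - t)\<^sup>2)) \<longlongrightarrow> b T) (at_left T)"
    proof (rule Lim_transform_eventually[OF bT])
      show "\<forall>\<^sub>F t in at_left T. b t = b t / (T - t)\<^sup>2 / (1 / (T - t)\<^sup>2)" using ev by eventually_elim auto
    qed
  qed
  then show ?thesis by (simp add: mult.commute)
qed

text \<open>The integrating-factor computation read backwards: from a given solution, a function
  \<open>P\<close> is built whose derivative contains noise only. No existence or uniqueness theorem
  for the equation is involved.\<close>

lemma interacting_path_solution:
  fixes x w :: "'c::finite \<Rightarrow> real \<Rightarrow> real"
  defines "avg \<equiv> \<lambda>z t. (\<Sum>c\<in>UNIV. z c t) / real CARD('c)"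
  assumes T: "0 < T" and x: "\<And>c. continuous_on {0..<T} (x c)"
    and eq: "\<And>c t. t \<in> {0..<T} \<Longrightarrow> x c t = x c 0 + integral {0..t} (\<lambda>r. (avg x r - x c r) / (T - r)) + w c t"
  obtains P where "\<And>c. P c 0 = 0"
    "\<And>c u t. u < T \<Longrightarrow> t \<in> {0..u} \<Longrightarrow> (P c has_real_derivative (w c t - avg w t) / (T - t)\<^sup>2) (at t within {0..u})"
    "\<And>c t. t \<in> {0..<T} \<Longrightarrow> x c t - ((T - t) / T * x c 0 + t / T * avg x 0) = w c t - (T - t) * P c t"
proof -
  have C: "real CARD('c) > 0" by simp
  define I where "I c t = integral {0..t} (\<lambda>r. (avg x r - x c r) / (T - r))" for c t
  have xa: "continuous_on {0..<T} (avg x)"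
    unfolding avg_def using x by (intro continuous_intros) auto
  have cont: "continuous_on {0..u} (\<lambda>r. (avg x r - x c r) / (T - r))" if "u < T" for u c
    using that by (intro continuous_intros continuous_on_subset[OF xa] continuous_on_subset[OF x]) auto
  have I': "(I c has_real_derivative (avg x t - x c t) / (T - t)) (at t within {0..u})"
    if "u < T" "t \<in> {0..u}" for u t c
    unfolding I_def by (rule integral_has_real_derivative[OF cont]) (use that in auto)
  have I0: "I c 0 = 0" for c by (simp add: I_def)
  have xI: "x c t = x c 0 + I c t + w c t" if "t \<in> {0..<T}" for c t
    using eq[OF that] by (simp add: I_def)
  have Isum: "(\<Sum>c\<in>UNIV. I c t) = 0" if t: "t \<in> {0..<T}" for t
  proof -
    have "(\<Sum>c\<in>UNIV. I c t) = integral {0..t} (\<lambda>r. \<Sum>c\<in>UNIV. (avg x r - x c r) / (T - r))"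
      unfolding I_def using t by (subst integral_sum) (auto intro!: integrable_continuous_real cont)
    also have "(\<lambda>r. \<Sum>c\<in>UNIV. (avg x r - x c r) / (T - r)) = (\<lambda>_. 0)"
      unfolding sum_divide_distrib[symmetric] sum_subtractf using C by (simp add: avg_def)
    finally show ?thesis by simp
  qed
  have xavg: "avg x t = avg x 0 + avg w t" if t: "t \<in> {0..<T}" for t
  proof -
    have "(\<Sum>c\<in>UNIV. x c t) = (\<Sum>c\<in>UNIV. x c 0) + (\<Sum>c\<in>UNIV. I c t) + (\<Sum>c\<in>UNIV. w c t)"
      using xI[OF t] by (simp add: sum.distrib)
    then show ?thesis unfolding avg_def using Isum[OF t] by (simp add: add_divide_distrib)
  qed
  \<comment> \<open>This is the third claimed identity solved for \<open>P\<close>, using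
    \<open>t / (T * (T - t)) = 1 / (T - t) - 1 / T\<close> and the expression of
    \<open>x c t\<close> through the drift integral \<open>I\<close>.\<close>
  define P where "P c t = - I c t / (T - t) - (x c 0 - avg x 0) * (1 / (T - t) - 1 / T)" for c t
  show thesis
  proof
    show "P c 0 = 0" for c by (simp add: P_def I0)
    show "x c t - ((T - t) / T * x c 0 + t / T * avg x 0) = w c t - (T - t) * P c t"
      if t: "t \<in> {0..<T}" for c t
    proof -
      have "(T - t) * (1 / (T - t) - 1 / T) = t / T" "(T - t) / T = 1 - t / T" using t T by (auto simp: field_simps)
      moreover have "(T - t) * (- I c t / (T - t)) = - I c t" using t by simp
      ultimately have "(T - t) * P c t = - I c t - (x c 0 - avg x 0) * (t / T)"
        unfolding P_def right_diff_distrib[of "T - t" "- I c t / (T - t)"] mult.left_commute[of "T - t" "x c 0 - avg x 0"]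
        by (simp only:)
      then show ?thesis
        unfolding \<open>(T - t) / T = 1 - t / T\<close> using xI[OF t, of c] by (simp add: algebra_simps)
    qed
    show "(P c has_real_derivative (w c t - avg w t) / (T - t)\<^sup>2) (at t within {0..u})"
      if u: "u < T" "t \<in> {0..u}" for c u t
    proof -
      have t: "t \<in> {0..<T}" "T - t \<noteq> 0" using u by auto
      have "(P c has_real_derivative - ((avg x t - x c t) / (T - t) * (T - t) + I c t) / (T - t)\<^sup>2 - (x c 0 - avg x 0) * (1 / (T - t)\<^sup>2)) (at t within {0..u})"
        unfolding P_def using t(2)
        by (auto intro!: derivative_eq_intros I'[OF u] simp: power2_eq_square add_divide_distrib diff_divide_distrib)
      moreover have "- (a / h * h + y) / h\<^sup>2 - z * (1 / h\<^sup>2) = (- (a + y) - z) / h\<^sup>2" if "h \<noteq> 0" for a y z h :: real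
        using that by (simp add: diff_divide_distrib)
      note this[OF t(2)]
      \<comment> \<open>Here the state drops out: with \<open>x c t\<close> and
        \<open>avg x t\<close> expanded, the drift integral cancels, and the initial values cancel
        against the last summand of \<open>P\<close>.\<close>
      moreover have "- ((avg x t - x c t) + I c t) - (x c 0 - avg x 0) = w c t - avg w t"
        using xI[OF t(1), of c] xavg[OF t(1)] by simp
      ultimately show ?thesis by simp
    qed
  qed
qed

section \<open>Brownian increments\<close>

lemma char_brownian_increment:
  fixes W :: "real \<Rightarrow> 'a \<Rightarrow> real^'d"
  assumes bm: "brownian_motion M W" and st: "0 \<le> s" "s < t"
  shows "(LINT \<omega>|M. iexp (a \<bullet> (W t \<omega> - W s \<omega>))) = exp (complex_of_real (- ((a \<bullet> a) * (t - s)) / 2))"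
proof -
  have M: "prob_space M" using bm by (simp add: brownian_motion_def)
  have [measurable]: "W t \<in> borel_measurable M" "W s \<in> borel_measurable M"
    using bm st by (auto simp: brownian_motion_def)
  have "multivariate_normal (distr M borel (\<lambda>\<omega>. W t \<omega> - W s \<omega>)) 0 ((t - s) *\<^sub>R mat 1)"
    using bm st by (auto simp: brownian_motion_def)
  then have "normal_law (distr (distr M borel (\<lambda>\<omega>. W t \<omega> - W s \<omega>)) borel (\<lambda>x. a \<bullet> x)) (a \<bullet> 0) (a \<bullet> (((t - s) *\<^sub>R mat 1) *v a))"
    by (simp only: multivariate_normal_def)
  then have "normal_law (distr M borel (\<lambda>\<omega>. a \<bullet> (W t \<omega> - W s \<omega>))) 0 ((a \<bullet> a) * (t - s))"
    by (subst (asm) distr_distr) (auto simp: comp_def scaleR_matrix_vector_assoc[symmetric] mult.commute)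
  from char_normal_law[OF M this, of 1] show ?thesis by simp
qed

lemma char_brownian_increments:
  fixes W :: "real \<Rightarrow> 'a \<Rightarrow> real^'d"
  assumes bm: "brownian_motion M W" and n: "0 < n"
  shows "(LINT \<omega>|M. iexp (\<Sum>j<N. a j \<bullet> (W (real (Suc j) / real n) \<omega> - W (real j / real n) \<omega>))) =
    exp (complex_of_real (- (\<Sum>j<N. (a j \<bullet> a j) / real n) / 2))"
proof -
  interpret prob_space M using bm by (simp add: brownian_motion_def)
  have M: "prob_space M" by unfold_locales
  let ?D = "\<lambda>j \<omega>. W (real (Suc j) / real n) \<omega> - W (real j / real n) \<omega>"
  have [measurable]: "W t \<in> borel_measurable M" if "0 \<le> t" for t
    using bm that by (auto simp: brownian_motion_def)
  have [measurable]: "?D j \<in> borel_measurable M" for j by (intro borel_measurable_diff) auto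
  have bmi: "indep_vars (\<lambda>_. borel) (\<lambda>i \<omega>. W (\<sigma> (Suc i)) \<omega> - W (\<sigma> i) \<omega>) {..<N}"
    if "0 \<le> \<sigma> 0" "\<forall>i<N. \<sigma> i \<le> \<sigma> (Suc i)" for \<sigma>
    using bm that by (simp add: brownian_motion_def)
  have "indep_vars (\<lambda>_. borel) ?D {..<N}" by (rule bmi) (auto intro!: divide_right_mono)
  then have ind: "indep_vars (\<lambda>_. borel) (\<lambda>j \<omega>. iexp (a j \<bullet> ?D j \<omega>)) {..<N}"
    by (rule indep_vars_compose2[where Y = "\<lambda>j x. iexp (a j \<bullet> x)"]) measurable
  have "(LINT \<omega>|M. iexp (\<Sum>j<N. a j \<bullet> ?D j \<omega>)) = (LINT \<omega>|M. (\<Prod>j<N. iexp (a j \<bullet> ?D j \<omega>)))"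
    by (simp add: exp_sum sum_distrib_left)
  also have "\<dots> = (\<Prod>j<N. LINT \<omega>|M. iexp (a j \<bullet> ?D j \<omega>))"
    by (rule indep_vars_lebesgue_integral[OF _ ind]) (auto intro!: integrable_bounded[OF M, where B = 1])
  also have "\<dots> = (\<Prod>j<N. exp (complex_of_real (- ((a j \<bullet> a j) / real n) / 2)))"
  proof (rule prod.cong[OF refl])
    fix j
    have d: "real (Suc j) / real n - real j / real n = 1 / real n" by (simp add: diff_divide_distrib[symmetric])
    show "(LINT \<omega>|M. iexp (a j \<bullet> ?D j \<omega>)) = exp (complex_of_real (- ((a j \<bullet> a j) / real n) / 2))"
      using char_brownian_increment[OF bm, of "real j / real n" "real (Suc j) / real n" "a j", unfolded d] n
      by (simp add: divide_strict_right_mono)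
  qed
  also have "\<dots> = exp (complex_of_real (- (\<Sum>j<N. (a j \<bullet> a j) / real n) / 2))"
    unfolding exp_sum[OF finite_lessThan, symmetric] of_real_sum[symmetric] sum_negf sum_divide_distrib[symmetric] ..
  finally show ?thesis .
qed

text \<open>The test variables that express independence of the noise from all initial values
  jointly, whatever their laws.\<close>

definition linear_functionals :: "('c::finite \<Rightarrow> 'a \<Rightarrow> real^'d) \<Rightarrow> ('a \<Rightarrow> real) set" where
  "linear_functionals X = range (\<lambda>\<tau> \<omega>. \<Sum>c\<in>UNIV. \<tau> c \<bullet> X c \<omega>)"

lemma linear_functionals_0: "(\<lambda>_. 0) \<in> linear_functionals X"
  unfolding linear_functionals_def by (rule image_eqI[of _ _ "\<lambda>_. 0"]) auto

text \<open>Discrete white noise. Particles and initial values separate through the independent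
  sigma-algebras of whole paths and initial positions, grid cells through independent increments,
  coordinates through the identity covariance; the characteristic function factors in that
  order.\<close>

lemma brownian_increments_gaussian_field:
  fixes W :: "'c::finite \<Rightarrow> real \<Rightarrow> 'a \<Rightarrow> real^'d" and X0 :: "'c \<Rightarrow> 'a \<Rightarrow> real^'d"
  assumes M: "prob_space M" and bm: "\<And>c. brownian_motion M (W c)"
    and X0: "\<And>c. X0 c \<in> borel_measurable M"
    and indep: "prob_space.indep_sets M
        (case_sum
          (\<lambda>c. sets (vimage_algebra (space M) (\<lambda>\<omega>. \<lambda>t\<in>{0..}. W c t \<omega>) (\<Pi>\<^sub>M t\<in>{0..}. borel)))
          (\<lambda>c. sets (vimage_algebra (space M) (X0 c) borel)))
        (UNIV :: ('c + 'c) set)"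
    and n: "0 < n"
  shows "gaussian_field M (linear_functionals X0) UNIV (\<lambda>p q. if p = q then 1 / real n else 0)
    (\<lambda>(c, k, j) \<omega>. W c (real (Suc j) / real n) \<omega> $ k - W c (real j / real n) \<omega> $ k)"
  unfolding gaussian_field_def
proof (intro conjI ballI allI impI)
  interpret prob_space M by fact
  note [measurable] = X0
  have W[measurable]: "W c t \<in> borel_measurable M" if "0 \<le> t" for c t
    using bm[of c] that by (auto simp: brownian_motion_def)
  let ?G = "\<lambda>(c, k, j) \<omega>. W c (real (Suc j) / real n) \<omega> $ k - W c (real j / real n) \<omega> $ k"
  show "?G i \<in> borel_measurable M" for i
    by (cases i) (auto intro!: borel_measurable_diff measurable_compose[OF W borel_measurable_nth])
  fix \<xi> assume "\<xi> \<in> linear_functionals X0"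
  then obtain \<tau> where \<xi>: "\<xi> = (\<lambda>\<omega>. \<Sum>c\<in>UNIV. \<tau> c \<bullet> X0 c \<omega>)" by (auto simp: linear_functionals_def)
  show "\<xi> \<in> borel_measurable M" unfolding \<xi> by measurable
  fix I :: "('c \<times> 'd \<times> nat) set" and a :: "'c \<times> 'd \<times> nat \<Rightarrow> real" assume I: "finite I \<and> I \<subseteq> UNIV"
  \<comment> \<open>A strict bound on the time indices occurring in \<open>I\<close>; the inserted 0
    covers the empty set.\<close>
  define N where "N = Suc (Max (insert 0 ((\<lambda>(c, k, j). j) ` I)))"
  have N: "j < N" if "(c, k, j) \<in> I" for c k j
    using I that unfolding N_def by (auto intro!: le_imp_less_Suc Max_ge rev_image_eqI[of "(c, k, j)"])
  \<comment> \<open>The coefficients belonging to one particle and one cell, gathered into a vector,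
    with 0 at the coordinates that do not occur in \<open>I\<close>.\<close>
  define l where "l c j = (\<chi> k. if (c, k, j) \<in> I then a (c, k, j) else 0)" for c j
  let ?D = "\<lambda>c j \<omega>. W c (real (Suc j) / real n) \<omega> - W c (real j / real n) \<omega>"
  have sumI: "(\<Sum>p\<in>I. f p) = (\<Sum>c\<in>UNIV. \<Sum>j<N. \<Sum>k\<in>UNIV. if (c, k, j) \<in> I then f (c, k, j) else 0)" for f :: "_ \<Rightarrow> real"
  proof -
    have "(\<Sum>p\<in>I. f p) = (\<Sum>p\<in>UNIV \<times> UNIV \<times> {..<N}. if p \<in> I then f p else 0)"
      using N by (subst sum.inter_restrict[symmetric]) (auto intro!: sum.cong)
    also have "\<dots> = (\<Sum>c\<in>UNIV. \<Sum>k\<in>UNIV. \<Sum>j<N. if (c, k, j) \<in> I then f (c, k, j) else 0)"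
      by (simp add: sum.cartesian_product)
    also have "\<dots> = (\<Sum>c\<in>UNIV. \<Sum>j<N. \<Sum>k\<in>UNIV. if (c, k, j) \<in> I then f (c, k, j) else 0)"
      by (intro sum.cong refl sum.swap)
    finally show ?thesis .
  qed
  have lin: "(\<Sum>p\<in>I. a p * ?G p \<omega>) = (\<Sum>c\<in>UNIV. \<Sum>j<N. l c j \<bullet> ?D c j \<omega>)" for \<omega>
    unfolding sumI inner_vec_def by (intro sum.cong) (auto simp: l_def)
  have quad: "(\<Sum>p\<in>I. \<Sum>q\<in>I. a p * a q * (if p = q then 1 / real n else 0)) = (\<Sum>c\<in>UNIV. \<Sum>j<N. (l c j \<bullet> l c j) / real n)"
  proof -
    have "(\<Sum>p\<in>I. \<Sum>q\<in>I. a p * a q * (if p = q then 1 / real n else 0)) = (\<Sum>p\<in>I. a p * a p / real n)"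
      using I by (intro sum.cong refl) (simp add: if_distrib cong: if_cong)
    also have "\<dots> = (\<Sum>c\<in>UNIV. \<Sum>j<N. (l c j \<bullet> l c j) / real n)"
      unfolding sumI inner_vec_def sum_divide_distrib by (intro sum.cong) (auto simp: l_def)
    finally show ?thesis .
  qed
  \<comment> \<open>One unimodular variable per independent source: the whole noise contribution of
    a particle, or its initial contribution. Each is measurable for its own sigma-algebra in
    \<open>indep\<close>.\<close>
  define Y where "Y l i = (case i of Inl c \<Rightarrow> (\<lambda>\<omega>. iexp (\<Sum>j<N. l c j \<bullet> ?D c j \<omega>)) | Inr c \<Rightarrow> (\<lambda>\<omega>. iexp (\<tau> c \<bullet> X0 c \<omega>)))"
    for l :: "'c \<Rightarrow> nat \<Rightarrow> real^'d" and i
  have Y[measurable]: "Y l i \<in> borel_measurable M" for l i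
    unfolding Y_def by (cases i) (auto simp del: of_real_sum)
  have Yind: "indep_vars (\<lambda>_. borel) (Y l) UNIV" for l
    unfolding indep_vars_def2
  proof (intro conjI ballI Y indep_sets_mono_sets[OF indep])
    fix i :: "'c + 'c"
    let ?V = "\<lambda>c. vimage_algebra (space M) (\<lambda>\<omega>. \<lambda>t\<in>{0..}. W c t \<omega>) (\<Pi>\<^sub>M t\<in>{0..}. borel :: (real^'d) measure)"
    let ?V' = "\<lambda>c. vimage_algebra (space M) (X0 c) (borel :: (real^'d) measure)"
    have path: "(\<lambda>\<omega>. \<lambda>t\<in>{0..}. W c t \<omega>) \<in> ?V c \<rightarrow>\<^sub>M (\<Pi>\<^sub>M t\<in>{0..}. borel)" for c
      by (intro measurable_vimage_algebra1) (auto simp: space_PiM)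
    have WV[measurable]: "W c t \<in> ?V c \<rightarrow>\<^sub>M borel" if t: "0 \<le> t" for c t
      using measurable_compose[OF path measurable_component_singleton[of t "{0..}" "\<lambda>_. borel"], of c] t by simp
    have XV[measurable]: "X0 c \<in> ?V' c \<rightarrow>\<^sub>M borel" for c
      by (intro measurable_vimage_algebra1) auto
    show "{Y l i -` A \<inter> space M |A. A \<in> sets borel} \<subseteq>
       (case i of Inl c \<Rightarrow> sets (?V c) | Inr c \<Rightarrow> sets (?V' c))"
    proof (cases i)
      case (Inl c)
      have "Y l i \<in> ?V c \<rightarrow>\<^sub>M borel" unfolding Y_def Inl by (simp del: of_real_sum)
      then show ?thesis using Inl by (auto dest: measurable_sets)
    next
      case (Inr c)
      have "Y l i \<in> ?V' c \<rightarrow>\<^sub>M borel" unfolding Y_def Inr by simp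
      then show ?thesis using Inr by (auto dest: measurable_sets)
    qed
  qed
  have split: "(LINT \<omega>|M. iexp (\<xi> \<omega> + (\<Sum>c\<in>UNIV. \<Sum>j<N. l c j \<bullet> ?D c j \<omega>))) =
     (\<Prod>c\<in>UNIV. exp (complex_of_real (- (\<Sum>j<N. (l c j \<bullet> l c j) / real n) / 2))) * (\<Prod>c\<in>UNIV. LINT \<omega>|M. iexp (\<tau> c \<bullet> X0 c \<omega>))"
    for l :: "'c \<Rightarrow> nat \<Rightarrow> real^'d"
  proof -
    have "(\<Prod>i\<in>UNIV. Y l i \<omega>) = iexp (\<xi> \<omega> + (\<Sum>c\<in>UNIV. \<Sum>j<N. l c j \<bullet> ?D c j \<omega>))" for \<omega>
    proof -
      have "(\<Prod>i\<in>UNIV. Y l i \<omega>) = (\<Prod>c\<in>UNIV. iexp (\<Sum>j<N. l c j \<bullet> ?D c j \<omega>)) * (\<Prod>c\<in>UNIV. iexp (\<tau> c \<bullet> X0 c \<omega>))"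
        unfolding UNIV_Plus_UNIV[symmetric] by (subst prod.Plus) (simp_all add: Y_def)
      also have "\<dots> = iexp (\<Sum>c\<in>UNIV. \<Sum>j<N. l c j \<bullet> ?D c j \<omega>) * iexp (\<xi> \<omega>)"
        unfolding exp_sum[OF finite, symmetric] sum_distrib_left[symmetric] of_real_sum[symmetric] \<xi> ..
      finally show ?thesis by (simp add: exp_add distrib_left)
    qed
    then have "(LINT \<omega>|M. iexp (\<xi> \<omega> + (\<Sum>c\<in>UNIV. \<Sum>j<N. l c j \<bullet> ?D c j \<omega>))) = (LINT \<omega>|M. (\<Prod>i\<in>UNIV. Y l i \<omega>))"
      by (simp only:)
    also have "\<dots> = (\<Prod>i\<in>UNIV. LINT \<omega>|M. Y l i \<omega>)"
    proof (rule indep_vars_lebesgue_integral[OF finite Yind])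
      show "integrable M (Y l i)" for i
        by (rule integrable_bounded[OF M Y, where B = 1]) (auto simp: Y_def split: sum.split simp del: of_real_sum)
    qed
    also have "\<dots> = (\<Prod>c\<in>UNIV. LINT \<omega>|M. iexp (\<Sum>j<N. l c j \<bullet> ?D c j \<omega>)) * (\<Prod>c\<in>UNIV. LINT \<omega>|M. iexp (\<tau> c \<bullet> X0 c \<omega>))"
      unfolding UNIV_Plus_UNIV[symmetric] by (subst prod.Plus) (simp_all add: Y_def)
    finally show ?thesis unfolding char_brownian_increments[OF bm n] .
  qed
  \<comment> \<open>With all noise coefficients 0, the same factorization evaluates the
    characteristic function of \<open>\<xi>\<close> alone.\<close>
  have e0: "(LINT \<omega>|M. iexp (\<xi> \<omega>)) = (\<Prod>c\<in>UNIV. LINT \<omega>|M. iexp (\<tau> c \<bullet> X0 c \<omega>))"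
    using split[of "\<lambda>_ _. 0"] by simp
  show "(LINT \<omega>|M. iexp (\<xi> \<omega> + (\<Sum>p\<in>I. a p * ?G p \<omega>))) =
     (LINT \<omega>|M. iexp (\<xi> \<omega>)) * exp (complex_of_real (- (\<Sum>p\<in>I. \<Sum>q\<in>I. a p * a q * (if p = q then 1 / real n else 0)) / 2))"
    unfolding lin quad split e0 exp_sum[OF finite, symmetric] of_real_sum[symmetric] sum_negf sum_divide_distrib[symmetric]
    by (rule mult.commute)
qed

section \<open>The noise kernel\<close>

text \<open>The weight of \<open>dW\<close> of particle \<open>c'\<close> at time \<open>r\<close> in the position of particle \<open>c\<close> at time \<open>u\<close>.\<close>

definition noise_kernel :: "real \<Rightarrow> real \<Rightarrow> 'c::finite \<Rightarrow> 'c \<Rightarrow> real \<Rightarrow> real" where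
  "noise_kernel T u c c' r = 1 / real CARD('c) + ((if c' = c then 1 else 0) - 1 / real CARD('c)) * ((T - u) / (T - r))"

definition noise_cov :: "real \<Rightarrow> 'c::finite \<times> 'd \<times> real \<Rightarrow> 'c \<times> 'd \<times> real \<Rightarrow> real" where
  "noise_cov T = (\<lambda>(c, k, u) (c', k', v). if k = k'
     then (if c = c' then min u v - u * v / T else 0) + u * v / (real CARD('c) * T) else 0)"

lemma sum_noise_kernel:
  fixes f :: "'c::finite \<Rightarrow> real"
  shows "(\<Sum>c'\<in>UNIV. noise_kernel T u c c' r * f c') =
     (\<Sum>c'\<in>UNIV. f c') / real CARD('c) + (T - u) / (T - r) * (f c - (\<Sum>c'\<in>UNIV. f c') / real CARD('c))"
proof -
  have "noise_kernel T u c c' r * f c' = f c' / real CARD('c) +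
      (T - u) / (T - r) * ((if c' = c then f c' else 0) - f c' / real CARD('c))" for c'
    by (simp add: noise_kernel_def algebra_simps)
  then show ?thesis
    by (simp add: sum.distrib sum_subtractf sum_divide_distrib[symmetric] sum_distrib_left[symmetric])
qed

text \<open>As a matrix in the particles, the kernel is \<open>J + \<rho> (I - J)\<close> with
  \<open>\<rho> = (T - u) / (T - r)\<close> and \<open>J\<close> the averaging projection. Since
  \<open>J\<close> is a symmetric idempotent, two kernels multiply by multiplying their factors
  \<open>\<rho>\<close>.\<close>

lemma sum_noise_kernel_mult:
  fixes c c' :: "'c::finite"
  shows "(\<Sum>z\<in>UNIV. noise_kernel T u c z r * noise_kernel T v c' z r) =
    1 / real CARD('c) + ((if c = c' then 1 else 0) - 1 / real CARD('c)) * ((T - u) / (T - r) * ((T - v) / (T - r)))"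
proof -
  have s: "(\<Sum>z\<in>UNIV. noise_kernel T v c' z r) = 1"
    using sum_noise_kernel[of T v c' r "\<lambda>_. 1"] by simp
  show ?thesis
    unfolding sum_noise_kernel s by (simp add: noise_kernel_def mult_ac)
qed

text \<open>Only cells before both times occur in both sums, so the double sum is a Riemann sum over
  \<open>[0, min u v]\<close> of the product of the two kernels.\<close>

lemma noise_kernel_covariance_tendsto:
  fixes c c' :: "'c::finite" and k k' :: "'d::finite"
  assumes T: "0 < T" and u: "0 \<le> u" "u < T" and v: "0 \<le> v" "v < T"
  shows "(\<lambda>n. \<Sum>p\<in>UNIV \<times> {k} \<times> {..<nat \<lfloor>real n * u\<rfloor>}. \<Sum>q\<in>UNIV \<times> {k'} \<times> {..<nat \<lfloor>real n * v\<rfloor>}.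
      noise_kernel T u c (fst p) (real (snd (snd p)) / real n) * noise_kernel T v c' (fst q) (real (snd (snd q)) / real n) *
        (if p = q then 1 / real n else 0))
    \<longlonglongrightarrow> noise_cov T (c, k, u) (c', k', v)" (is "?S \<longlonglongrightarrow> _")
proof -
  let ?C = "real CARD('c)" and ?m = "min u v"
  define d :: real where "d = (if c = c' then 1 else 0) - 1 / ?C"
  define F where "F x y = 1 / ?C + d * ((T - u) / (T - x) * ((T - v) / (T - x)))" for x y :: real
  have S: "?S n = (if k = k' then (\<Sum>j<nat \<lfloor>real n * ?m\<rfloor>. F (real j / real n) (real (Suc j) / real n) / real n) else 0)" for n
  proof -
    let ?A = "UNIV \<times> {k} \<times> {..<nat \<lfloor>real n * u\<rfloor>} :: ('c \<times> 'd \<times> nat) set"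
    let ?B = "UNIV \<times> {k'} \<times> {..<nat \<lfloor>real n * v\<rfloor>} :: ('c \<times> 'd \<times> nat) set"
    let ?g = "\<lambda>p. noise_kernel T u c (fst p) (real (snd (snd p)) / real n) * noise_kernel T v c' (fst p) (real (snd (snd p)) / real n) / real n"
    have "?S n = (\<Sum>p\<in>?A. if p \<in> ?B then ?g p else 0)"
      by (intro sum.cong refl) (simp add: if_distrib cong: if_cong)
    also have "\<dots> = (\<Sum>p\<in>?A \<inter> ?B. ?g p)" by (subst sum.inter_restrict) auto
    also have "\<dots> = (if k = k' then (\<Sum>j<nat \<lfloor>real n * ?m\<rfloor>. F (real j / real n) (real (Suc j) / real n) / real n) else 0)"
    proof (cases "k = k'")
      case True
      have "real n * ?m = min (real n * u) (real n * v)" by (simp add: min_mult_distrib_left)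
      then have "nat \<lfloor>real n * ?m\<rfloor> = min (nat \<lfloor>real n * u\<rfloor>) (nat \<lfloor>real n * v\<rfloor>)"
        by (simp add: min_def) linarith
      then have AB: "?A \<inter> ?B = UNIV \<times> {k} \<times> {..<nat \<lfloor>real n * ?m\<rfloor>}" using True by auto
      have "(\<Sum>p\<in>?A \<inter> ?B. ?g p) = (\<Sum>z\<in>UNIV. \<Sum>j<nat \<lfloor>real n * ?m\<rfloor>.
         noise_kernel T u c z (real j / real n) * noise_kernel T v c' z (real j / real n) / real n)"
      proof -
        have "(\<Sum>z\<in>UNIV. \<Sum>i\<in>{k}. \<Sum>j<nat \<lfloor>real n * ?m\<rfloor>. ?g (z, i, j)) = (\<Sum>p\<in>?A \<inter> ?B. ?g p)"
          unfolding AB sum.cartesian_product by (simp only: case_prod_unfold prod.collapse)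
        then show ?thesis by simp
      qed
      also have "\<dots> = (\<Sum>j<nat \<lfloor>real n * ?m\<rfloor>. (\<Sum>z\<in>UNIV.
         noise_kernel T u c z (real j / real n) * noise_kernel T v c' z (real j / real n)) / real n)"
        unfolding sum_divide_distrib by (rule sum.swap)
      also have "\<dots> = (\<Sum>j<nat \<lfloor>real n * ?m\<rfloor>. F (real j / real n) (real (Suc j) / real n) / real n)"
        unfolding sum_noise_kernel_mult F_def d_def ..
      finally show ?thesis using True by simp
    next
      case False
      then have "?A \<inter> ?B = {}" by auto
      then show ?thesis using False by (simp only: sum.empty if_False)
    qed
    finally show ?thesis .
  qed
  define P where "P r = r / ?C + d * ((T - u) * (T - v) / (T - r))" for r
  have lim: "(\<lambda>n. \<Sum>j<nat \<lfloor>real n * ?m\<rfloor>. F (real j / real n) (real (Suc j) / real n) / real n) \<longlonglongrightarrow> P ?m - P 0"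
  proof (rule riemann_sum_tendsto)
    show "0 \<le> ?m" using u v by simp
    have "continuous_on ({0..?m} \<times> {0..?m}) (\<lambda>z. 1 / ?C + d * ((T - u) / (T - fst z) * ((T - v) / (T - fst z))))"
      using u v by (intro continuous_intros) auto
    then show "continuous_on ({0..?m} \<times> {0..?m}) (\<lambda>(x, y). F x y)" by (simp add: F_def case_prod_unfold)
    fix x assume "x \<in> {0..?m}"
    then have "T - x \<noteq> 0" using u v by auto
    then show "(P has_real_derivative F x x) (at x within {0..?m})"
      unfolding P_def F_def by (auto intro!: derivative_eq_intros)
  qed
  have "P ?m - P 0 = (if c = c' then min u v - u * v / T else 0) + u * v / (?C * T)"
  proof -
    \<comment> \<open>Sorting the two times lets the denominator at \<open>r = min u v\<close>
      cancel the factor of the earlier time, leaving \<open>T - max u v\<close>.\<close>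
    have uv: "u * v = min u v * max u v" "(T - u) * (T - v) = (T - min u v) * (T - max u v)" by (auto simp: min_def max_def)
    have "(T - u) * (T - v) / (T - ?m) = T - max u v" unfolding uv(2) using u v by simp
    then have "P ?m = ?m / ?C + d * (T - max u v)" unfolding P_def by (simp only:)
    moreover have "(T - u) * (T - v) / T = T - min u v - max u v + u * v / T"
      unfolding uv using T by (simp add: field_simps)
    then have "P 0 = d * (T - min u v - max u v + u * v / T)" unfolding P_def by simp
    ultimately have "P ?m - P 0 = ?m / ?C + d * (?m - u * v / T)"
      by (simp add: algebra_simps)
    then show ?thesis by (cases "c = c'") (simp_all add: d_def algebra_simps)
  qed
  then show ?thesis using lim unfolding S noise_cov_def by (cases "k = k'") auto
qed

text \<open>The limit at \<open>T\<close> is the same for every particle: the part of the noise that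
  distinguishes particles is cancelled by \<open>(T - t) * P c t\<close>, and the chords all end at
  the initial mean. The second claim exhibits the noise before \<open>T\<close> as a pathwise Wiener
  integral.\<close>

lemma interacting_path_limits:
  fixes x w :: "'c::finite \<Rightarrow> real \<Rightarrow> real"
  defines "avg \<equiv> \<lambda>z t. (\<Sum>c\<in>UNIV. z c t) / real CARD('c)"
  assumes T: "0 < T" and x: "\<And>c. continuous_on {0..<T} (x c)" and w: "\<And>c. continuous_on {0..} (w c)"
    and eq: "\<And>c t. t \<in> {0..<T} \<Longrightarrow> x c t = x c 0 + integral {0..t} (\<lambda>r. (avg x r - x c r) / (T - r)) + w c t"
  shows "(x c \<longlongrightarrow> avg x 0 + avg w T) (at_left T)"
    and "u \<in> {0..<T} \<Longrightarrow> (\<lambda>n. \<Sum>c'\<in>UNIV. \<Sum>j<nat \<lfloor>real n * u\<rfloor>. noise_kernel T u c c' (real j / real n) *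
        (w c' (real (Suc j) / real n) - w c' (real j / real n)))
      \<longlonglongrightarrow> x c u - ((T - u) / T * x c 0 + u / T * avg x 0)"
proof -
  have eq': "x c t = x c 0 + integral {0..t} (\<lambda>r. ((\<Sum>c\<in>UNIV. x c r) / real CARD('c) - x c r) / (T - r)) + w c t"
    if "t \<in> {0..<T}" for c t using eq[OF that] unfolding avg_def .
  obtain P where P0: "\<And>c. P c 0 = 0"
    and P': "\<And>c u t. u < T \<Longrightarrow> t \<in> {0..u} \<Longrightarrow> (P c has_real_derivative (w c t - avg w t) / (T - t)\<^sup>2) (at t within {0..u})"
    and Px: "\<And>c t. t \<in> {0..<T} \<Longrightarrow> x c t - ((T - t) / T * x c 0 + t / T * avg x 0) = w c t - (T - t) * P c t"
    unfolding avg_def by (rule interacting_path_solution[OF T x eq']) blast+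
  \<comment> \<open>At time 0 the integral in the equation is over a single point, which forces the
    noise to start at 0.\<close>
  have w0: "w c 0 = 0" for c using eq[of 0 c] T by simp
  have aw: "continuous_on {0..} (avg w)" unfolding avg_def using w by (intro continuous_intros) auto
  have b: "continuous_on {0..} (\<lambda>t. w c t - avg w t)" using w aw by (intro continuous_intros) auto
  have ev: "\<forall>\<^sub>F t in at_left T. t \<in> {0<..<T}"
    using T by (intro eventually_at_leftI[of 0]) auto
  have "continuous_on {0..T} (w c)" using w by (rule continuous_on_subset) auto
  then have wT: "(w c \<longlongrightarrow> w c T) (at_left T)"
    using T unfolding continuous_on_def at_within_Icc_at_left[OF T, symmetric] by auto
  have lP: "((\<lambda>t. (T - t) * P c t) \<longlongrightarrow> w c T - avg w T) (at_left T)"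
    by (rule singular_kernel_limit[OF T continuous_on_subset[OF b] P']) auto
  have "((\<lambda>t. ((T - t) / T * x c 0 + t / T * avg x 0) + (w c t - (T - t) * P c t)) \<longlongrightarrow> ((T - T) / T * x c 0 + T / T * avg x 0) + (w c T - (w c T - avg w T))) (at_left T)"
    using T by (intro tendsto_intros wT lP) auto
  then have "((\<lambda>t. ((T - t) / T * x c 0 + t / T * avg x 0) + (w c t - (T - t) * P c t)) \<longlongrightarrow> avg x 0 + avg w T) (at_left T)"
    using T by simp
  then show "(x c \<longlongrightarrow> avg x 0 + avg w T) (at_left T)"
  proof (rule Lim_transform_eventually)
    show "\<forall>\<^sub>F t in at_left T. ((T - t) / T * x c 0 + t / T * avg x 0) + (w c t - (T - t) * P c t) = x c t"
      using ev
    proof eventually_elim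
      case (elim t)
      then show ?case using Px[of t c] by simp
    qed
  qed
  show "(\<lambda>n. \<Sum>c'\<in>UNIV. \<Sum>j<nat \<lfloor>real n * u\<rfloor>. noise_kernel T u c c' (real j / real n) *
        (w c' (real (Suc j) / real n) - w c' (real j / real n)))
      \<longlonglongrightarrow> x c u - ((T - u) / T * x c 0 + u / T * avg x 0)" (is "?S \<longlonglongrightarrow> _")
    if u: "u \<in> {0..<T}"
  proof -
    let ?N = "\<lambda>n. nat \<lfloor>real n * u\<rfloor>"
    let ?b = "\<lambda>t. w c t - avg w t"
    have u': "0 \<le> u" "u < T" using u by auto
    have 1: "(\<lambda>n. \<Sum>j<?N n. (?b (real (Suc j) / real n) - ?b (real j / real n)) / (T - real j / real n))
      \<longlonglongrightarrow> ?b u / (T - u) - (P c u - P c 0)"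
      using u' w0 P'[OF u'(2)]
      by (intro stieltjes_sum_tendsto continuous_on_subset[OF b]) (auto simp: avg_def)
    have 2: "(\<lambda>n. avg w (real (?N n) / real n)) \<longlonglongrightarrow> avg w u"
      using u' by (intro continuous_on_tendsto_compose[OF aw tendsto_nat_floor_div] always_eventually) auto
    \<comment> \<open>The averaging part of the kernel has constant weight and telescopes; the
      remaining part is the Stieltjes sum for the deviation \<open>w c - avg w\<close>.\<close>
    have "?S n = avg w (real (?N n) / real n) + (T - u) *
       (\<Sum>j<?N n. (?b (real (Suc j) / real n) - ?b (real j / real n)) / (T - real j / real n))" for n
    proof -
      let ?t = "\<lambda>j. real j / real n"
      have a: "(\<Sum>c'\<in>UNIV. w c' (?t (Suc j)) - w c' (?t j)) / real CARD('c) = avg w (?t (Suc j)) - avg w (?t j)" for j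
        by (simp add: avg_def sum_subtractf diff_divide_distrib)
      have "?S n = (\<Sum>j<?N n. \<Sum>c'\<in>UNIV. noise_kernel T u c c' (?t j) * (w c' (?t (Suc j)) - w c' (?t j)))"
        by (rule sum.swap)
      also have "\<dots> = (\<Sum>j<?N n. (avg w (?t (Suc j)) - avg w (?t j)) + (T - u) * ((?b (?t (Suc j)) - ?b (?t j)) / (T - ?t j)))"
      proof (rule sum.cong[OF refl])
        fix j
        have "(w c (?t (Suc j)) - w c (?t j)) - (avg w (?t (Suc j)) - avg w (?t j)) = ?b (?t (Suc j)) - ?b (?t j)" by simp
        then show "(\<Sum>c'\<in>UNIV. noise_kernel T u c c' (?t j) * (w c' (?t (Suc j)) - w c' (?t j))) =
          (avg w (?t (Suc j)) - avg w (?t j)) + (T - u) * ((?b (?t (Suc j)) - ?b (?t j)) / (T - ?t j))"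
          unfolding sum_noise_kernel a by (simp only: times_divide_eq_left times_divide_eq_right)
      qed
      also have "\<dots> = (\<Sum>j<?N n. avg w (?t (Suc j)) - avg w (?t j)) + (T - u) * (\<Sum>j<?N n. (?b (?t (Suc j)) - ?b (?t j)) / (T - ?t j))"
        by (simp only: sum.distrib sum_distrib_left)
      also have "(\<Sum>j<?N n. avg w (?t (Suc j)) - avg w (?t j)) = avg w (?t (?N n))"
        using sum_lessThan_telescope[of "\<lambda>j. avg w (?t j)" "?N n"] w0 by (simp add: avg_def)
      finally show ?thesis .
    qed
    moreover have "(\<lambda>n. avg w (real (?N n) / real n) + (T - u) *
       (\<Sum>j<?N n. (?b (real (Suc j) / real n) - ?b (real j / real n)) / (T - real j / real n)))
       \<longlonglongrightarrow> avg w u + (T - u) * (?b u / (T - u) - (P c u - P c 0))"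
      by (intro tendsto_intros 1 2)
    moreover have "avg w u + (T - u) * (?b u / (T - u) - (P c u - P c 0)) = w c u - (T - u) * P c u"
    proof -
      have "(T - u) * (?b u / (T - u)) = ?b u" using u' by simp
      then show ?thesis using P0[of c] by (simp only: right_diff_distrib[of _ "?b u / (T - u)"] diff_zero)
    qed
    ultimately show ?thesis unfolding Px[OF u] by simp
  qed
qed

section \<open>The Gaussian field of the interacting system\<close>

locale interacting_system =
  fixes M :: "'a measure" and T :: real and W X :: "'c::finite \<Rightarrow> real \<Rightarrow> 'a \<Rightarrow> real^'d::finite"
  assumes prob: "prob_space M"
    and T_pos: "0 < T"
    and bm: "\<And>c. brownian_motion M (W c)"
    and meas: "\<And>c t. t \<in> {0..T} \<Longrightarrow> X c t \<in> borel_measurable M"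
    and indep: "prob_space.indep_sets M
        (case_sum
          (\<lambda>c. sets (vimage_algebra (space M) (\<lambda>\<omega>. \<lambda>t\<in>{0..}. W c t \<omega>) (\<Pi>\<^sub>M t\<in>{0..}. borel)))
          (\<lambda>c. sets (vimage_algebra (space M) (X c 0) borel)))
        (UNIV :: ('c + 'c) set)"
    and sde: "sde_solution M T W X"
    and terminal: "\<And>c. AE \<omega> in M. X c T \<omega> = Lim (at_left T) (\<lambda>t. X c t \<omega>)"
begin

text \<open>The \<open>G\<close> of the overview, defined as a difference of positions and not as an
  integral: it is then measurable at once, and its representation as a limit of sums over increments
  has to hold only almost surely.\<close>

definition noise :: "'c \<times> 'd \<times> real \<Rightarrow> 'a \<Rightarrow> real" where
  "noise = (\<lambda>(c, k, u) \<omega>. X c u \<omega> $ k - ((T - u) / T * X c 0 \<omega> $ k + u / T * average (joint X 0 \<omega>) $ k))"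

lemma average_nth: "average (joint X t \<omega>) $ k = (\<Sum>c\<in>UNIV. X c t \<omega> $ k) / real CARD('c)"
  by (simp add: average_def joint_def)

text \<open>A single null set serves all particles, coordinates and times: outside it the argument
  is deterministic. It also upgrades continuity on \<open>[0, T)\<close> to the closed
  interval.\<close>

lemma AE_paths:
  "AE \<omega> in M. (\<forall>c. continuous_on {0..T} (\<lambda>t. X c t \<omega>)) \<and>
     (\<forall>c k. \<forall>u\<in>{0..<T}. (\<lambda>n. \<Sum>c'\<in>UNIV. \<Sum>j<nat \<lfloor>real n * u\<rfloor>. noise_kernel T u c c' (real j / real n) *
        (W c' (real (Suc j) / real n) \<omega> $ k - W c' (real j / real n) \<omega> $ k)) \<longlonglongrightarrow> noise (c, k, u) \<omega>)"
proof -
  have "AE \<omega> in M. \<forall>c. continuous_on {0..} (\<lambda>t. W c t \<omega>)"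
    using bm unfolding brownian_motion_def by (subst AE_all_countable) blast
  moreover have "AE \<omega> in M. \<forall>c. X c T \<omega> = Lim (at_left T) (\<lambda>t. X c t \<omega>)"
    using terminal by (subst AE_all_countable) blast
  moreover have "AE \<omega> in M. \<forall>c. continuous_on {0..<T} (\<lambda>t. X c t \<omega>) \<and>
        (\<forall>t\<in>{0..<T}.
           set_integrable lborel {0..t} (\<lambda>r. drift T X c r \<omega>) \<and>
           X c t \<omega> = X c 0 \<omega> + (LINT r:{0..t}|lborel. drift T X c r \<omega>) + W c t \<omega>)"
    using sde unfolding sde_solution_def by (subst AE_all_countable) blast
  ultimately show ?thesis
  proof eventually_elim
    case (elim \<omega>)
    then have Wc: "continuous_on {0..} (\<lambda>t. W c t \<omega>)" and XT: "X c T \<omega> = Lim (at_left T) (\<lambda>t. X c t \<omega>)"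
      and Xc: "continuous_on {0..<T} (\<lambda>t. X c t \<omega>)"
      and di: "t \<in> {0..<T} \<Longrightarrow> set_integrable lborel {0..t} (\<lambda>r. drift T X c r \<omega>)"
      and Xt: "t \<in> {0..<T} \<Longrightarrow> X c t \<omega> = X c 0 \<omega> + (LINT r:{0..t}|lborel. drift T X c r \<omega>) + W c t \<omega>"
      for c t by blast+
    have xc: "continuous_on {0..<T} (\<lambda>t. X c t \<omega> $ k)" for c k using Xc by (intro continuous_intros)
    have wc: "continuous_on {0..} (\<lambda>t. W c t \<omega> $ k)" for c k using Wc by (intro continuous_intros)
    have eq: "X c t \<omega> $ k = X c 0 \<omega> $ k + integral {0..t} (\<lambda>r. ((\<Sum>c\<in>UNIV. X c r \<omega> $ k) / real CARD('c) - X c r \<omega> $ k) / (T - r)) + W c t \<omega> $ k"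
      if t: "t \<in> {0..<T}" for c k t
    proof -
      have "X c t \<omega> $ k = X c 0 \<omega> $ k + integral {0..t} (\<lambda>r. drift T X c r \<omega>) $ k + W c t \<omega> $ k"
        using Xt[OF t, of c] unfolding set_borel_integral_eq_integral(2)[OF di[OF t]] by (metis vector_add_component)
      also have "integral {0..t} (\<lambda>r. drift T X c r \<omega>) $ k = integral {0..t} (\<lambda>r. drift T X c r \<omega> $ k)"
        by (rule integral_component_eq_cart[symmetric, OF set_borel_integral_eq_integral(1)[OF di[OF t]]])
      also have "(\<lambda>r. drift T X c r \<omega> $ k) = (\<lambda>r. ((\<Sum>c\<in>UNIV. X c r \<omega> $ k) / real CARD('c) - X c r \<omega> $ k) / (T - r))"
        by (simp add: drift_def average_nth)
      finally show ?thesis .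
    qed
    note lims = interacting_path_limits[where x = "\<lambda>c t. X c t \<omega> $ k" and w = "\<lambda>c t. W c t \<omega> $ k" for k, OF T_pos xc wc eq]
    have lim: "((\<lambda>t. X c t \<omega>) \<longlongrightarrow> X c T \<omega>) (at_left T)" for c
    proof -
      \<comment> \<open>\<open>Lim\<close> is a description, so \<open>terminal\<close> is
        informative only once convergence is known; \<open>L\<close> is the limit found pathwise,
        coordinate by coordinate.\<close>
      define L where "L = (\<chi> k. (\<Sum>c\<in>UNIV. X c 0 \<omega> $ k) / real CARD('c) + (\<Sum>c\<in>UNIV. W c T \<omega> $ k) / real CARD('c))"
      have "((\<lambda>t. X c t \<omega>) \<longlongrightarrow> L) (at_left T)"
        by (rule vec_tendstoI, simp add: L_def, rule lims(1))
      then show ?thesis using tendsto_Lim[of "at_left T" "\<lambda>t. X c t \<omega>" L] XT[of c] by simp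
    qed
    have "continuous_on {0..T} (\<lambda>t. X c t \<omega>)" for c
    proof (rule continuous_on_IccI[OF _ lim _ T_pos])
      have "continuous_on {0..T/2} (\<lambda>t. X c t \<omega>)" using T_pos by (intro continuous_on_subset[OF Xc]) auto
      then show "((\<lambda>t. X c t \<omega>) \<longlongrightarrow> X c 0 \<omega>) (at_right 0)"
        unfolding continuous_on_def using T_pos at_within_Icc_at_right[of 0 "T / 2"]
        by (elim ballE[of _ _ 0]) auto
      fix x assume "0 < x" "x < T"
      then have "x \<in> interior {0..<T}" by (auto simp: interior_atLeastLessThan)
      then show "(\<lambda>t. X c t \<omega>) \<midarrow>x\<rightarrow> X c x \<omega>"
        using continuous_on_interior[OF Xc] by (simp add: isCont_def)
    qed
    then show ?case using lims(2) by (simp add: noise_def average_nth)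
  qed
qed

lemma noise_measurable: "i \<in> UNIV \<times> UNIV \<times> {0..T} \<Longrightarrow> noise i \<in> borel_measurable M"
proof -
  assume "i \<in> UNIV \<times> UNIV \<times> {0..T}"
  then obtain c k u where i: "i = (c, k, u)" and [measurable]: "X c u \<in> borel_measurable M"
    using meas by (cases i) auto
  have [measurable]: "X c 0 \<in> borel_measurable M" for c using meas[of 0 c] T_pos by simp
  show ?thesis
    unfolding i noise_def average_nth prod.case
    by (intro borel_measurable_diff borel_measurable_add borel_measurable_times borel_measurable_const
       borel_measurable_divide borel_measurable_sum measurable_compose[OF _ borel_measurable_nth]) measurable
qed

abbreviation "initial_functionals \<equiv> linear_functionals (\<lambda>c. X c 0)"

lemma noise_gaussian_field_open:
  "gaussian_field M initial_functionals (UNIV \<times> UNIV \<times> {0..<T}) (noise_cov T) noise"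
proof -
  let ?F = "\<lambda>n (i :: 'c \<times> 'd \<times> real). (UNIV :: 'c set) \<times> {fst (snd i)} \<times> {..<nat \<lfloor>real n * snd (snd i)\<rfloor>}"
  let ?w = "\<lambda>n (i :: 'c \<times> 'd \<times> real) (p :: 'c \<times> 'd \<times> nat). noise_kernel T (snd (snd i)) (fst i) (fst p) (real (snd (snd p)) / real n)"
  let ?I = "\<lambda>n (c, k, j) \<omega>. W c (real (Suc j) / real n) \<omega> $ k - W c (real j / real n) \<omega> $ k"
  have X0: "X c 0 \<in> borel_measurable M" for c using meas[of 0 c] T_pos by simp
  \<comment> \<open>Meshes \<open>1 / Suc n\<close> avoid the degenerate grid \<open>n = 0\<close>;
    the limits, available in terms of \<open>n\<close>, are shifted by
    \<open>LIMSEQ_Suc\<close>.\<close>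
  have inc: "gaussian_field M initial_functionals UNIV (\<lambda>p q. if p = q then 1 / real (Suc n) else 0) (?I (Suc n))" for n
    by (rule brownian_increments_gaussian_field[OF prob bm X0 indep]) simp
  have fin: "finite (?F (Suc n) j)" for n j by simp
  show ?thesis
  proof (rule gaussian_field_limit[OF prob gaussian_field_linear[OF inc fin subset_UNIV]])
    show "noise i \<in> borel_measurable M" if "i \<in> UNIV \<times> UNIV \<times> {0..<T}" for i
      using that by (intro noise_measurable) auto
    fix i :: "'c \<times> 'd \<times> real" assume i: "i \<in> UNIV \<times> UNIV \<times> {0..<T}"
    obtain c k u where cku: "i = (c, k, u)" "u \<in> {0..<T}" using i by (cases i) auto
    have sumF: "(\<Sum>p\<in>?F n i. ?w n i p * ?I n p \<omega>) = (\<Sum>c'\<in>UNIV. \<Sum>j<nat \<lfloor>real n * u\<rfloor>. noise_kernel T u c c' (real j / real n) *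
        (W c' (real (Suc j) / real n) \<omega> $ k - W c' (real j / real n) \<omega> $ k))" for n \<omega>
    proof -
      let ?g = "\<lambda>p. ?w n i p * ?I n p \<omega>"
      have "(\<Sum>c'\<in>UNIV. \<Sum>k'\<in>{k}. \<Sum>j<nat \<lfloor>real n * u\<rfloor>. ?g (c', k', j)) = (\<Sum>p\<in>?F n i. ?g p)"
        unfolding sum.cartesian_product cku by (simp only: case_prod_unfold prod.collapse fst_conv snd_conv)
      then show ?thesis by (simp add: cku)
    qed
    show "AE \<omega> in M. (\<lambda>n. \<Sum>p\<in>?F (Suc n) i. ?w (Suc n) i p * ?I (Suc n) p \<omega>) \<longlonglongrightarrow> noise i \<omega>"
      using AE_paths
    proof eventually_elim
      case (elim \<omega>)
      then have "(\<lambda>n. \<Sum>p\<in>?F n i. ?w n i p * ?I n p \<omega>) \<longlonglongrightarrow> noise i \<omega>"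
        unfolding sumF unfolding cku(1) using cku(2) by blast
      then show ?case by (rule LIMSEQ_Suc)
    qed
    fix i' :: "'c \<times> 'd \<times> real" assume i': "i' \<in> UNIV \<times> UNIV \<times> {0..<T}"
    obtain c' k' v where cku': "i' = (c', k', v)" "v \<in> {0..<T}" using i' by (cases i') auto
    have "(\<lambda>n. \<Sum>p\<in>?F n i. \<Sum>q\<in>?F n i'. ?w n i p * ?w n i' q * (if p = q then 1 / real n else 0)) \<longlonglongrightarrow> noise_cov T i i'"
      unfolding cku(1) cku'(1) fst_conv snd_conv
      by (rule noise_kernel_covariance_tendsto) (use T_pos cku cku' in auto)
    then show "(\<lambda>n. \<Sum>p\<in>?F (Suc n) i. \<Sum>q\<in>?F (Suc n) i'. ?w (Suc n) i p * ?w (Suc n) i' q * (if p = q then 1 / real (Suc n) else 0)) \<longlonglongrightarrow> noise_cov T i i'"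
      by (rule LIMSEQ_Suc)
  qed
qed

text \<open>The Stieltjes sums converge only for times before the singularity. Shrinking all times
  at once by \<open>n / Suc n\<close> moves them into \<open>[0, T)\<close>, and continuity of the
  paths and of the covariance recovers time \<open>T\<close>.\<close>

lemma noise_gaussian_field:
  "gaussian_field M initial_functionals (UNIV \<times> UNIV \<times> {0..T}) (noise_cov T) noise"
proof -
  define \<rho> where "\<rho> n u = u * (real n / real (Suc n))" for n u
  let ?\<rho> = "\<lambda>n (i :: 'c \<times> 'd \<times> real). (fst i, fst (snd i), \<rho> n (snd (snd i)))"
  have \<rho>: "\<rho> n u \<in> {0..<T}" if "u \<in> {0..T}" for n u
  proof -
    have "u * (real n / real (Suc n)) \<le> T * (real n / real (Suc n))" using that by (intro mult_right_mono) auto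
    also have "\<dots> < T * 1" using T_pos by (intro mult_strict_left_mono) auto
    finally show ?thesis using that by (auto simp: \<rho>_def)
  qed
  have \<rho>lim: "(\<lambda>n. \<rho> n u) \<longlonglongrightarrow> u" for u
    using tendsto_mult[OF tendsto_const LIMSEQ_n_over_Suc_n, of u] by (simp add: \<rho>_def)
  have f: "gaussian_field M initial_functionals (UNIV \<times> UNIV \<times> {0..T})
     (\<lambda>i i'. \<Sum>p\<in>{?\<rho> n i}. \<Sum>q\<in>{?\<rho> n i'}. 1 * 1 * noise_cov T p q) (\<lambda>i \<omega>. \<Sum>p\<in>{?\<rho> n i}. 1 * noise p \<omega>)" for n
    by (rule gaussian_field_linear[OF noise_gaussian_field_open]) (use \<rho> in auto)
  show ?thesis
  proof (rule gaussian_field_limit[OF prob f noise_measurable])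
    fix i :: "'c \<times> 'd \<times> real" assume i: "i \<in> UNIV \<times> UNIV \<times> {0..T}"
    obtain c k u where cku: "i = (c, k, u)" "u \<in> {0..T}" using i by (cases i) auto
    show "AE \<omega> in M. (\<lambda>n. \<Sum>p\<in>{?\<rho> n i}. 1 * noise p \<omega>) \<longlonglongrightarrow> noise i \<omega>"
      using AE_paths
    proof eventually_elim
      case (elim \<omega>)
      then have c: "continuous_on {0..T} (\<lambda>t. X c t \<omega>)" by blast
      have "(\<lambda>n. X c (\<rho> n u) \<omega>) \<longlonglongrightarrow> X c u \<omega>"
        using \<rho>[OF cku(2)] by (intro continuous_on_tendsto_compose[OF c \<rho>lim cku(2)] always_eventually) (auto intro: less_imp_le)
      then show ?case
        unfolding cku noise_def using T_pos by (auto intro!: tendsto_intros \<rho>lim)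
    qed
    fix i' :: "'c \<times> 'd \<times> real" assume i': "i' \<in> UNIV \<times> UNIV \<times> {0..T}"
    obtain c' k' v where cku': "i' = (c', k', v)" by (cases i')
    show "(\<lambda>n. \<Sum>p\<in>{?\<rho> n i}. \<Sum>q\<in>{?\<rho> n i'}. 1 * 1 * noise_cov T p q) \<longlonglongrightarrow> noise_cov T i i'"
      unfolding cku cku' noise_cov_def using T_pos by (auto intro!: tendsto_eq_intros \<rho>lim)
  qed
qed

end

section \<open>Transition law\<close>

lemma borel_measurable_vec:
  fixes f :: "'a \<Rightarrow> 'b::euclidean_space^'n"
  assumes "\<And>i. (\<lambda>x. f x $ i) \<in> borel_measurable M"
  shows "f \<in> borel_measurable M"
proof (rule borel_measurable_euclidean_space[THEN iffD2], rule ballI)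
  fix b :: "'b^'n" assume "b \<in> Basis"
  then obtain i u where b: "b = axis i u" by (auto simp: Basis_vec_def)
  have "(\<lambda>x. f x $ i \<bullet> u) \<in> borel_measurable M"
    by (intro borel_measurable_inner assms borel_measurable_const)
  then show "(\<lambda>x. f x \<bullet> b) \<in> borel_measurable M" by (simp add: b inner_axis)
qed

lemma indep_distr_comp:
  assumes M: "prob_space M" and Y[measurable]: "Y \<in> M \<rightarrow>\<^sub>M N" and Z[measurable]: "Z \<in> M \<rightarrow>\<^sub>M Q"
    and ind: "distr M (N \<Otimes>\<^sub>M Q) (\<lambda>\<omega>. (Y \<omega>, Z \<omega>)) = distr M N Y \<Otimes>\<^sub>M distr M Q Z"
    and f[measurable]: "f \<in> N \<rightarrow>\<^sub>M N'" and g[measurable]: "g \<in> Q \<rightarrow>\<^sub>M Q'"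
  shows "distr M (N' \<Otimes>\<^sub>M Q') (\<lambda>\<omega>. (f (Y \<omega>), g (Z \<omega>))) = distr M N' (\<lambda>\<omega>. f (Y \<omega>)) \<Otimes>\<^sub>M distr M Q' (\<lambda>\<omega>. g (Z \<omega>))"
proof -
  interpret prob_space M by fact
  have "distr M (N' \<Otimes>\<^sub>M Q') (\<lambda>\<omega>. (f (Y \<omega>), g (Z \<omega>))) =
     distr (distr M (N \<Otimes>\<^sub>M Q) (\<lambda>\<omega>. (Y \<omega>, Z \<omega>))) (N' \<Otimes>\<^sub>M Q') (\<lambda>(x, y). (f x, g y))"
    by (subst distr_distr) (auto simp: comp_def)
  also have "\<dots> = distr (distr M N Y) N' f \<Otimes>\<^sub>M distr (distr M Q Z) Q' g"
    unfolding ind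
    by (rule pair_measure_distr[symmetric])
      (auto intro!: prob_space_imp_sigma_finite prob_space.prob_space_distr prob_space_distr)
  finally show ?thesis by (simp add: distr_distr comp_def)
qed

context interacting_system
begin

abbreviation state :: "'c \<times> 'd \<times> real \<Rightarrow> 'a \<Rightarrow> real" where
  "state p \<omega> \<equiv> X (fst p) (snd (snd p)) \<omega> $ fst (snd p)"

abbreviation functionals :: "('c \<times> 'd \<times> real) set \<Rightarrow> ('a \<Rightarrow> real) set" where
  "functionals E \<equiv> {\<lambda>\<omega>. \<xi> \<omega> + (\<Sum>i\<in>I. a i * noise i \<omega>) |\<xi> I a. \<xi> \<in> initial_functionals \<and> finite I \<and> I \<subseteq> E}"

lemma zero_functional: "(\<lambda>_. 0) \<in> functionals E"
  using linear_functionals_0 by (auto intro!: exI[of _ "\<lambda>_. 0"] exI[of _ "{}"])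

lemma state_functional:
  fixes s :: "'c \<times> 'd \<times> real \<Rightarrow> real"
  assumes F: "finite F" "F \<subseteq> E"
  shows "(\<lambda>\<omega>. \<Sum>p\<in>F. s p * state p \<omega>) \<in> functionals E"
proof -
  \<comment> \<open>The chord coefficients: a state at time \<open>u\<close> carries
    \<open>(T - u) / T\<close> times its own initial value and \<open>u / T\<close>, spread evenly
    as \<open>u / T / C\<close>, on every particle.\<close>
  define \<tau> where "\<tau> c = (\<Sum>p\<in>F. (s p * ((T - snd (snd p)) / T * (if c = fst p then 1 else 0) + snd (snd p) / T / real CARD('c))) *\<^sub>R axis (fst (snd p)) (1::real))" for c :: 'c
  have "(\<Sum>c\<in>UNIV. \<tau> c \<bullet> X c 0 \<omega>) + (\<Sum>p\<in>F. s p * noise p \<omega>) = (\<Sum>p\<in>F. s p * state p \<omega>)" for \<omega>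
  proof -
    have "(\<Sum>c\<in>UNIV. \<tau> c \<bullet> X c 0 \<omega>) = (\<Sum>p\<in>F. \<Sum>c\<in>UNIV. s p * ((T - snd (snd p)) / T * (if c = fst p then 1 else 0) + snd (snd p) / T / real CARD('c)) * X c 0 \<omega> $ fst (snd p))"
      unfolding \<tau>_def inner_sum_left inner_scaleR_left by (subst sum.swap) (simp add: inner_axis' mult_ac)
    also have "\<dots> = (\<Sum>p\<in>F. s p * ((T - snd (snd p)) / T * X (fst p) 0 \<omega> $ fst (snd p) + snd (snd p) / T * average (joint X 0 \<omega>) $ fst (snd p)))"
    proof (rule sum.cong[OF refl])
      fix p
      have e: "s p * ((T - snd (snd p)) / T * (if c = fst p then 1 else 0) + snd (snd p) / T / real CARD('c)) * X c 0 \<omega> $ fst (snd p) =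
        s p * ((T - snd (snd p)) / T) * (if c = fst p then X c 0 \<omega> $ fst (snd p) else 0) + s p * (snd (snd p) / T) * (X c 0 \<omega> $ fst (snd p) / real CARD('c))" for c
        by (simp add: algebra_simps)
      show "(\<Sum>c\<in>UNIV. s p * ((T - snd (snd p)) / T * (if c = fst p then 1 else 0) + snd (snd p) / T / real CARD('c)) * X c 0 \<omega> $ fst (snd p)) =
        s p * ((T - snd (snd p)) / T * X (fst p) 0 \<omega> $ fst (snd p) + snd (snd p) / T * average (joint X 0 \<omega>) $ fst (snd p))"
        unfolding average_nth sum_divide_distrib e sum.distrib sum_distrib_left[symmetric]
        by (simp only: sum.delta[OF finite] UNIV_I if_True distrib_left mult.assoc)
    qed
    also have "\<dots> + (\<Sum>p\<in>F. s p * noise p \<omega>) = (\<Sum>p\<in>F. s p * state p \<omega>)"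
      unfolding sum.distrib[symmetric] distrib_left[symmetric] by (simp add: noise_def case_prod_unfold)
    finally show ?thesis .
  qed
  then have "(\<lambda>\<omega>. \<Sum>p\<in>F. s p * state p \<omega>) = (\<lambda>\<omega>. (\<lambda>\<omega>. \<Sum>c\<in>UNIV. \<tau> c \<bullet> X c 0 \<omega>) \<omega> + (\<Sum>p\<in>F. s p * noise p \<omega>))" by simp
  moreover have "(\<lambda>\<omega>. \<Sum>c\<in>UNIV. \<tau> c \<bullet> X c 0 \<omega>) \<in> initial_functionals" by (auto simp: linear_functionals_def)
  ultimately show ?thesis
    using F by (intro CollectI exI[of _ "\<lambda>\<omega>. \<Sum>c\<in>UNIV. \<tau> c \<bullet> X c 0 \<omega>"] exI[of _ F] exI[of _ s] conjI) simp_all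
qed

lemma state_measurable:
  assumes "p \<in> UNIV \<times> UNIV \<times> {0..T}" shows "state p \<in> borel_measurable M"
  using assms by (intro measurable_compose[OF meas borel_measurable_nth]) auto

text \<open>Independence is proved for families of real coordinates; \<open>f\<close> and
  \<open>g\<close> repackage them as the vectors, pairs or paths on which the conditional laws
  live.\<close>

lemma residual_indep:
  assumes R: "gaussian_field M (functionals E) D \<Gamma> R" and E: "E \<subseteq> UNIV \<times> UNIV \<times> {0..T}"
    and f: "f \<in> (\<Pi>\<^sub>M p\<in>E. borel) \<rightarrow>\<^sub>M N" and g: "g \<in> (\<Pi>\<^sub>M j\<in>D. borel) \<rightarrow>\<^sub>M Q"
  shows "distr M (N \<Otimes>\<^sub>M Q) (\<lambda>\<omega>. (f (\<lambda>p\<in>E. state p \<omega>), g (\<lambda>j\<in>D. R j \<omega>))) =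
    distr M N (\<lambda>\<omega>. f (\<lambda>p\<in>E. state p \<omega>)) \<Otimes>\<^sub>M distr M Q (\<lambda>\<omega>. g (\<lambda>j\<in>D. R j \<omega>))"
proof (rule indep_distr_comp[OF prob _ _ _ f g])
  show "(\<lambda>\<omega>. \<lambda>p\<in>E. state p \<omega>) \<in> M \<rightarrow>\<^sub>M (\<Pi>\<^sub>M p\<in>E. borel)"
    by (intro measurable_restrict state_measurable) (use E in auto)
  show "(\<lambda>\<omega>. \<lambda>j\<in>D. R j \<omega>) \<in> M \<rightarrow>\<^sub>M (\<Pi>\<^sub>M j\<in>D. borel)"
    by (intro measurable_restrict gaussian_fieldD(2)[OF R])
  show "distr M ((\<Pi>\<^sub>M p\<in>E. borel) \<Otimes>\<^sub>M (\<Pi>\<^sub>M j\<in>D. borel)) (\<lambda>\<omega>. (\<lambda>p\<in>E. state p \<omega>, \<lambda>j\<in>D. R j \<omega>)) =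
    distr M (\<Pi>\<^sub>M p\<in>E. borel) (\<lambda>\<omega>. \<lambda>p\<in>E. state p \<omega>) \<Otimes>\<^sub>M distr M (\<Pi>\<^sub>M j\<in>D. borel) (\<lambda>\<omega>. \<lambda>j\<in>D. R j \<omega>)"
    by (rule gaussian_field_indep[OF prob R zero_functional state_functional])
qed

section \<open>Regression of the joint state on an earlier joint state\<close>

definition transition_residual :: "real \<Rightarrow> real \<Rightarrow> 'c \<times> 'd \<Rightarrow> 'a \<Rightarrow> real" where
  "transition_residual s t p \<omega> = stack (joint X t \<omega>) $ p - stack (cond_mean T s t (joint X s \<omega>)) $ p"

text \<open>The residual takes \<open>\<alpha>\<close> times the particle's own state and
  \<open>\<beta>\<close> times the average at time \<open>s\<close>. Deviations from the average are
  thus predicted with factor \<open>\<alpha>\<close>, as for bridges ending at \<open>T\<close>, and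
  the average itself with \<open>\<alpha> + \<beta> = 1\<close>, as for Brownian motion. The same
  weights annihilate the chords.\<close>

lemma transition_residual_field:
  assumes st: "0 \<le> s" "s < t" "t \<le> T"
  shows "gaussian_field M (functionals (UNIV \<times> UNIV \<times> {s})) UNIV
     (\<lambda>p q. kronecker (cond_Sigma T s t) (mat 1) $ p $ q) (transition_residual s t)"
proof -
  let ?C = "real CARD('c)"
  define \<alpha> where "\<alpha> = (T - t) / (T - s)"
  define \<beta> where "\<beta> = (t - s) / (T - s)"
  define F where "F q = insert (fst q, snd q, t) (UNIV \<times> {snd q} \<times> {s})" for q :: "'c \<times> 'd"
  define w where "w q p = (if snd (snd p) = t then 1 else - \<alpha> * (if fst p = fst q then 1 else 0) - \<beta> / ?C)"
    for q :: "'c \<times> 'd" and p :: "'c \<times> 'd \<times> real"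
  have sumw: "(\<Sum>p\<in>F (c, k). w (c, k) p * f p) = f (c, k, t) - \<alpha> * f (c, k, s) - \<beta> / ?C * (\<Sum>c'\<in>UNIV. f (c', k, s))" for c k f
  proof -
    have "(\<Sum>p\<in>F (c, k). w (c, k) p * f p) = f (c, k, t) + (\<Sum>p\<in>UNIV \<times> {k} \<times> {s}. w (c, k) p * f p)"
      unfolding F_def using st by (subst sum.insert) (auto simp: w_def)
    also have "(\<Sum>p\<in>UNIV \<times> {k} \<times> {s}. w (c, k) p * f p) = (\<Sum>c'\<in>UNIV. w (c, k) (c', k, s) * f (c', k, s))"
    proof -
      have "(\<Sum>c'\<in>UNIV. \<Sum>i\<in>{k}. \<Sum>r\<in>{s}. w (c, k) (c', i, r) * f (c', i, r)) = (\<Sum>p\<in>UNIV \<times> {k} \<times> {s}. w (c, k) p * f p)"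
        unfolding sum.cartesian_product by (simp only: case_prod_unfold prod.collapse)
      then show ?thesis by simp
    qed
    also have "\<dots> = (\<Sum>c'\<in>UNIV. - \<alpha> * (if c' = c then f (c', k, s) else 0) - \<beta> / ?C * f (c', k, s))"
      using st by (intro sum.cong) (auto simp: w_def algebra_simps)
    also have "\<dots> = - \<alpha> * f (c, k, s) - \<beta> / ?C * (\<Sum>c'\<in>UNIV. f (c', k, s))"
      by (simp only: sum_subtractf sum_distrib_left[symmetric]) simp
    finally show ?thesis by simp
  qed
  have Ts: "T - s \<noteq> 0" "T \<noteq> 0" using st T_pos by auto
  \<comment> \<open>These relate the chord coefficients at \<open>t\<close> to those at
    \<open>s\<close>; they are used both for orthogonality and for cancelling the initial
    values.\<close>
  have ab: "\<alpha> * s / T + \<beta> = t / T" "\<alpha> * (T - s) = T - t"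
    using Ts by (simp_all add: \<alpha>_def \<beta>_def divide_simps) (simp_all add: algebra_simps)
  have sym: "noise_cov T p q = noise_cov T q p" for p q :: "'c \<times> 'd \<times> real"
    by (auto simp: noise_cov_def case_prod_unfold mult.commute min.commute)
  \<comment> \<open>Summed over particles, \<open>- u * v / T\<close> is cancelled by the
    \<open>C\<close> copies of \<open>u * v / (C * T)\<close>, and a Brownian covariance
    remains.\<close>
  have sumcov: "(\<Sum>c'\<in>UNIV. noise_cov T (c', k, u) (c'', k', v)) = (if k = k' then min u v else 0)"
     for k k' :: 'd and u v and c'' :: 'c
  proof (cases "k = k'")
    case True
    then have "(\<Sum>c'\<in>UNIV. noise_cov T (c', k, u) (c'', k', v)) =
       (\<Sum>c'\<in>UNIV. (if c' = c'' then min u v - u * v / T else 0) + u * v / (?C * T))"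
      by (simp add: noise_cov_def)
    then show ?thesis using True by (simp only: sum.distrib) simp
  qed (simp add: noise_cov_def)
  have orth: "(\<Sum>p\<in>F q. w q p * noise_cov T p i) = 0" if i: "i \<in> UNIV \<times> UNIV \<times> {s}" for q i
  proof -
    obtain c k where q: "q = (c, k)" by (cases q)
    obtain c' k' where i': "i = (c', k', s)" using i by auto
    have e: "(s - t * s / T) = \<alpha> * (s - s * s / T)"
    proof -
      have "s - t * s / T = s / T * (T - t)" using Ts by (simp add: field_simps)
      also have "\<dots> = \<alpha> * (s - s * s / T)" unfolding ab(2)[symmetric] using Ts by (simp add: field_simps)
      finally show ?thesis .
    qed
    have e2: "t * s / (?C * T) = \<alpha> * (s * s / (?C * T)) + \<beta> / ?C * s"
    proof -
      have "t * s / (?C * T) = (t / T) * (s / ?C)" by simp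
      also have "\<dots> = \<alpha> * (s * s / (?C * T)) + \<beta> / ?C * s" unfolding ab(1)[symmetric] by (simp add: algebra_simps)
      finally show ?thesis .
    qed
    show ?thesis
      unfolding q sumw i' sumcov using st e e2 by (auto simp: noise_cov_def algebra_simps)
  qed
  have cov: "(\<Sum>p\<in>F q. \<Sum>p'\<in>F q'. w q p * w q' p' * noise_cov T p p') = kronecker (cond_Sigma T s t) (mat 1) $ q $ q'" for q q'
  proof -
    obtain c k where q: "q = (c, k)" by (cases q)
    obtain c' k' where q': "q' = (c', k')" by (cases q')
    \<comment> \<open>By orthogonality the terms at time \<open>s\<close> of one residual contribute
      nothing, so its noise at \<open>t\<close> alone is paired with the other residual.\<close>
    have "(\<Sum>p\<in>F q. \<Sum>p'\<in>F q'. w q p * w q' p' * noise_cov T p p') = (\<Sum>p'\<in>F q'. w q' p' * (\<Sum>p\<in>F q. w q p * noise_cov T p p'))"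
      by (subst sum.swap) (simp add: sum_distrib_left mult_ac)
    also have "\<dots> = (\<Sum>p\<in>F q. w q p * noise_cov T p (c', k', t))"
      unfolding q' sumw using orth[of "(_, _, s)" q] by simp
    also have "\<dots> = kronecker (cond_Sigma T s t) (mat 1) $ q $ q'"
    proof (cases "k = k'")
      case True
      have "t - t * t / T - \<alpha> * (s - s * t / T) = (t - s) * (T - t) / (T - s)"
        unfolding \<alpha>_def using Ts by (simp add: divide_simps) (simp add: algebra_simps)
      moreover have "t * t / (?C * T) - \<alpha> * (s * t / (?C * T)) - \<beta> / ?C * s = (t - s)\<^sup>2 / (?C * (T - s))"
        unfolding \<alpha>_def \<beta>_def using Ts by (simp add: divide_simps) (simp add: algebra_simps power2_eq_square)
      ultimately show ?thesis
        unfolding q q' sumw sumcov using st True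
        by (simp add: noise_cov_def kronecker_def cond_Sigma_def mat_def) (auto simp: algebra_simps)
    next
      case False
      then show ?thesis unfolding q q' sumw sumcov by (simp add: noise_cov_def kronecker_def mat_def)
    qed
    finally show ?thesis .
  qed
  have res: "(\<Sum>p\<in>F q. w q p * noise p \<omega>) = transition_residual s t q \<omega>" for q \<omega>
  proof -
    obtain c k where q: "q = (c, k)" by (cases q)
    let ?A = "average (joint X 0 \<omega>) $ k"
    have "(\<Sum>c'\<in>UNIV. noise (c', k, s) \<omega>) =
      (\<Sum>c'\<in>UNIV. X c' s \<omega> $ k) - ((T - s) / T * (\<Sum>c'\<in>UNIV. X c' 0 \<omega> $ k) + ?C * (s / T * ?A))"
      by (simp add: noise_def sum_subtractf sum.distrib sum_distrib_left)
    also have "\<dots> = ?C * (average (joint X s \<omega>) $ k - ?A)"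
      unfolding average_nth using Ts by (simp add: field_simps)
    finally have s: "\<beta> / ?C * (\<Sum>c'\<in>UNIV. noise (c', k, s) \<omega>) = \<beta> * (average (joint X s \<omega>) $ k - ?A)" by simp
    have 1: "(T - t) / T = \<alpha> * ((T - s) / T)" unfolding ab(2)[symmetric] by simp
    have 2: "t / T = \<alpha> * (s / T) + \<beta>" using ab(1) by simp
    have "(\<Sum>p\<in>F q. w q p * noise p \<omega>) = X c t \<omega> $ k - \<alpha> * X c s \<omega> $ k - \<beta> * average (joint X s \<omega>) $ k"
      unfolding q sumw s unfolding noise_def prod.case 1 2 by (simp add: algebra_simps)
    also have "\<dots> = transition_residual s t q \<omega>"
      by (simp add: transition_residual_def stack_def cond_mean_def joint_def q \<alpha>_def \<beta>_def)
    finally show ?thesis .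
  qed
  have "gaussian_field M (functionals (UNIV \<times> UNIV \<times> {s})) UNIV
     (\<lambda>q q'. \<Sum>p\<in>F q. \<Sum>p'\<in>F q'. w q p * w q' p' * noise_cov T p p') (\<lambda>q \<omega>. \<Sum>p\<in>F q. w q p * noise p \<omega>)"
  proof (rule gaussian_field_residual[OF noise_gaussian_field])
    show "(\<Sum>p\<in>F q. w q p * noise_cov T i p) = 0" if "i \<in> UNIV \<times> UNIV \<times> {s}" for i q
      using orth[OF that, of q] by (simp add: sym)
  qed (use orth st in \<open>auto simp: F_def\<close>)
  then show ?thesis unfolding cov res by simp
qed

text \<open>The kernel is the fixed law of the residual translated by the conditional mean, hence
  Gaussian for every \<open>x\<close> and not merely for almost every one.\<close>

lemma transition_law:
  assumes st: "0 \<le> s" "s < t" "t \<le> T"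
  shows "\<exists>K. regular_cond_law M borel (joint X s) borel (\<lambda>\<omega>. stack (joint X t \<omega>)) K \<and>
    (\<forall>x. multivariate_normal (K x) (stack (cond_mean T s t x)) (kronecker (cond_Sigma T s t) (mat 1)))"
proof -
  interpret prob_space M by (rule prob)
  define R where "R \<omega> = stack (joint X t \<omega>) - stack (cond_mean T s t (joint X s \<omega>))" for \<omega>
  let ?E = "UNIV \<times> UNIV \<times> {s} :: ('c \<times> 'd \<times> real) set"
  let ?D = "UNIV :: ('c \<times> 'd) set"
  let ?V = "kronecker (cond_Sigma T s t) (mat 1) :: real^('c \<times> 'd)^('c \<times> 'd)"
  note fld = transition_residual_field[OF st]
  have Rn: "R \<omega> $ q = transition_residual s t q \<omega>" for q \<omega> by (simp add: R_def transition_residual_def)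
  have E: "?E \<subseteq> UNIV \<times> UNIV \<times> {0..T}" using st by auto
  have Xs: "joint X s \<omega> = (\<lambda>\<phi>. \<chi> c k. \<phi> (c, k, s)) (\<lambda>p\<in>?E. state p \<omega>)" for \<omega>
    by (simp add: joint_def vec_eq_iff)
  have Rg: "R \<omega> = (\<lambda>\<phi>. \<chi> q. \<phi> q) (\<lambda>q\<in>?D. transition_residual s t q \<omega>)" for \<omega>
    by (simp add: vec_eq_iff Rn)
  have f: "(\<lambda>\<phi>. \<chi> c k. \<phi> (c, k, s)) \<in> (\<Pi>\<^sub>M p\<in>?E. borel) \<rightarrow>\<^sub>M (borel :: (real^'d^'c) measure)"
    by (intro borel_measurable_vec) (auto intro!: measurable_component_singleton)
  have g: "(\<lambda>\<phi>. \<chi> q. \<phi> q) \<in> (\<Pi>\<^sub>M q\<in>?D. borel) \<rightarrow>\<^sub>M (borel :: (real^('c \<times> 'd)) measure)"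
    by (intro borel_measurable_vec) (auto intro!: measurable_component_singleton)
  have ind: "distr M (borel \<Otimes>\<^sub>M borel) (\<lambda>\<omega>. (joint X s \<omega>, R \<omega>)) = distr M borel (joint X s) \<Otimes>\<^sub>M distr M borel R"
    using residual_indep[OF fld E f g] unfolding Xs[symmetric] Rg[symmetric] .
  have jX[measurable]: "joint X s \<in> borel_measurable M"
    using st by (intro borel_measurable_vec) (auto simp: joint_def intro!: measurable_compose[OF meas borel_measurable_nth])
  have R[measurable]: "R \<in> borel_measurable M"
    unfolding Rg using gaussian_fieldD(2)[OF fld] by (intro borel_measurable_vec) simp
  have cm[measurable]: "(\<lambda>x. stack (cond_mean T s t x)) \<in> borel_measurable (borel :: (real^'d^'c) measure)"
    using st by (intro borel_measurable_continuous_onI) (auto simp: stack_def cond_mean_def average_def intro!: continuous_intros)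
  have "regular_cond_law M borel (joint X s) borel (\<lambda>\<omega>. stack (joint X t \<omega>))
     (\<lambda>x. distr (distr M borel R) borel (\<lambda>r. stack (cond_mean T s t x) + r))"
    by (rule regular_cond_law_residual[OF prob jX R ind]) (auto simp: R_def)
  moreover have "multivariate_normal (distr (distr M borel R) borel (\<lambda>r. stack (cond_mean T s t x) + r))
     (stack (cond_mean T s t x)) ?V" for x
    unfolding multivariate_normal_def
  proof (intro conjI allI)
    let ?m = "stack (cond_mean T s t x)"
    show "prob_space (distr (distr M borel R) borel (\<lambda>r. ?m + r))"
      by (intro prob_space.prob_space_distr[OF prob_space_distr]) auto
    show "transpose ?V = ?V"
      by (auto simp: transpose_def kronecker_def cond_Sigma_def mat_def vec_eq_iff)
    fix a :: "real^('c \<times> 'd)"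
    have q: "a \<bullet> (?V *v a) = (\<Sum>i\<in>UNIV. \<Sum>j\<in>UNIV. a $ i * a $ j * ?V $ i $ j)"
      by (simp add: inner_vec_def matrix_vector_mult_def sum_distrib_left mult_ac)
    have "distr (distr (distr M borel R) borel (\<lambda>r. ?m + r)) borel (\<lambda>y. a \<bullet> y) =
       distr M borel (\<lambda>\<omega>. a \<bullet> ?m + (\<Sum>q\<in>UNIV. a $ q * transition_residual s t q \<omega>))"
      by (subst distr_distr, simp, simp, subst distr_distr, simp, simp)
        (simp add: comp_def inner_add_right, simp add: inner_vec_def Rn)
    also have "normal_law \<dots> (a \<bullet> ?m) (\<Sum>i\<in>UNIV. \<Sum>j\<in>UNIV. a $ i * a $ j * ?V $ i $ j)"
      by (rule gaussian_field_normal_law[OF prob fld zero_functional]) auto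
    finally show "normal_law (distr (distr (distr M borel R) borel (\<lambda>r. ?m + r)) borel (\<lambda>y. a \<bullet> y)) (a \<bullet> ?m) (a \<bullet> (?V *v a))"
      unfolding q .
  qed simp
  ultimately show ?thesis by blast
qed

section \<open>Regression of one particle on its two endpoint positions\<close>

definition bridge_residual :: "'c \<Rightarrow> real \<Rightarrow> real \<Rightarrow> real \<times> 'd \<Rightarrow> 'a \<Rightarrow> real" where
  "bridge_residual c s t = (\<lambda>(u, k) \<omega>. X c u \<omega> $ k - ((t - u) / (t - s) * X c s \<omega> $ k + (u - s) / (t - s) * X c t \<omega> $ k))"

text \<open>Within one particle and coordinate the noise covariance is
  \<open>min u v - \<kappa> * (u * v)\<close>. The weights \<open>\<alpha> u\<close>,
  \<open>\<beta> u\<close> reproduce functions affine in time, so the term with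
  \<open>\<kappa>\<close> disappears (\<open>key\<close>) and the remaining computation is that for
  Brownian motion.\<close>

lemma bridge_residual_field:
  assumes st: "0 \<le> s" "s < t" "t \<le> T"
  shows "gaussian_field M (functionals ({c} \<times> UNIV \<times> {s, t})) ({s..t} \<times> UNIV)
     (\<lambda>(u, k) (v, l). if k = l then (min u v - s) * (t - max u v) / (t - s) else 0) (bridge_residual c s t)"
proof -
  define \<alpha> where "\<alpha> u = (t - u) / (t - s)" for u
  define \<beta> where "\<beta> u = (u - s) / (t - s)" for u
  define \<kappa> where "\<kappa> = 1 / T - 1 / (real CARD('c) * T)"
  define F where "F j = {(c, snd j, fst j), (c, snd j, s), (c, snd j, t)}" for j :: "real \<times> 'd"
  \<comment> \<open>The three indicators are added because at \<open>u = s\<close> or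
    \<open>u = t\<close> two of the indices in \<open>F j\<close> coincide; \<open>sumw\<close> then
    holds without a case distinction.\<close>
  define w where "w j p = (if p = (c, snd j, fst j) then 1 else 0) - \<alpha> (fst j) * (if p = (c, snd j, s) then 1 else 0)
     - \<beta> (fst j) * (if p = (c, snd j, t) then 1 else 0)" for j :: "real \<times> 'd" and p
  have sumw: "(\<Sum>p\<in>F (u, k). w (u, k) p * f p) = f (c, k, u) - \<alpha> u * f (c, k, s) - \<beta> u * f (c, k, t)" for u k f
  proof -
    have "w (u, k) p * f p = (if p = (c, k, u) then f p else 0) - \<alpha> u * (if p = (c, k, s) then f p else 0) - \<beta> u * (if p = (c, k, t) then f p else 0)" for p
      by (simp add: w_def algebra_simps)
    then show ?thesis by (simp add: sum_subtractf sum_distrib_left[symmetric] F_def)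
  qed
  have ab: "\<alpha> u + \<beta> u = 1" "\<alpha> u * s + \<beta> u * t = u" for u
    using st by (simp_all add: \<alpha>_def \<beta>_def divide_simps) (simp_all add: algebra_simps)
  have nc: "noise_cov T (c, k, u) (c, l, v) = (if k = l then min u v - \<kappa> * (u * v) else 0)" for k l u v
    by (simp add: noise_cov_def \<kappa>_def algebra_simps)
  have sym: "noise_cov T p q = noise_cov T q p" for p q :: "'c \<times> 'd \<times> real"
    by (auto simp: noise_cov_def case_prod_unfold mult.commute min.commute)
  have key: "(min u v - \<kappa> * (u * v)) - \<alpha> u * (min s v - \<kappa> * (s * v)) - \<beta> u * (min t v - \<kappa> * (t * v)) =
      min u v - \<alpha> u * min s v - \<beta> u * min t v" for u v
  proof -
    have "\<kappa> * (u * v) = \<kappa> * ((\<alpha> u * s + \<beta> u * t) * v)" by (simp only: ab)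
    then show ?thesis by (simp add: algebra_simps)
  qed
  have orth: "(\<Sum>p\<in>F j. w j p * noise_cov T p i) = 0" if i: "i \<in> {c} \<times> UNIV \<times> {s, t}" and j: "j \<in> {s..t} \<times> UNIV" for i j
  proof -
    obtain u k where uk: "j = (u, k)" "u \<in> {s..t}" using j by auto
    obtain l v where i': "i = (c, l, v)" and v: "v = s \<or> v = t" using i by auto
    have 0: "min u v - \<alpha> u * min s v - \<beta> u * min t v = 0"
    proof -
      have "min u v = (if v = s then s else u)" "min s v = s" "min t v = v" using uk v st by auto
      then show ?thesis using v ab[of u] st
        by (auto simp: distrib_right[symmetric] diff_diff_eq)
    qed
    show ?thesis
    proof (cases "k = l")
      case True
      show ?thesis unfolding uk sumw i' nc using True key[of u v] 0 by (simp only: simp_thms if_True)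
    qed (simp add: uk sumw i' nc)
  qed
  have cov: "(\<Sum>p\<in>F j. \<Sum>p'\<in>F j'. w j p * w j' p' * noise_cov T p p') =
     (case j of (u, k) \<Rightarrow> case j' of (v, l) \<Rightarrow> if k = l then (min u v - s) * (t - max u v) / (t - s) else 0)"
    if j: "j \<in> {s..t} \<times> UNIV" and j': "j' \<in> {s..t} \<times> UNIV" for j j'
  proof -
    obtain u k where uk: "j = (u, k)" "u \<in> {s..t}" using j by auto
    obtain v l where vl: "j' = (v, l)" "v \<in> {s..t}" using j' by auto
    have "(\<Sum>p\<in>F j. \<Sum>p'\<in>F j'. w j p * w j' p' * noise_cov T p p') = (\<Sum>p'\<in>F j'. w j' p' * (\<Sum>p\<in>F j. w j p * noise_cov T p p'))"
      by (subst sum.swap) (simp add: sum_distrib_left mult_ac)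
    also have "\<dots> = (\<Sum>p\<in>F j. w j p * noise_cov T p (c, l, v))"
      unfolding vl sumw using orth[OF _ j, of "(c, l, s)"] orth[OF _ j, of "(c, l, t)"] by simp
    also have "\<dots> = (if k = l then min u v - \<alpha> u * min s v - \<beta> u * min t v else 0)"
      unfolding uk sumw nc using key[of u v] by (cases "k = l") (simp_all only: simp_thms if_True if_False mult_zero_right diff_zero)
    also have "min u v - \<alpha> u * min s v - \<beta> u * min t v = (min u v - s) * (t - max u v) / (t - s)"
    proof -
      have "min s v = s" "min t v = v" using vl by auto
      moreover have "u \<le> v \<or> v \<le> u" by linarith
      ultimately show ?thesis
        unfolding \<alpha>_def \<beta>_def using st by (auto simp: min_def max_def divide_simps) (simp_all add: algebra_simps)
    qed
    finally show ?thesis by (simp add: uk vl)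
  qed
  have res: "(\<Sum>p\<in>F j. w j p * noise p \<omega>) = bridge_residual c s t j \<omega>" for j \<omega>
  proof -
    obtain u k where uk: "j = (u, k)" by (cases j)
    have 1: "(T - u) / T = \<alpha> u * ((T - s) / T) + \<beta> u * ((T - t) / T)"
    proof -
      have "T - u = (\<alpha> u + \<beta> u) * T - (\<alpha> u * s + \<beta> u * t)" by (simp only: ab)
      also have "\<dots> = \<alpha> u * (T - s) + \<beta> u * (T - t)" by (simp add: algebra_simps)
      finally show ?thesis by (simp add: add_divide_distrib)
    qed
    have 2: "u / T = \<alpha> u * (s / T) + \<beta> u * (t / T)"
    proof -
      have "u / T = (\<alpha> u * s + \<beta> u * t) / T" by (simp only: ab)
      then show ?thesis by (simp add: add_divide_distrib)
    qed
    show ?thesis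
      unfolding uk sumw noise_def prod.case bridge_residual_def 1 2 unfolding \<alpha>_def[symmetric] \<beta>_def[symmetric]
      by (simp add: algebra_simps)
  qed
  have "gaussian_field M (functionals ({c} \<times> UNIV \<times> {s, t})) ({s..t} \<times> UNIV)
     (\<lambda>j j'. \<Sum>p\<in>F j. \<Sum>p'\<in>F j'. w j p * w j' p' * noise_cov T p p') (\<lambda>j \<omega>. \<Sum>p\<in>F j. w j p * noise p \<omega>)"
  proof (rule gaussian_field_residual[OF noise_gaussian_field])
    show "(\<Sum>p\<in>F q. w q p * noise_cov T i p) = 0" if "i \<in> {c} \<times> UNIV \<times> {s, t}" "q \<in> {s..t} \<times> UNIV" for i q
      using orth[OF that] by (simp add: sym)
    show "F j \<subseteq> UNIV \<times> UNIV \<times> {0..T}" if "j \<in> {s..t} \<times> UNIV" for j using that st by (auto simp: F_def)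
  qed (use orth st in \<open>auto simp: F_def\<close>)
  then show ?thesis unfolding res by (rule gaussian_field_cov_cong) (use cov in auto)
qed

section \<open>Brownian bridges\<close>

definition chord :: "real \<Rightarrow> real \<Rightarrow> real \<Rightarrow> (real^'d) \<times> (real^'d) \<Rightarrow> real^'d" where
  "chord s t u z = (1 / (t - s)) *\<^sub>R ((t - u) *\<^sub>R fst z + (u - s) *\<^sub>R snd z)"

definition residual_path :: "'c \<Rightarrow> real \<Rightarrow> real \<Rightarrow> 'a \<Rightarrow> real \<Rightarrow> real^'d" where
  "residual_path c s t \<omega> = (\<lambda>u\<in>{s..t}. X c u \<omega> - chord s t u (X c s \<omega>, X c t \<omega>))"

lemma chord_measurable[measurable]: "chord s t u \<in> borel \<Otimes>\<^sub>M borel \<rightarrow>\<^sub>M borel"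
  unfolding chord_def by measurable

lemma residual_path_nth: "u \<in> {s..t} \<Longrightarrow> residual_path c s t \<omega> u $ k = bridge_residual c s t (u, k) \<omega>"
  by (simp add: residual_path_def chord_def bridge_residual_def add_divide_distrib)

lemma state_eq_chord_residual:
  "u \<in> {s..t} \<Longrightarrow> X c u \<omega> = chord s t u (X c s \<omega>, X c t \<omega>) + residual_path c s t \<omega> u"
  by (simp add: residual_path_def)

lemma residual_path_measurable:
  assumes st: "0 \<le> s" "s < t" "t \<le> T"
  shows "residual_path c s t \<in> M \<rightarrow>\<^sub>M (\<Pi>\<^sub>M u\<in>{s..t}. borel)"
proof -
  have [measurable]: "X c u \<in> borel_measurable M" if "u \<in> {s..t}" for u using meas[of u c] that st by auto
  have [measurable]: "X c s \<in> borel_measurable M" "X c t \<in> borel_measurable M" using meas st by auto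
  show ?thesis unfolding residual_path_def by (intro measurable_restrict) measurable
qed

lemma residual_path_indep:
  assumes st: "0 \<le> s" "s < t" "t \<le> T"
  shows "distr M ((borel \<Otimes>\<^sub>M borel) \<Otimes>\<^sub>M (\<Pi>\<^sub>M u\<in>{s..t}. borel)) (\<lambda>\<omega>. ((X c s \<omega>, X c t \<omega>), residual_path c s t \<omega>)) =
    distr M (borel \<Otimes>\<^sub>M borel) (\<lambda>\<omega>. (X c s \<omega>, X c t \<omega>)) \<Otimes>\<^sub>M distr M (\<Pi>\<^sub>M u\<in>{s..t}. borel) (residual_path c s t)"
proof -
  let ?E = "{c} \<times> UNIV \<times> {s, t} :: ('c \<times> 'd \<times> real) set"
  let ?D = "{s..t} \<times> UNIV :: (real \<times> 'd) set"
  let ?f = "\<lambda>\<phi> :: 'c \<times> 'd \<times> real \<Rightarrow> real. (\<chi> k. \<phi> (c, k, s), \<chi> k. \<phi> (c, k, t)) :: (real^'d) \<times> (real^'d)"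
  let ?g = "\<lambda>\<phi> :: real \<times> 'd \<Rightarrow> real. \<lambda>u\<in>{s..t}. (\<chi> k. \<phi> (u, k)) :: real^'d"
  have E: "?E \<subseteq> UNIV \<times> UNIV \<times> {0..T}" using st by auto
  have Xs: "(X c s \<omega>, X c t \<omega>) = ?f (\<lambda>p\<in>?E. state p \<omega>)" for \<omega>
    by (simp add: vec_eq_iff)
  have Rg: "residual_path c s t \<omega> = ?g (\<lambda>q\<in>?D. bridge_residual c s t q \<omega>)" for \<omega>
    by (rule ext, simp add: vec_eq_iff restrict_def residual_path_nth) (simp add: residual_path_def)
  have f: "?f \<in> (\<Pi>\<^sub>M p\<in>?E. borel) \<rightarrow>\<^sub>M borel \<Otimes>\<^sub>M borel"
    by (intro measurable_Pair borel_measurable_vec) (auto intro!: measurable_component_singleton)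
  have g: "?g \<in> (\<Pi>\<^sub>M q\<in>?D. borel) \<rightarrow>\<^sub>M (\<Pi>\<^sub>M u\<in>{s..t}. borel)"
    by (intro measurable_restrict borel_measurable_vec) (auto intro!: measurable_component_singleton)
  show ?thesis
    using residual_indep[OF bridge_residual_field[OF st] E f g] unfolding Xs[symmetric] Rg[symmetric] .
qed

text \<open>\<open>H\<close> is left open so that one independent residual path yields both the law
  of the whole path and the law at a single time.\<close>

lemma bridge_regular_cond_law:
  assumes st: "0 \<le> s" "s < t" "t \<le> T"
    and H: "(\<lambda>(z, \<rho>). H z \<rho>) \<in> (borel \<Otimes>\<^sub>M borel) \<Otimes>\<^sub>M (\<Pi>\<^sub>M u\<in>{s..t}. borel) \<rightarrow>\<^sub>M L"
    and Y: "\<And>\<omega>. Y \<omega> = H (X c s \<omega>, X c t \<omega>) (residual_path c s t \<omega>)"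
  shows "regular_cond_law M (borel \<Otimes>\<^sub>M borel) (\<lambda>\<omega>. (X c s \<omega>, X c t \<omega>)) L Y
     (\<lambda>z. distr (distr M (\<Pi>\<^sub>M u\<in>{s..t}. borel) (residual_path c s t)) L (H z))"
proof -
  have "(\<lambda>\<omega>. (X c s \<omega>, X c t \<omega>)) \<in> M \<rightarrow>\<^sub>M borel \<Otimes>\<^sub>M borel"
    using st by (intro measurable_Pair meas) auto
  then show ?thesis
    by (rule regular_cond_law_residual[OF prob _ residual_path_measurable[OF st] residual_path_indep[OF st] H]) (rule Y)
qed

text \<open>The endpoints \<open>z\<close> are frozen, so they enter only through the mean. Summing
  over coordinates, where the covariance is diagonal, turns products of coefficients into the inner
  products \<open>a u \<bullet> a v\<close>.\<close>

lemma bridge_normal_law: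
  assumes st: "0 \<le> s" "s < t" "t \<le> T" and J: "finite J" "J \<subseteq> {s..t}"
  shows "normal_law (distr M borel (\<lambda>\<omega>. \<Sum>u\<in>J. a u \<bullet> (chord s t u z + residual_path c s t \<omega> u)))
    (\<Sum>u\<in>J. a u \<bullet> chord s t u z) (\<Sum>u\<in>J. \<Sum>v\<in>J. (min u v - s) * (t - max u v) / (t - s) * (a u \<bullet> a v))"
proof -
  let ?\<Gamma> = "\<lambda>(u, k :: 'd) (v, l). if k = l then (min u v - s) * (t - max u v) / (t - s) else 0"
  let ?b = "\<lambda>p. a (fst p) $ snd p"
  have sp: "(\<Sum>p\<in>J \<times> UNIV. g p) = (\<Sum>u\<in>J. \<Sum>k\<in>UNIV. g (u, k))" for g :: "real \<times> 'd \<Rightarrow> real"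
    by (simp add: sum.cartesian_product case_prod_unfold)
  have "normal_law (distr M borel (\<lambda>\<omega>. (\<Sum>u\<in>J. a u \<bullet> chord s t u z) + (\<Sum>p\<in>J \<times> UNIV. ?b p * bridge_residual c s t p \<omega>)))
    (\<Sum>u\<in>J. a u \<bullet> chord s t u z) (\<Sum>p\<in>J \<times> UNIV. \<Sum>q\<in>J \<times> UNIV. ?b p * ?b q * ?\<Gamma> p q)"
    by (rule gaussian_field_normal_law[OF prob bridge_residual_field[OF st] zero_functional]) (use J in auto)
  moreover have "(\<Sum>u\<in>J. a u \<bullet> chord s t u z) + (\<Sum>p\<in>J \<times> UNIV. ?b p * bridge_residual c s t p \<omega>) =
    (\<Sum>u\<in>J. a u \<bullet> (chord s t u z + residual_path c s t \<omega> u))" for \<omega>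
  proof -
    have "(\<Sum>p\<in>J \<times> UNIV. ?b p * bridge_residual c s t p \<omega>) = (\<Sum>u\<in>J. \<Sum>k\<in>UNIV. a u $ k * bridge_residual c s t (u, k) \<omega>)"
      unfolding sp by simp
    also have "\<dots> = (\<Sum>u\<in>J. a u \<bullet> residual_path c s t \<omega> u)"
      using J(2) by (intro sum.cong refl) (auto simp: inner_vec_def residual_path_nth subset_eq)
    finally show ?thesis by (simp add: inner_add_right sum.distrib)
  qed
  moreover have "(\<Sum>p\<in>J \<times> UNIV. \<Sum>q\<in>J \<times> UNIV. ?b p * ?b q * ?\<Gamma> p q) =
     (\<Sum>u\<in>J. \<Sum>v\<in>J. (min u v - s) * (t - max u v) / (t - s) * (a u \<bullet> a v))"
  proof -
    have "(\<Sum>p\<in>J \<times> UNIV. \<Sum>q\<in>J \<times> UNIV. ?b p * ?b q * ?\<Gamma> p q) =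
      (\<Sum>u\<in>J. \<Sum>k\<in>UNIV. \<Sum>v\<in>J. \<Sum>l\<in>UNIV. if k = l then a u $ k * a v $ l * ((min u v - s) * (t - max u v) / (t - s)) else 0)"
      unfolding sp by (intro sum.cong refl) auto
    also have "\<dots> = (\<Sum>u\<in>J. \<Sum>v\<in>J. \<Sum>k\<in>UNIV. a u $ k * a v $ k * ((min u v - s) * (t - max u v) / (t - s)))"
      by (rule sum.cong[OF refl], subst sum.swap) simp
    also have "\<dots> = (\<Sum>u\<in>J. \<Sum>v\<in>J. (min u v - s) * (t - max u v) / (t - s) * (a u \<bullet> a v))"
      unfolding inner_vec_def sum_distrib_left by (simp add: mult_ac)
    finally show ?thesis .
  qed
  ultimately show ?thesis by (simp only:)
qed

lemma bridge_law:
  assumes st: "0 \<le> s" "s < t" "t \<le> T"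
  shows "\<exists>K. regular_cond_law M (borel \<Otimes>\<^sub>M borel) (\<lambda>\<omega>. (X c s \<omega>, X c t \<omega>))
                  (\<Pi>\<^sub>M u\<in>{s..t}. borel) (\<lambda>\<omega>. \<lambda>u\<in>{s..t}. X c u \<omega>) K \<and>
                (\<forall>x y. brownian_bridge_law s t x y (K (x, y)))"
proof -
  let ?Q = "\<Pi>\<^sub>M u\<in>{s..t}. (borel :: (real^'d) measure)"
  let ?H = "\<lambda>z \<rho>. \<lambda>u\<in>{s..t}. chord s t u z + \<rho> u"
  let ?K = "\<lambda>z. distr (distr M ?Q (residual_path c s t)) ?Q (?H z)"
  note rp = residual_path_measurable[OF st, of c]
  have Hm: "(\<lambda>(z, \<rho>). ?H z \<rho>) \<in> (borel \<Otimes>\<^sub>M borel) \<Otimes>\<^sub>M ?Q \<rightarrow>\<^sub>M ?Q"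
    unfolding case_prod_unfold
    by (intro measurable_restrict borel_measurable_add measurable_compose[OF measurable_fst chord_measurable]
        measurable_compose[OF measurable_snd measurable_component_singleton])
  have Hz: "?H z \<in> ?Q \<rightarrow>\<^sub>M ?Q" for z
    by (intro measurable_restrict borel_measurable_add borel_measurable_const measurable_component_singleton)
  have K: "?K z = distr M ?Q (\<lambda>\<omega>. ?H z (residual_path c s t \<omega>))" for z
    by (subst distr_distr[OF Hz rp]) (simp add: comp_def)
  have Hr: "(\<lambda>\<omega>. ?H z (residual_path c s t \<omega>)) \<in> M \<rightarrow>\<^sub>M ?Q" for z
    by (rule measurable_compose[OF rp Hz])
  have "regular_cond_law M (borel \<Otimes>\<^sub>M borel) (\<lambda>\<omega>. (X c s \<omega>, X c t \<omega>)) ?Q (\<lambda>\<omega>. \<lambda>u\<in>{s..t}. X c u \<omega>) ?K"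
    by (rule bridge_regular_cond_law[OF st Hm]) (auto simp: state_eq_chord_residual[symmetric] cong: restrict_cong)
  moreover have "brownian_bridge_law s t x y (?K (x, y))" for x y
    unfolding brownian_bridge_law_def
  proof (intro conjI allI ballI impI)
    let ?z = "(x, y)"
    show pK: "prob_space (?K ?z)" unfolding K by (rule prob_space.prob_space_distr[OF prob Hr])
    show "sets (?K ?z) = sets ?Q" by simp
    show "normal_law (distr (?K ?z) borel (\<lambda>\<omega>. \<Sum>u\<in>J. a u \<bullet> \<omega> u))
          (\<Sum>u\<in>J. a u \<bullet> ((1 / (t - s)) *\<^sub>R ((t - u) *\<^sub>R x + (u - s) *\<^sub>R y)))
          (\<Sum>u\<in>J. \<Sum>v\<in>J. (min u v - s) * (t - max u v) / (t - s) * (a u \<bullet> a v))"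
      if "finite J \<and> J \<subseteq> {s..t}" for J and a :: "real \<Rightarrow> real^'d"
    proof -
      have J: "finite J" "J \<subseteq> {s..t}" using that by auto
      have m: "(\<lambda>\<omega>. \<Sum>u\<in>J. a u \<bullet> \<omega> u) \<in> borel_measurable ?Q"
        using J by (intro borel_measurable_sum borel_measurable_inner borel_measurable_const measurable_component_singleton) auto
      have "distr (?K ?z) borel (\<lambda>\<omega>. \<Sum>u\<in>J. a u \<bullet> \<omega> u) =
        distr M borel (\<lambda>\<omega>. \<Sum>u\<in>J. a u \<bullet> (chord s t u ?z + residual_path c s t \<omega> u))"
        unfolding K distr_distr[OF m Hr] using J by (intro distr_cong refl) (auto simp: comp_def subset_eq intro!: sum.cong)
      then show ?thesis using bridge_normal_law[OF st J, of a ?z c] by (simp add: chord_def)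
    qed
    fix A assume A: "A \<in> sets (?K ?z)" and cont: "{\<omega> \<in> space (?K ?z). continuous_on {s..t} \<omega>} \<subseteq> A"
    then have A': "A \<in> sets ?Q" by simp
    \<comment> \<open>Outer measure 1: replacing the random chord by the fixed chord through
      \<open>x\<close> and \<open>y\<close> preserves continuity, so almost every resulting path
      lies in any measurable \<open>A\<close> containing the continuous ones.\<close>
    have "AE \<omega> in M. ?H ?z (residual_path c s t \<omega>) \<in> A"
      using AE_paths AE_space
    proof eventually_elim
      case (elim \<omega>)
      then have "continuous_on {0..T} (\<lambda>u. X c u \<omega>)" by blast
      then have "continuous_on {s..t} (\<lambda>u. chord s t u ?z + (X c u \<omega> - chord s t u (X c s \<omega>, X c t \<omega>)))"
        unfolding chord_def using st by (intro continuous_intros) (auto elim: continuous_on_subset)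
      then have "continuous_on {s..t} (?H ?z (residual_path c s t \<omega>))"
        by (rule continuous_on_eq) (simp add: residual_path_def)
      moreover have "?H ?z (residual_path c s t \<omega>) \<in> space ?Q"
        using measurable_space[OF Hr elim(2)] .
      ultimately show ?case using cont by auto
    qed
    then have "AE \<omega> in ?K ?z. \<omega> \<in> A"
      unfolding K by (subst AE_distr_iff[OF Hr]) (use A' in auto)
    then show "emeasure (?K ?z) A = 1" using prob_space.emeasure_eq_1_AE[OF pK A] by blast
  qed
  ultimately show ?thesis by blast
qed

text \<open>The bridge computation with the single time \<open>J = {u}\<close>. At
  \<open>u = s\<close> and \<open>u = t\<close> the variance is 0 and the law is the Dirac measure
  at the given endpoint, which \<open>normal_law\<close> admits.\<close>

lemma bridge_marginal_law:
  assumes st: "0 \<le> s" "s < t" "t \<le> T" and u: "u \<in> {s..t}"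
  shows "\<exists>K. regular_cond_law M (borel \<Otimes>\<^sub>M borel) (\<lambda>\<omega>. (X c s \<omega>, X c t \<omega>)) borel (X c u) K \<and>
     (\<forall>x y. multivariate_normal (K (x, y)) ((1 / (t - s)) *\<^sub>R ((t - u) *\<^sub>R x + (u - s) *\<^sub>R y))
        (((u - s) * (t - u) / (t - s)) *\<^sub>R mat 1))"
proof -
  let ?Q = "\<Pi>\<^sub>M u\<in>{s..t}. (borel :: (real^'d) measure)"
  let ?H = "\<lambda>z \<rho>. chord s t u z + \<rho> u"
  let ?K = "\<lambda>z. distr (distr M ?Q (residual_path c s t)) borel (?H z)"
  note rp = residual_path_measurable[OF st, of c]
  have Hm: "(\<lambda>(z, \<rho>). ?H z \<rho>) \<in> (borel \<Otimes>\<^sub>M borel) \<Otimes>\<^sub>M ?Q \<rightarrow>\<^sub>M borel"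
    unfolding case_prod_unfold
    by (intro borel_measurable_add measurable_compose[OF measurable_fst chord_measurable]
        measurable_compose[OF measurable_snd measurable_component_singleton] u)
  have Hz: "?H z \<in> ?Q \<rightarrow>\<^sub>M borel" for z
    by (intro borel_measurable_add borel_measurable_const measurable_component_singleton u)
  have K: "?K z = distr M borel (\<lambda>\<omega>. ?H z (residual_path c s t \<omega>))" for z
    by (subst distr_distr[OF Hz rp]) (simp add: comp_def)
  have Hr: "(\<lambda>\<omega>. ?H z (residual_path c s t \<omega>)) \<in> borel_measurable M" for z
    by (rule measurable_compose[OF rp Hz])
  have reg: "regular_cond_law M (borel \<Otimes>\<^sub>M borel) (\<lambda>\<omega>. (X c s \<omega>, X c t \<omega>)) borel (X c u) ?K"
    by (rule bridge_regular_cond_law[OF st Hm]) (rule state_eq_chord_residual[OF u])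
  have "multivariate_normal (?K z) (chord s t u z) (((u - s) * (t - u) / (t - s)) *\<^sub>R mat 1)" for z
    unfolding multivariate_normal_def
  proof (intro conjI allI)
    show "prob_space (?K z)" unfolding K by (rule prob_space.prob_space_distr[OF prob Hr])
    show "transpose (((u - s) * (t - u) / (t - s)) *\<^sub>R mat 1) = (((u - s) * (t - u) / (t - s)) *\<^sub>R mat 1 :: real^'d^'d)"
      by (auto simp: transpose_def mat_def vec_eq_iff)
    fix a :: "real^'d"
    have "distr (?K z) borel (\<lambda>x. a \<bullet> x) = distr M borel (\<lambda>\<omega>. a \<bullet> (chord s t u z + residual_path c s t \<omega> u))"
      unfolding K by (subst distr_distr[OF _ Hr]) (simp_all add: comp_def)
    then show "normal_law (distr (?K z) borel (\<lambda>x. a \<bullet> x)) (a \<bullet> chord s t u z) (a \<bullet> ((((u - s) * (t - u) / (t - s)) *\<^sub>R mat 1) *v a))"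
      using bridge_normal_law[OF st, of "{u}" "\<lambda>_. a" z c] u by (simp add: scaleR_matrix_vector_assoc[symmetric])
  qed simp
  then have mn: "multivariate_normal (?K z) (chord s t u z) (((u - s) * (t - u) / (t - s)) *\<^sub>R mat 1)" for z .
  have ch: "chord s t u (x, y) = (1 / (t - s)) *\<^sub>R ((t - u) *\<^sub>R x + (u - s) *\<^sub>R y)" for x y
    by (simp add: chord_def)
  have "multivariate_normal (?K (x, y)) ((1 / (t - s)) *\<^sub>R ((t - u) *\<^sub>R x + (u - s) *\<^sub>R y))
      (((u - s) * (t - u) / (t - s)) *\<^sub>R mat 1)" for x y
    using mn[of "(x, y)"] by (simp only: ch)
  with reg show ?thesis by blast
qed

end

theorem theorem2:
  fixes M :: "'a measure"
    and T :: real
    and f :: "'c::finite \<Rightarrow> real^'d::finite \<Rightarrow> real"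
    and W X :: "'c \<Rightarrow> real \<Rightarrow> 'a \<Rightarrow> real^'d"
  assumes prob: "prob_space M"
    and T_pos: "T > 0"
    and dens: "\<And>c. prob_density (f c)"
    and bm: "\<And>c. brownian_motion M (W c)"
    and meas: "\<And>c t. t \<in> {0..T} \<Longrightarrow> X c t \<in> borel_measurable M"
    and init: "\<And>c. distributed M lborel (X c 0) (\<lambda>x. ennreal (f c x))"
    and indep: "prob_space.indep_sets M
        (case_sum
          (\<lambda>c. sets (vimage_algebra (space M) (\<lambda>\<omega>. \<lambda>t\<in>{0..}. W c t \<omega>) (\<Pi>\<^sub>M t\<in>{0..}. borel)))
          (\<lambda>c. sets (vimage_algebra (space M) (X c 0) borel)))
        (UNIV :: ('c + 'c) set)"
    and sde: "sde_solution M T W X"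
    and terminal: "\<And>c. AE \<omega> in M. X c T \<omega> = Lim (at_left T) (\<lambda>t. X c t \<omega>)"
  shows "(\<forall>s t. 0 \<le> s \<and> s < t \<and> t \<le> T \<longrightarrow>
           (\<exists>K. regular_cond_law M borel (joint X s) borel (\<lambda>\<omega>. stack (joint X t \<omega>)) K \<and>
                (\<forall>x. multivariate_normal (K x) (stack (cond_mean T s t x))
                       (kronecker (cond_Sigma T s t) (mat 1)))))
       \<and> (\<forall>c s t. 0 \<le> s \<and> s < t \<and> t \<le> T \<longrightarrow>
           (\<exists>K. regular_cond_law M (borel \<Otimes>\<^sub>M borel) (\<lambda>\<omega>. (X c s \<omega>, X c t \<omega>))
                  (\<Pi>\<^sub>M u\<in>{s..t}. borel) (\<lambda>\<omega>. \<lambda>u\<in>{s..t}. X c u \<omega>) K \<and>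
                (\<forall>x y. brownian_bridge_law s t x y (K (x, y)))) \<and>
           (\<forall>u\<in>{s..t}.
             \<exists>K. regular_cond_law M (borel \<Otimes>\<^sub>M borel) (\<lambda>\<omega>. (X c s \<omega>, X c t \<omega>))
                   borel (X c u) K \<and>
                 (\<forall>x y. multivariate_normal (K (x, y))
                    ((1 / (t - s)) *\<^sub>R ((t - u) *\<^sub>R x + (u - s) *\<^sub>R y))
                    (((u - s) * (t - u) / (t - s)) *\<^sub>R mat 1))))"
proof -
  interpret interacting_system M T W X
    by (intro interacting_system.intro prob T_pos bm meas indep sde terminal)
  show ?thesis
    by (intro conjI allI impI ballI transition_law bridge_law bridge_marginal_law) auto
qed

end
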